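(* Let $k$ be an algebraically closed field of characteristic $p>0$, let $n$ be a positive integer with $p\mid n$, and write $n=pr$. Then the commuting variety of $\mathfrak{pgl}_n$, $$\mathcal{C}_2(\mathfrak{pgl}_n)=\{(A,B)\in\mathfrak{pgl}_n\times\mathfrak{pgl}_n \mid [A,B]=0\},$$ has exactly two irreducible components, one of dimension $n^2+n-2$ and one of dimension $n^2+r-1$.
   Context: Here $\mathfrak{gl}_n=\mathfrak{gl}_n(k)$ is the Lie algebra of all $n\times n$ matrices over $k$ with bracket $[A,B]=AB-BA$, and $\mathfrak{pgl}_n=\mathfrak{gl}_n/kI$ is its quotient by the ideal of scalar matrices, with the induced bracket. $\mathcal{C}_2(\mathfrak{pgl}_n)$ is regarded as a Zariski closed subset of the affine space $\mathfrak{pgl}_n\times\mathfrak{pgl}_n$ (of dimension $2(n^2-1)$). *)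

theory Defs
  imports "HOL-Analysis.Analysis" "HOL-Computational_Algebra.Polynomial"
begin

section \<open>The Lie algebra pgl\<close>

definition matrix_scale :: "'a::times \<Rightarrow> 'a ^ 'n ^ 'm \<Rightarrow> 'a ^ 'n ^ 'm"
  where "matrix_scale c A = (\<chi> i j. c * A $ i $ j)"

lemma mat_mult_nth:
  fixes A :: "'a::comm_ring_1 ^ 'n ^ 'n"
  shows "(mat c ** A) $ i $ j = c * A $ i $ j" "(A ** mat c) $ i $ j = c * A $ i $ j"
  by (simp_all add: matrix_matrix_mult_def mat_def if_distrib if_distribR mult.commute cong: if_cong)

lemma mat_mult_commute:
  fixes A :: "'a::comm_ring_1 ^ 'n ^ 'n"
  shows "mat c ** A = A ** mat c"
  by (simp add: vec_eq_iff mat_mult_nth)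

lemma mat_arith:
  "mat c + mat d = (mat (c + d) :: 'a::comm_ring_1 ^ 'n ^ 'n)"
  "mat c - mat d = (mat (c - d) :: 'a::comm_ring_1 ^ 'n ^ 'n)"
  "- mat c = (mat (- c) :: 'a::comm_ring_1 ^ 'n ^ 'n)"
  "matrix_scale d (mat c) = (mat (d * c) :: 'a::comm_ring_1 ^ 'n ^ 'n)"
  by (auto simp: vec_eq_iff mat_def matrix_scale_def)

definition scalar_rel :: "'a::comm_ring_1 ^ 'n ^ 'n \<Rightarrow> 'a ^ 'n ^ 'n \<Rightarrow> bool"
  where "scalar_rel A B \<longleftrightarrow> (\<exists>c. A - B = mat c)"

lemma equivp_scalar_rel: "equivp scalar_rel"
proof (rule equivpI)
  show "reflp (scalar_rel :: 'a ^ 'n ^ 'n \<Rightarrow> _)"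
    by (auto simp: reflp_def scalar_rel_def intro!: exI[of _ 0])
  show "symp (scalar_rel :: 'a ^ 'n ^ 'n \<Rightarrow> _)"
    unfolding symp_def scalar_rel_def by (metis minus_diff_eq mat_arith(3))
  show "transp (scalar_rel :: 'a ^ 'n ^ 'n \<Rightarrow> _)"
  proof (rule transpI)
    fix A B C :: "'a ^ 'n ^ 'n"
    assume "scalar_rel A B" "scalar_rel B C"
    then obtain c d where "A - B = mat c" "B - C = mat d"
      by (auto simp: scalar_rel_def)
    moreover have "A - C = (A - B) + (B - C)" by simp
    ultimately have "A - C = mat (c + d)"
      by (simp only: mat_arith)
    then show "scalar_rel A C" by (auto simp: scalar_rel_def)
  qed
qed

quotient_type (overloaded) ('a, 'n) pgl = "('a::comm_ring_1) ^ 'n ^ ('n::finite)" / scalar_rel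
  by (rule equivp_scalar_rel)

instantiation pgl :: (comm_ring_1, finite) ab_group_add
begin

lift_definition zero_pgl :: "('a, 'b) pgl" is 0 .

lift_definition plus_pgl :: "('a, 'b) pgl \<Rightarrow> ('a, 'b) pgl \<Rightarrow> ('a, 'b) pgl" is "(+)"
  unfolding scalar_rel_def by (metis add_diff_add mat_arith(1))

lift_definition minus_pgl :: "('a, 'b) pgl \<Rightarrow> ('a, 'b) pgl \<Rightarrow> ('a, 'b) pgl" is "(-)"
proof -
  fix A B C D :: "'a ^ 'b ^ 'b"
  assume "scalar_rel A B" "scalar_rel C D"
  then obtain c d where "A - B = mat c" "C - D = mat d"
    by (auto simp: scalar_rel_def)
  moreover have "(A - C) - (B - D) = (A - B) - (C - D)" by simp
  ultimately show "scalar_rel (A - C) (B - D)"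
    unfolding scalar_rel_def by (metis mat_arith(2))
qed

lift_definition uminus_pgl :: "('a, 'b) pgl \<Rightarrow> ('a, 'b) pgl" is uminus
  unfolding scalar_rel_def by (metis minus_diff_minus mat_arith(3))

instance
  by standard (transfer; simp add: equivp_reflp[OF equivp_scalar_rel] algebra_simps)+

end

lift_definition pgl_scale :: "'a::comm_ring_1 \<Rightarrow> ('a, 'n::finite) pgl \<Rightarrow> ('a, 'n) pgl"
  is matrix_scale
proof -
  fix c and A B :: "'a ^ 'n ^ 'n"
  assume "scalar_rel A B"
  then obtain d where d: "A - B = mat d"
    by (auto simp: scalar_rel_def)
  have "matrix_scale c A - matrix_scale c B = matrix_scale c (A - B)"
    by (simp add: vec_eq_iff matrix_scale_def algebra_simps)
  then show "scalar_rel (matrix_scale c A) (matrix_scale c B)"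
    unfolding scalar_rel_def d mat_arith by blast
qed

lift_definition pgl_bracket ::
  "('a::comm_ring_1, 'n::finite) pgl \<Rightarrow> ('a, 'n) pgl \<Rightarrow> ('a, 'n) pgl"
  is "\<lambda>A B. A ** B - B ** A"
proof -
  fix A A' B B' :: "'a ^ 'n ^ 'n"
  assume "scalar_rel A A'" "scalar_rel B B'"
  then obtain c d where "A - A' = mat c" "B - B' = mat d"
    by (auto simp: scalar_rel_def)
  then have eq: "A = A' + mat c" "B = B' + mat d"
    by (auto simp: algebra_simps)
  have distrib: "(X + Y) ** Z = X ** Z + Y ** Z" for X Y Z :: "'a ^ 'n ^ 'n"
    by (simp add: vec_eq_iff matrix_matrix_mult_def algebra_simps sum.distrib)
  have "A ** B - B ** A = A' ** B' - B' ** A'"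
    unfolding eq
    by (simp add: matrix_add_ldistrib distrib mat_mult_commute[of c B']
        mat_mult_commute[of d A'] mat_mult_commute[of d "mat c"])
  then show "scalar_rel (A ** B - B ** A) (A' ** B' - B' ** A')"
    by (simp add: equivp_reflp[OF equivp_scalar_rel])
qed

global_interpretation pgl: vector_space
  "pgl_scale :: 'a::field \<Rightarrow> ('a, 'n::finite) pgl \<Rightarrow> ('a, 'n) pgl"
proof (unfold_locales; transfer)
  fix a b :: 'a and x y :: "'a ^ 'n ^ 'n"
  have *: "scalar_rel A B" if "A = B" for A B :: "'a ^ 'n ^ 'n"
    using that by (simp add: equivp_reflp[OF equivp_scalar_rel])
  show "scalar_rel (matrix_scale a (x + y)) (matrix_scale a x + matrix_scale a y)"
    "scalar_rel (matrix_scale (a + b) x) (matrix_scale a x + matrix_scale b x)"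
    "scalar_rel (matrix_scale a (matrix_scale b x)) (matrix_scale (a * b) x)"
    "scalar_rel (matrix_scale 1 x) x"
    by (rule *, simp add: vec_eq_iff matrix_scale_def algebra_simps)+
qed

definition pgl2_scale ::
  "'a::comm_ring_1 \<Rightarrow> ('a, 'n::finite) pgl \<times> ('a, 'n) pgl \<Rightarrow> ('a, 'n) pgl \<times> ('a, 'n) pgl"
  where "pgl2_scale c = map_prod (pgl_scale c) (pgl_scale c)"

lemma vector_space_pgl2:
  "vector_space (pgl2_scale :: 'a::field \<Rightarrow> ('a, 'n::finite) pgl \<times> ('a, 'n) pgl \<Rightarrow> _)"
  by unfold_locales
    (auto simp: pgl2_scale_def pgl.scale_right_distrib pgl.scale_left_distrib)

definition commuting_variety_pgl :: "(('a::comm_ring_1, 'n::finite) pgl \<times> ('a, 'n) pgl) set"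
  where "commuting_variety_pgl = {(A, B). pgl_bracket A B = 0}"


section \<open>The Zariski topology of a vector space\<close>

text \<open>
  The algebra of functions generated by the constants and the linear functionals. On a
  finite-dimensional space these are the polynomials in the coordinates with respect to any basis.
\<close>

inductive_set polynomial_functions :: "('a::field \<Rightarrow> 'v::ab_group_add \<Rightarrow> 'v) \<Rightarrow> ('v \<Rightarrow> 'a) set"
  for scl :: "'a \<Rightarrow> 'v \<Rightarrow> 'v"
where
  const: "(\<lambda>_. c) \<in> polynomial_functions scl"
| linear: "Vector_Spaces.linear scl (*) f \<Longrightarrow> f \<in> polynomial_functions scl"
| add: "f \<in> polynomial_functions scl \<Longrightarrow> g \<in> polynomial_functions scl \<Longrightarrow>
    (\<lambda>x. f x + g x) \<in> polynomial_functions scl"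
| mult: "f \<in> polynomial_functions scl \<Longrightarrow> g \<in> polynomial_functions scl \<Longrightarrow>
    (\<lambda>x. f x * g x) \<in> polynomial_functions scl"

definition zero_locus :: "('v \<Rightarrow> 'a::zero) set \<Rightarrow> 'v set"
  where "zero_locus F = {x. \<forall>f\<in>F. f x = 0}"

definition zariski_closed :: "('a::field \<Rightarrow> 'v::ab_group_add \<Rightarrow> 'v) \<Rightarrow> 'v set \<Rightarrow> bool"
  where "zariski_closed scl S \<longleftrightarrow> (\<exists>F \<subseteq> polynomial_functions scl. S = zero_locus F)"

definition zariski :: "('a::field \<Rightarrow> 'v::ab_group_add \<Rightarrow> 'v) \<Rightarrow> 'v topology"
  where "zariski scl = topology (\<lambda>U. zariski_closed scl (- U))"

lemma zariski_closed_Un: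
  assumes "zariski_closed scl S" "zariski_closed scl T"
  shows "zariski_closed scl (S \<union> T)"
proof -
  obtain F G where FG: "F \<subseteq> polynomial_functions scl" "S = zero_locus F"
      "G \<subseteq> polynomial_functions scl" "T = zero_locus G"
    using assms by (auto simp: zariski_closed_def)
  let ?FG = "(\<lambda>(f, g) x. f x * g x) ` (F \<times> G)"
  have "S \<union> T = zero_locus ?FG"
    unfolding FG zero_locus_def by (simp add: set_eq_iff)
  moreover have "?FG \<subseteq> polynomial_functions scl"
    using FG by (auto intro: polynomial_functions.mult)
  ultimately show ?thesis unfolding zariski_closed_def by blast
qed

lemma zariski_closed_Inter:
  assumes "\<And>S. S \<in> \<S> \<Longrightarrow> zariski_closed scl S"
  shows "zariski_closed scl (\<Inter>\<S>)"
proof -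
  define F where "F = {f \<in> polynomial_functions scl. \<exists>S\<in>\<S>. \<forall>x\<in>S. f x = 0}"
  have "\<Inter>\<S> = zero_locus F"
  proof (intro equalityI subsetI InterI)
    fix x assume x: "x \<in> \<Inter>\<S>"
    show "x \<in> zero_locus F"
      unfolding zero_locus_def
    proof (intro CollectI ballI)
      fix f assume "f \<in> F"
      then obtain S where "S \<in> \<S>" "\<forall>y\<in>S. f y = 0"
        unfolding F_def by blast
      with x show "f x = 0" by blast
    qed
  next
    fix x S assume x: "x \<in> zero_locus F" and S: "S \<in> \<S>"
    obtain G where G: "G \<subseteq> polynomial_functions scl" "S = zero_locus G"
      using assms[OF S] unfolding zariski_closed_def by blast
    have "f x = 0" if "f \<in> G" for f
    proof -
      have "\<forall>y\<in>S. f y = 0" using that by (simp add: G(2) zero_locus_def)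
      then have "f \<in> F" using that G(1) S unfolding F_def by blast
      then show ?thesis using x by (simp add: zero_locus_def)
    qed
    then show "x \<in> S" by (simp add: G(2) zero_locus_def)
  qed
  moreover have "F \<subseteq> polynomial_functions scl"
    by (simp add: F_def)
  ultimately show ?thesis
    unfolding zariski_closed_def by (intro exI[of _ F] conjI)
qed

lemma istopology_zariski: "istopology (\<lambda>U. zariski_closed scl (- U))"
  unfolding istopology_def
proof (intro conjI allI impI)
  fix \<K> assume *: "\<forall>K\<in>\<K>. zariski_closed scl (- K)"
  have "zariski_closed scl (\<Inter>(uminus ` \<K>))"
    by (rule zariski_closed_Inter) (use * in auto)
  then show "zariski_closed scl (- \<Union>\<K>)"
    by (simp add: uminus_Sup)
qed (simp add: zariski_closed_Un)

lemma openin_zariski: "openin (zariski scl) U \<longleftrightarrow> zariski_closed scl (- U)"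
  by (simp add: zariski_def istopology_zariski)

lemma topspace_zariski [simp]: "topspace (zariski scl) = UNIV"
proof -
  have "zariski_closed scl (- UNIV)"
    unfolding zariski_closed_def
    by (rule exI[of _ "{\<lambda>_. 1}"]) (auto simp: zero_locus_def intro: polynomial_functions.const)
  then show ?thesis
    using openin_subset openin_zariski top.extremum_unique by metis
qed

lemma closedin_zariski: "closedin (zariski scl) S \<longleftrightarrow> zariski_closed scl S"
  by (simp add: closedin_def openin_zariski Compl_eq_Diff_UNIV[symmetric])


section \<open>Irreducible components and dimension of a topological space\<close>

definition irreducible_in :: "'a topology \<Rightarrow> 'a set \<Rightarrow> bool"
  where "irreducible_in X S \<longleftrightarrow> S \<subseteq> topspace X \<and> S \<noteq> {} \<and>
    (\<forall>C D. closedin X C \<and> closedin X D \<and> S \<subseteq> C \<union> D \<longrightarrow> S \<subseteq> C \<or> S \<subseteq> D)"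

definition irreducible_components :: "'a topology \<Rightarrow> 'a set set"
  where "irreducible_components X =
    {S. irreducible_in X S \<and> (\<forall>T. irreducible_in X T \<and> S \<subseteq> T \<longrightarrow> T = S)}"

text \<open>
  The supremum of the lengths of chains \<open>Z 0 \<subset> \<dots> \<subset> Z m\<close> of irreducible closed subsets.
  The empty space gets dimension 0.
\<close>

definition krull_dim :: "'a topology \<Rightarrow> enat"
  where "krull_dim X = Sup {enat m | m. \<exists>Z.
    (\<forall>i\<le>m. closedin X (Z i) \<and> irreducible_in X (Z i)) \<and> (\<forall>i<m. Z i \<subset> Z (Suc i))}"

end

theory Submission
  imports Defs
begin

text \<open>
  Lift a commuting pair of \<open>pgl\<^sub>n\<close> to matrices with \<open>[A, B] = c\<close> scalar. Some \<open>R\<close> with a cyclic vector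
  commutes with \<open>B\<close>, and \<open>A + t R\<close> is cyclic for almost all \<open>t\<close> while \<open>[A + t R, B] = c\<close>, so the pairs
  with \<open>A\<close> cyclic are dense in both cases \<open>c = 0\<close> and \<open>c \<noteq> 0\<close>. If \<open>A\<close> is cyclic and \<open>c = 0\<close>, then
  \<open>B = q(A)\<close>. If \<open>c \<noteq> 0\<close>, the minimal polynomial of \<open>A\<close> has derivative zero, so it is \<open>f(x\<^sup>p)\<close> with
  \<open>deg f = r\<close>, and in a Krylov basis \<open>A\<close> is multiplication by \<open>x\<close> on \<open>k[x]/(f(x\<^sup>p))\<close> and
  \<open>B = - c d/dx + q(A)\<close>. This makes both closures images of affine spaces, of dimensions \<open>n\<^sup>2 + n - 2\<close>
  (the entries of \<open>A\<close> and the coefficients of \<open>q\<close>, modulo scalars) and \<open>n\<^sup>2 + r - 1\<close> (a normalised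
  change of basis, \<open>f\<close>, \<open>c\<close> and \<open>q\<close>), under maps with generically finite fibres.

  For the dimensions, functions that cut out successive members of a chain of irreducible closed sets
  are algebraically independent, which bounds the length of a chain in the image of an affine space;
  images of coordinate subspaces form a chain of maximal length. The components differ because
  \<open>A\<close> has trace zero whenever \<open>[A, B] = c \<noteq> 0\<close>.
\<close>

text \<open>Taking traces in \<open>[A, B] = c\<close> gives \<open>n c = 0\<close>, so a nonzero
  \<open>c\<close> is possible only because p divides n.

  The parameter counts rest on removing redundancy. In the second family, replacing the cyclic
  vector \<open>v\<close> by \<open>g(A) v\<close> only changes \<open>q\<close>, so
  \<open>v\<close> can be fixed, which takes n parameters away from the base change; the scalar
  shift of \<open>A\<close> takes one more. There remain n(n-1) - 1 entries, r coefficients of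
  \<open>f\<close>, the scalar \<open>c\<close> and n - 1 coefficients of \<open>q\<close>. In the
  first family there are n^2 - 1 entries and n - 1 coefficients. The price of fixing
  \<open>v\<close> is a second deformation, since a cyclic \<open>A\<close> need not have the
  prescribed vector as a cyclic vector.

  Inverses and roots are not polynomial, so the parameters of a pair are not recovered by polynomial
  formulas. They are only tested by polynomial conditions, built from Cramer determinants and from
  powers that eliminate an unknown determinant; finitely many candidate values for each parameter
  are enough for the dimension.\<close>

section \<open>Algebras of polynomial functions\<close>

text \<open>Polynomial functions on the target space and polynomials in the parameters share these
  closure rules, so that determinants, Krylov matrices and adjugates are shown to be polynomial once
  for both.\<close>

locale function_algebra =
  fixes \<A> :: "('x \<Rightarrow> 'a::comm_ring_1) set"
  assumes const: "(\<lambda>_. c) \<in> \<A>"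
    and add: "f \<in> \<A> \<Longrightarrow> g \<in> \<A> \<Longrightarrow> (\<lambda>x. f x + g x) \<in> \<A>"
    and mult: "f \<in> \<A> \<Longrightarrow> g \<in> \<A> \<Longrightarrow> (\<lambda>x. f x * g x) \<in> \<A>"
begin

lemma uminus: "f \<in> \<A> \<Longrightarrow> (\<lambda>x. - f x) \<in> \<A>"
  using mult[OF const[of "-1"]] by simp

lemma diff: "f \<in> \<A> \<Longrightarrow> g \<in> \<A> \<Longrightarrow> (\<lambda>x. f x - g x) \<in> \<A>"
  using add[OF _ uminus] by simp

lemma power: "f \<in> \<A> \<Longrightarrow> (\<lambda>x. f x ^ k) \<in> \<A>"
  by (induction k) (auto intro: const mult)

lemma sum: "(\<And>i. i \<in> S \<Longrightarrow> f i \<in> \<A>) \<Longrightarrow> (\<lambda>x. \<Sum>i\<in>S. f i x) \<in> \<A>"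
  by (induction S rule: infinite_finite_induct) (auto intro: const add)

lemma prod: "(\<And>i. i \<in> S \<Longrightarrow> f i \<in> \<A>) \<Longrightarrow> (\<lambda>x. \<Prod>i\<in>S. f i x) \<in> \<A>"
  by (induction S rule: infinite_finite_induct) (auto intro: const mult)

lemma if_const: "(P \<Longrightarrow> f \<in> \<A>) \<Longrightarrow> (\<not> P \<Longrightarrow> g \<in> \<A>) \<Longrightarrow> (\<lambda>x. if P then f x else g x) \<in> \<A>"
  by (cases P) simp_all

lemma det:
  fixes A :: "'x \<Rightarrow> 'a ^ 'n ^ 'n"
  assumes "\<And>i j. (\<lambda>x. A x $ i $ j) \<in> \<A>"
  shows "(\<lambda>x. det (A x)) \<in> \<A>"
  unfolding det_def by (intro sum mult const prod assms)

lemma matrix_mult: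
  fixes A B :: "'x \<Rightarrow> 'a ^ 'n ^ 'n"
  assumes "\<And>i j. (\<lambda>x. A x $ i $ j) \<in> \<A>" "\<And>i j. (\<lambda>x. B x $ i $ j) \<in> \<A>"
  shows "(\<lambda>x. (A x ** B x) $ i $ j) \<in> \<A>"
  unfolding matrix_matrix_mult_def by (simp, intro sum mult assms)

lemma matrix_vector_mult:
  fixes A :: "'x \<Rightarrow> 'a ^ 'n ^ 'n"
  assumes "\<And>i j. (\<lambda>x. A x $ i $ j) \<in> \<A>" "\<And>i. (\<lambda>x. v x $ i) \<in> \<A>"
  shows "(\<lambda>x. (A x *v v x) $ i) \<in> \<A>"
  unfolding matrix_vector_mult_def by (simp, intro sum mult assms)

end

interpretation poly_alg: function_algebra "polynomial_functions scl"
  by unfold_locales (auto intro: polynomial_functions.intros)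

text \<open>Polynomials are kept as functions on all assignments: over an infinite field nothing is
  lost, and composition is plain substitution.\<close>

inductive_set coord_polys :: "'i set \<Rightarrow> (('i \<Rightarrow> 'a::comm_ring_1) \<Rightarrow> 'a) set" for I
where
  const: "(\<lambda>_. c) \<in> coord_polys I"
| coord: "i \<in> I \<Longrightarrow> (\<lambda>x. x i) \<in> coord_polys I"
| add: "f \<in> coord_polys I \<Longrightarrow> g \<in> coord_polys I \<Longrightarrow> (\<lambda>x. f x + g x) \<in> coord_polys I"
| mult: "f \<in> coord_polys I \<Longrightarrow> g \<in> coord_polys I \<Longrightarrow> (\<lambda>x. f x * g x) \<in> coord_polys I"

interpretation coord_alg: function_algebra "coord_polys I"
  by unfold_locales (auto intro: coord_polys.intros)

lemma coord_polys_compose: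
  assumes "f \<in> coord_polys I" "\<And>i. i \<in> I \<Longrightarrow> (\<lambda>x. g x i) \<in> coord_polys J"
  shows "(\<lambda>x. f (g x)) \<in> coord_polys J"
  using assms by (induction rule: coord_polys.induct) (auto intro: coord_polys.intros)

lemma coord_polys_line:
  fixes f :: "('i \<Rightarrow> 'a::comm_ring_1) \<Rightarrow> 'a"
  assumes "f \<in> coord_polys I"
  shows "\<exists>P. \<forall>t. f (\<lambda>i. a i + t * (b i - a i)) = poly P t"
  using assms
proof (induction rule: coord_polys.induct)
  case (const c)
  show ?case by (rule exI[of _ "[:c:]"]) simp
next
  case (coord i)
  show ?case by (rule exI[of _ "[:a i, b i - a i:]"]) simp
next
  case (add f g)
  then show ?case by (metis poly_add)
next
  case (mult f g)
  then show ?case by (metis poly_mult)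
qed

lemma poly_eq_0_infinite:
  fixes P :: "'a::idom poly"
  assumes "infinite (UNIV :: 'a set)" "\<And>t. poly P t = 0"
  shows "P = 0"
  using assms poly_roots_finite[of P] by auto

text \<open>On the line through \<open>a\<close> and \<open>b\<close> both functions become nonzero
  univariate polynomials, whose product has a nonroot in an infinite field. This is the
  irreducibility of affine space and the source of every density argument below.\<close>

lemma coord_polys_common_nonzero:
  fixes f g :: "('i \<Rightarrow> 'a::idom) \<Rightarrow> 'a"
  assumes inf: "infinite (UNIV :: 'a set)"
    and fg: "f \<in> coord_polys I" "g \<in> coord_polys I" and "f a \<noteq> 0" "g b \<noteq> 0"
  obtains x where "f x \<noteq> 0" "g x \<noteq> 0"
proof -
  let ?l = "\<lambda>t i. a i + t * (b i - a i)"
  obtain P Q where P: "\<And>t. f (?l t) = poly P t" and Q: "\<And>t. g (?l t) = poly Q t"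
    using coord_polys_line[OF fg(1)] coord_polys_line[OF fg(2)] by meson
  have "P \<noteq> 0" using P[of 0] assms by auto
  moreover have "Q \<noteq> 0" using Q[of 1] assms by auto
  ultimately obtain t where "poly (P * Q) t \<noteq> 0"
    using poly_eq_0_infinite[OF inf, of "P * Q"] by auto
  then show thesis using that[of "?l t"] P Q by simp
qed

section \<open>Polynomial maps\<close>

text \<open>Pulling back functions avoids the choice of a basis of the target.\<close>

definition polynomial_map ::
  "('a::field \<Rightarrow> 'v::ab_group_add \<Rightarrow> 'v) \<Rightarrow> 'i set \<Rightarrow> (('i \<Rightarrow> 'a) \<Rightarrow> 'v) \<Rightarrow> bool"
  where "polynomial_map scl I \<phi> \<longleftrightarrow> (\<forall>F\<in>polynomial_functions scl. (\<lambda>x. F (\<phi> x)) \<in> coord_polys I)"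

lemma polynomial_mapI:
  assumes "\<And>f. Vector_Spaces.linear scl (*) f \<Longrightarrow> (\<lambda>x. f (\<phi> x)) \<in> coord_polys I"
  shows "polynomial_map scl I \<phi>"
  unfolding polynomial_map_def
proof
  fix F assume "F \<in> polynomial_functions scl"
  then show "(\<lambda>x. F (\<phi> x)) \<in> coord_polys I"
    by (induction rule: polynomial_functions.induct) (auto intro: coord_polys.intros assms)
qed

lemma closedin_zero_set:
  "F \<in> polynomial_functions scl \<Longrightarrow> closedin (zariski scl) {x. F x = 0}"
  unfolding closedin_zariski zariski_closed_def
  by (rule exI[of _ "{F}"]) (auto simp: zero_locus_def)

lemma closedin_zariski_separate:
  assumes "closedin (zariski scl) Z" "x \<notin> Z"
  obtains F where "F \<in> polynomial_functions scl" "\<And>z. z \<in> Z \<Longrightarrow> F z = 0" "F x \<noteq> 0"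
proof -
  obtain G where "G \<subseteq> polynomial_functions scl" "Z = zero_locus G"
    using assms(1) unfolding closedin_zariski zariski_closed_def by blast
  with assms(2) that show thesis unfolding zero_locus_def by blast
qed

lemma zariski_closure_vanish:
  assumes "F \<in> polynomial_functions scl" "\<And>x. x \<in> S \<Longrightarrow> F x = 0" "x \<in> zariski scl closure_of S"
  shows "F x = 0"
  using closure_of_minimal[OF _ closedin_zero_set[OF assms(1)], of S] assms(2,3) by auto

lemma subset_zariski_closure: "S \<subseteq> zariski scl closure_of S"
  by (rule closure_of_subset) simp

text \<open>The locus \<open>\<delta> x \<noteq> 0\<close> is dense: a function that separates
  \<open>\<phi> x\<close> from \<open>Z\<close> pulls back to a polynomial that is nonzero at some
  point where \<open>\<delta>\<close> is nonzero as well.\<close>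

lemma polynomial_map_dense:
  fixes \<phi> :: "('i \<Rightarrow> 'a::field) \<Rightarrow> 'v::ab_group_add"
  assumes inf: "infinite (UNIV :: 'a set)" and pm: "polynomial_map scl I \<phi>"
    and Z: "closedin (zariski scl) Z" and \<delta>: "\<delta> \<in> coord_polys I" "\<delta> b \<noteq> 0"
    and *: "\<And>x. \<delta> x \<noteq> 0 \<Longrightarrow> \<phi> x \<in> Z"
  shows "\<phi> x \<in> Z"
proof (rule ccontr)
  assume "\<phi> x \<notin> Z"
  then obtain F where F: "F \<in> polynomial_functions scl" "\<And>z. z \<in> Z \<Longrightarrow> F z = 0" "F (\<phi> x) \<noteq> 0"
    using closedin_zariski_separate[OF Z] by metis
  have "(\<lambda>x. F (\<phi> x)) \<in> coord_polys I"
    using pm F by (simp add: polynomial_map_def)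
  from coord_polys_common_nonzero[OF inf this \<delta>(1), OF F(3) \<delta>(2)]
  obtain y where "F (\<phi> y) \<noteq> 0" "\<delta> y \<noteq> 0" by blast
  with * F(2) show False by blast
qed

text \<open>If the image lay in neither \<open>C\<close> nor \<open>D\<close>, functions vanishing
  on \<open>C\<close> and on \<open>D\<close> would pull back to polynomials with a common nonzero
  point, whose image is outside both sets.\<close>

lemma irreducible_in_polynomial_image:
  fixes \<phi> :: "('i \<Rightarrow> 'a::field) \<Rightarrow> 'v::ab_group_add"
  assumes inf: "infinite (UNIV :: 'a set)" and pm: "polynomial_map scl I \<phi>"
  shows "irreducible_in (zariski scl) (zariski scl closure_of range \<phi>)"
  unfolding irreducible_in_def
proof (intro conjI allI impI)
  show "zariski scl closure_of range \<phi> \<noteq> {}"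
    using subset_zariski_closure[of "range \<phi>" scl] by blast
next
  fix C D assume CD: "closedin (zariski scl) C \<and> closedin (zariski scl) D \<and>
    zariski scl closure_of range \<phi> \<subseteq> C \<union> D"
  have CD': "\<phi> x \<in> C \<union> D" for x
    using CD subset_zariski_closure[of "range \<phi>" scl] by blast
  have "range \<phi> \<subseteq> C \<or> range \<phi> \<subseteq> D"
  proof (rule ccontr)
    assume "\<not> ?thesis"
    then obtain a b where ab: "\<phi> a \<notin> C" "\<phi> b \<notin> D" by blast
    obtain F where F: "F \<in> polynomial_functions scl" "\<And>z. z \<in> C \<Longrightarrow> F z = 0" "F (\<phi> a) \<noteq> 0"
      using closedin_zariski_separate CD ab(1) by metis
    obtain G where G: "G \<in> polynomial_functions scl" "\<And>z. z \<in> D \<Longrightarrow> G z = 0" "G (\<phi> b) \<noteq> 0"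
      using closedin_zariski_separate CD ab(2) by metis
    have "(\<lambda>x. F (\<phi> x)) \<in> coord_polys I" "(\<lambda>x. G (\<phi> x)) \<in> coord_polys I"
      using pm F(1) G(1) by (auto simp: polynomial_map_def)
    from coord_polys_common_nonzero[OF inf this, OF F(3) G(3)]
    obtain y where "F (\<phi> y) \<noteq> 0" "G (\<phi> y) \<noteq> 0" by blast
    with CD'[of y] F(2) G(2) show False by blast
  qed
  then show "zariski scl closure_of range \<phi> \<subseteq> C \<or> zariski scl closure_of range \<phi> \<subseteq> D"
    using CD closure_of_minimal by metis
qed simp

section \<open>Counting monomials\<close>

text \<open>Gaussian elimination, one equation at a time. Equations and unknowns are arbitrary
  finite sets, so that monomials can index them.\<close>

lemma homogeneous_system:
  fixes a :: "'e \<Rightarrow> 'u \<Rightarrow> 'a::field"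
  assumes "finite E" "finite U" "card E < card U"
  shows "\<exists>y. (\<exists>u\<in>U. y u \<noteq> 0) \<and> (\<forall>e\<in>E. (\<Sum>u\<in>U. y u * a e u) = 0)"
  using assms
proof (induction E arbitrary: U a rule: finite_induct)
  case empty
  then show ?case by (intro exI[of _ "\<lambda>_. 1"]) (auto simp: card_gt_0_iff)
next
  case (insert e E)
  show ?case
  proof (cases "\<forall>u\<in>U. a e u = 0")
    case True
    have "card E < card U" using insert by simp
    from insert.IH[OF insert.prems(1) this, of a] True show ?thesis by auto
  next
    case False
    then obtain w where w: "w \<in> U" "a e w \<noteq> 0" by blast
    let ?U = "U - {w}"
    \<comment> \<open>The coefficients after equation \<open>e\<close> has been used to eliminate
      the unknown \<open>w\<close>.\<close>
    let ?a = "\<lambda>e' u. a e' u - a e u / a e w * a e' w"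
    have "card E < card ?U" using insert w by simp
    from insert.IH[OF _ this, of ?a] insert.prems
    obtain y where y: "\<exists>u\<in>?U. y u \<noteq> 0" "\<And>e'. e' \<in> E \<Longrightarrow> (\<Sum>u\<in>?U. y u * ?a e' u) = 0"
      by auto
    define s where "s = (\<Sum>u\<in>?U. y u * a e u)"
    define z where "z = y(w := - s / a e w)"
    have z_w: "z w = - s / a e w" by (simp add: z_def)
    have split: "(\<Sum>u\<in>U. z u * a e' u) = z w * a e' w + (\<Sum>u\<in>?U. y u * a e' u)" for e'
    proof -
      have "(\<Sum>u\<in>U. z u * a e' u) = z w * a e' w + (\<Sum>u\<in>?U. z u * a e' u)"
        using insert.prems w by (simp add: sum.remove)
      moreover have "(\<Sum>u\<in>?U. z u * a e' u) = (\<Sum>u\<in>?U. y u * a e' u)"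
        by (rule sum.cong) (auto simp: z_def)
      ultimately show ?thesis by simp
    qed
    have "(\<Sum>u\<in>U. z u * a e' u) = 0" if "e' \<in> insert e E" for e'
    proof (cases "e' = e")
      case True
      then show ?thesis using w split[of e] by (simp add: z_w s_def)
    next
      case F: False
      have "0 = (\<Sum>u\<in>?U. y u * a e' u - y u * a e u * (a e' w / a e w))"
        using y(2)[of e'] that F by (simp add: algebra_simps)
      also have "\<dots> = (\<Sum>u\<in>?U. y u * a e' u) - s * (a e' w / a e w)"
        by (simp add: sum_subtractf sum_distrib_right sum_divide_distrib s_def)
      finally show ?thesis using split[of e'] by (simp add: z_w)
    qed
    moreover have "\<exists>u\<in>U. z u \<noteq> 0" using y(1) by (auto simp: z_def)
    ultimately show ?thesis by blast
  qed
qed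

text \<open>The degree is bounded in each variable separately, so that the exponents form a box with
  \<open>(D + 1) ^ card I\<close> points.\<close>

definition bounded_degree :: "'i set \<Rightarrow> nat \<Rightarrow> (('i \<Rightarrow> 'a::comm_ring_1) \<Rightarrow> 'a) set"
  where "bounded_degree I D =
    {f. \<exists>c. \<forall>x. f x = (\<Sum>e\<in>PiE I (\<lambda>_. {..D}). c e * (\<Prod>i\<in>I. x i ^ e i))}"

lemma bounded_degree_add:
  "f \<in> bounded_degree I D \<Longrightarrow> g \<in> bounded_degree I D \<Longrightarrow> (\<lambda>x. f x + g x) \<in> bounded_degree I D"
  unfolding bounded_degree_def
proof clarify
  fix c d assume "\<forall>x. f x = (\<Sum>e\<in>PiE I (\<lambda>_. {..D}). c e * (\<Prod>i\<in>I. x i ^ e i))"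
    "\<forall>x. g x = (\<Sum>e\<in>PiE I (\<lambda>_. {..D}). d e * (\<Prod>i\<in>I. x i ^ e i))"
  then show "\<exists>c. \<forall>x. f x + g x = (\<Sum>e\<in>PiE I (\<lambda>_. {..D}). c e * (\<Prod>i\<in>I. x i ^ e i))"
    by (intro exI[of _ "\<lambda>e. c e + d e"]) (simp add: sum.distrib algebra_simps)
qed

lemma bounded_degree_scale:
  "f \<in> bounded_degree I D \<Longrightarrow> (\<lambda>x. k * f x) \<in> bounded_degree I D"
  unfolding bounded_degree_def
proof clarify
  fix c assume "\<forall>x. f x = (\<Sum>e\<in>PiE I (\<lambda>_. {..D}). c e * (\<Prod>i\<in>I. x i ^ e i))"
  then show "\<exists>c. \<forall>x. k * f x = (\<Sum>e\<in>PiE I (\<lambda>_. {..D}). c e * (\<Prod>i\<in>I. x i ^ e i))"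
    by (intro exI[of _ "\<lambda>e. k * c e"]) (simp add: sum_distrib_left algebra_simps)
qed

lemma bounded_degree_sum:
  assumes "\<And>s. s \<in> S \<Longrightarrow> f s \<in> bounded_degree I D"
  shows "(\<lambda>x. \<Sum>s\<in>S. f s x) \<in> bounded_degree I D"
proof -
  have 0: "(\<lambda>x. 0) \<in> bounded_degree I D"
    unfolding bounded_degree_def by (rule CollectI, rule exI[of _ "\<lambda>_. 0"]) simp
  show ?thesis
    using assms by (induction S rule: infinite_finite_induct) (auto intro: bounded_degree_add 0)
qed

lemma bounded_degree_monomial:
  fixes I :: "'i set"
  assumes "finite I" "\<And>i. i \<in> I \<Longrightarrow> e i \<le> D"
  shows "(\<lambda>x. \<Prod>i\<in>I. (x i :: 'a::comm_ring_1) ^ e i) \<in> bounded_degree I D"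
  unfolding bounded_degree_def
proof (rule CollectI, intro exI allI)
  fix x :: "'i \<Rightarrow> 'a"
  let ?S = "PiE I (\<lambda>_. {..D})"
  have fin: "finite ?S" using assms by (simp add: finite_PiE)
  have mem: "restrict e I \<in> ?S" using assms by auto
  have "(\<Sum>e'\<in>?S. (if e' = restrict e I then 1 else 0) * (\<Prod>i\<in>I. x i ^ e' i))
      = (\<Sum>e'\<in>?S. if e' = restrict e I then \<Prod>i\<in>I. x i ^ e' i else 0)"
    by (rule sum.cong) auto
  also have "\<dots> = (\<Prod>i\<in>I. x i ^ e i)" using fin mem by simp
  finally show "(\<Prod>i\<in>I. x i ^ e i) =
    (\<Sum>e'\<in>?S. (if e' = restrict e I then 1 else 0) * (\<Prod>i\<in>I. x i ^ e' i))" by simp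
qed

lemma bounded_degree_mult:
  fixes f g :: "('i \<Rightarrow> 'a::comm_ring_1) \<Rightarrow> 'a"
  assumes I: "finite I" and "f \<in> bounded_degree I D" "g \<in> bounded_degree I D'"
  shows "(\<lambda>x. f x * g x) \<in> bounded_degree I (D + D')"
proof -
  obtain c where c: "\<And>x. f x = (\<Sum>e\<in>PiE I (\<lambda>_. {..D}). c e * (\<Prod>i\<in>I. x i ^ e i))"
    using assms unfolding bounded_degree_def by blast
  obtain d where d: "\<And>x. g x = (\<Sum>e\<in>PiE I (\<lambda>_. {..D'}). d e * (\<Prod>i\<in>I. x i ^ e i))"
    using assms unfolding bounded_degree_def by blast
  have eq: "(\<lambda>x. f x * g x) = (\<lambda>x. \<Sum>e\<in>PiE I (\<lambda>_. {..D}). \<Sum>e'\<in>PiE I (\<lambda>_. {..D'}).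
      c e * d e' * (\<Prod>i\<in>I. x i ^ (e i + e' i)))"
    unfolding c d by (simp add: sum_product power_add prod.distrib algebra_simps)
  show ?thesis
    unfolding eq
  proof (intro bounded_degree_sum bounded_degree_scale bounded_degree_monomial I)
    fix e e' :: "'i \<Rightarrow> nat" and i
    assume "e \<in> PiE I (\<lambda>_. {..D})" "e' \<in> PiE I (\<lambda>_. {..D'})" "i \<in> I"
    then have "e i \<le> D" "e' i \<le> D'" by auto
    then show "e i + e' i \<le> D + D'" by simp
  qed
qed

lemma bounded_degree_const: "finite I \<Longrightarrow> (\<lambda>_. c) \<in> bounded_degree I D"
  using bounded_degree_scale[OF bounded_degree_monomial[of I "\<lambda>_. 0" D], of c] by simp

lemma bounded_degree_mono:
  assumes "finite I" "f \<in> bounded_degree I D" "D \<le> D'"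
  shows "f \<in> bounded_degree I D'"
  using bounded_degree_mult[OF assms(1,2) bounded_degree_const[OF assms(1), of 1 "D' - D"]] assms(3)
  by simp

lemma coord_polys_bounded_degree:
  fixes f :: "('i \<Rightarrow> 'a::comm_ring_1) \<Rightarrow> 'a"
  assumes "finite I" "f \<in> coord_polys I"
  shows "\<exists>D. f \<in> bounded_degree I D"
  using assms(2)
proof (induction rule: coord_polys.induct)
  case (const c)
  then show ?case using bounded_degree_const[OF assms(1)] by blast
next
  case (coord i)
  have eq: "(\<lambda>x. \<Prod>j\<in>I. x j ^ (if j = i then 1 else 0)) = (\<lambda>x. x i :: 'a)"
  proof
    fix x :: "'i \<Rightarrow> 'a"
    have "(\<Prod>j\<in>I. x j ^ (if j = i then 1 else 0)) = (\<Prod>j\<in>I. if j = i then x j else 1)"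
      by (rule prod.cong) auto
    then show "(\<Prod>j\<in>I. x j ^ (if j = i then 1 else 0)) = x i"
      using assms(1) coord by simp
  qed
  have "(\<lambda>x. \<Prod>j\<in>I. (x j :: 'a) ^ (if j = i then 1 else 0)) \<in> bounded_degree I 1"
    by (rule bounded_degree_monomial[OF assms(1)]) simp
  then show ?case unfolding eq by blast
next
  case (add f g)
  then obtain D D' where "f \<in> bounded_degree I D" "g \<in> bounded_degree I D'" by blast
  then have "f \<in> bounded_degree I (D + D')" "g \<in> bounded_degree I (D + D')"
    by (auto intro: bounded_degree_mono[OF assms(1)])
  then show ?case using bounded_degree_add by blast
next
  case (mult f g)
  then show ?case using bounded_degree_mult[OF assms(1)] by blast
qed

section \<open>Monomials in a list of functions\<close>

definition monomial_value :: "('v \<Rightarrow> 'a::comm_ring_1) list \<Rightarrow> nat list \<Rightarrow> 'v \<Rightarrow> 'a"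
  where "monomial_value fs es x = prod_list (map2 (\<lambda>f e. f x ^ e) fs es)"

lemma monomial_value_simps [simp]:
  "monomial_value [] es x = 1"
  "monomial_value (f # fs) (e # es) x = f x ^ e * monomial_value fs es x"
  by (simp_all add: monomial_value_def)

definition exponents :: "nat \<Rightarrow> nat \<Rightarrow> nat list set"
  where "exponents d N = {es. set es \<subseteq> {..<N} \<and> length es = d}"

lemma exponents_0 [simp]: "exponents 0 N = {[]}"
  by (auto simp: exponents_def)

lemma finite_exponents [simp]: "finite (exponents d N)"
  unfolding exponents_def using finite_lists_length_eq[of "{..<N}" d] by simp

lemma card_exponents: "card (exponents d N) = N ^ d"
  unfolding exponents_def using card_lists_length_eq[of "{..<N}" d] by simp

lemma sum_exponents_Suc:
  "(\<Sum>es\<in>exponents (Suc d) N. g es) = (\<Sum>b<N. \<Sum>es\<in>exponents d N. g (b # es))"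
proof -
  have "exponents (Suc d) N = (\<lambda>(b, es). b # es) ` ({..<N} \<times> exponents d N)"
    by (auto simp: exponents_def length_Suc_conv image_iff)
  moreover have "inj_on (\<lambda>(b, es). b # es) ({..<N} \<times> exponents d N)"
    by (auto simp: inj_on_def)
  ultimately show ?thesis
    by (simp add: sum.reindex sum.cartesian_product case_prod_unfold)
qed

lemma (in function_algebra) monomial_value:
  assumes "set fs \<subseteq> \<A>" "length es = length fs"
  shows "monomial_value fs es \<in> \<A>"
  using assms(2,1)
proof (induction es fs rule: list_induct2)
  case Nil
  have "monomial_value [] [] = (\<lambda>_. 1)" by auto
  then show ?case using const by simp
next
  case (Cons e es f fs)
  have "monomial_value (f # fs) (e # es) = (\<lambda>x. f x ^ e * monomial_value fs es x)" by auto
  then show ?case using Cons by (auto intro!: mult power)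
qed

text \<open>With exponents below \<open>N\<close> there are \<open>N ^ length fs\<close> monomials
  in \<open>fs\<close>, but their expansions involve at most a constant times
  \<open>N ^ card I\<close> monomials in the coordinates. For large \<open>N\<close> the
  coefficients of a relation solve a homogeneous system with more unknowns than equations.\<close>

lemma monomials_dependent:
  fixes fs :: "(('i \<Rightarrow> 'a::field) \<Rightarrow> 'a) list"
  assumes I: "finite I" and fs: "set fs \<subseteq> coord_polys I" and len: "card I < length fs"
  shows "\<exists>N y. (\<exists>es\<in>exponents (length fs) N. y es \<noteq> 0) \<and>
    (\<forall>x. (\<Sum>es\<in>exponents (length fs) N. y es * monomial_value fs es x) = 0)"
proof -
  let ?d = "length fs" and ?m = "card I"
  have "\<exists>D. set fs \<subseteq> bounded_degree I D"
    using fs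
  proof (induction fs)
    case (Cons f fs)
    then obtain D where D: "set fs \<subseteq> bounded_degree I D" by auto
    obtain D' where "f \<in> bounded_degree I D'" using coord_polys_bounded_degree[OF I, of f] Cons by auto
    then have "set (f # fs) \<subseteq> bounded_degree I (D + D')"
      using D bounded_degree_mono[OF I, of _ D "D + D'"] bounded_degree_mono[OF I, of _ D' "D + D'"]
      by auto
    then show ?case by blast
  qed simp
  then obtain D where D: "set fs \<subseteq> bounded_degree I D" by blast
  \<comment> \<open>Chosen to exceed \<open>(?d * D + 1) ^ ?m\<close>, so that
    \<open>(N * (?d * D + 1)) ^ ?m < N ^ Suc ?m \<le> N ^ ?d\<close>.\<close>
  define N where "N = Suc ((?d * D + 1) ^ ?m)"
  have pow: "(\<lambda>x. f x ^ e) \<in> bounded_degree I (e * D)" if "f \<in> set fs" for f e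
  proof (induction e)
    case 0 show ?case using bounded_degree_const[OF I, of 1] by simp
  next
    case (Suc e)
    then show ?case using bounded_degree_mult[OF I _ Suc, of f D] D that by auto
  qed
  have mon: "set gs \<subseteq> set fs \<Longrightarrow> set es \<subseteq> {..<N} \<Longrightarrow>
      monomial_value gs es \<in> bounded_degree I (length gs * (N * D))" if "length es = length gs" for es gs
    using that
  proof (induction es gs rule: list_induct2)
    case Nil
    have "monomial_value [] [] = (\<lambda>_::'i \<Rightarrow> 'a. 1 :: 'a)" by auto
    then show ?case using bounded_degree_const[OF I, of 1] by simp
  next
    case (Cons e es f gs)
    have eq: "monomial_value (f # gs) (e # es) = (\<lambda>x. f x ^ e * monomial_value gs es x)" by auto
    have "(\<lambda>x. f x ^ e) \<in> bounded_degree I (N * D)"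
      by (rule bounded_degree_mono[OF I pow]) (use Cons in auto)
    from bounded_degree_mult[OF I this Cons.IH] Cons.prems show ?case by (simp add: eq)
  qed
  let ?E = "PiE I (\<lambda>_. {..?d * (N * D)})"
  have ex: "\<forall>es\<in>exponents ?d N. \<exists>c. \<forall>x. monomial_value fs es x = (\<Sum>e\<in>?E. c e * (\<Prod>i\<in>I. x i ^ e i))"
    using mon by (simp add: exponents_def bounded_degree_def)
  obtain c where c: "\<And>es x. es \<in> exponents ?d N \<Longrightarrow>
      monomial_value fs es x = (\<Sum>e\<in>?E. c es e * (\<Prod>i\<in>I. x i ^ e i))"
    using bchoice[OF ex] by blast
  have "card ?E = (?d * (N * D) + 1) ^ ?m" using I by (simp add: card_PiE)
  also have "\<dots> \<le> (N * (?d * D + 1)) ^ ?m"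
    by (rule power_mono) (auto simp: N_def algebra_simps)
  also have "\<dots> = N ^ ?m * (?d * D + 1) ^ ?m" by (rule power_mult_distrib)
  also have "\<dots> < N ^ ?m * N"
    by (simp add: N_def)
  also have "\<dots> \<le> N ^ ?d"
  proof -
    have "N ^ Suc ?m \<le> N ^ ?d" by (rule power_increasing) (use len in \<open>auto simp: N_def\<close>)
    then show ?thesis by (simp add: mult.commute)
  qed
  finally have lt: "card ?E < card (exponents ?d N)" by (simp add: card_exponents)
  have "finite ?E" using I by (simp add: finite_PiE)
  from homogeneous_system[OF this finite_exponents lt, of "\<lambda>e u. c u e"]
  obtain y where y: "\<exists>u\<in>exponents ?d N. y u \<noteq> 0"
    "\<forall>e\<in>?E. (\<Sum>u\<in>exponents ?d N. y u * c u e) = 0"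
    by blast
  have "(\<Sum>es\<in>exponents ?d N. y es * monomial_value fs es x) = 0" for x
  proof -
    have "(\<Sum>es\<in>exponents ?d N. y es * monomial_value fs es x)
        = (\<Sum>es\<in>exponents ?d N. \<Sum>e\<in>?E. y es * c es e * (\<Prod>i\<in>I. x i ^ e i))"
      by (rule sum.cong) (simp_all add: c sum_distrib_left mult.assoc)
    also have "\<dots> = (\<Sum>e\<in>?E. (\<Sum>es\<in>exponents ?d N. y es * c es e) * (\<Prod>i\<in>I. x i ^ e i))"
      by (subst sum.swap) (simp add: sum_distrib_right)
    also have "\<dots> = 0" using y(2) by simp
    finally show ?thesis .
  qed
  with y(1) show ?thesis by blast
qed

section \<open>Chains of irreducible closed sets\<close>

text \<open>The functions on an irreducible set form a domain, so a factor that is nonzero somewhere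
  on the set can be cancelled.\<close>

lemma irreducible_in_zariski_prod:
  assumes "irreducible_in (zariski scl) Z" "f \<in> polynomial_functions scl" "g \<in> polynomial_functions scl"
    "\<And>x. x \<in> Z \<Longrightarrow> f x * g x = 0" "z \<in> Z" "f z \<noteq> 0" "x \<in> Z"
  shows "g x = 0"
proof -
  have "Z \<subseteq> {x. f x = 0} \<union> {x. g x = 0}" using assms(4) by auto
  then have "Z \<subseteq> {x. f x = 0} \<or> Z \<subseteq> {x. g x = 0}"
    using assms(1) closedin_zero_set[OF assms(2)] closedin_zero_set[OF assms(3)]
    unfolding irreducible_in_def by blast
  then show ?thesis using assms by auto
qed

text \<open>
  If \<open>f\<^sub>i\<close> vanishes on one member of the chain but not on the next one, the \<open>f\<^sub>i\<close> are algebraically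
  independent on the largest member: the lowest coefficient of a relation, viewed as a polynomial
  in the first \<open>f\<^sub>i\<close>, becomes a relation on the next smaller member.
\<close>

lemma chain_independent:
  fixes scl :: "'a::field \<Rightarrow> 'v::ab_group_add \<Rightarrow> 'v" and Z :: "nat \<Rightarrow> 'v set"
  assumes "\<And>i. i \<le> d \<Longrightarrow> irreducible_in (zariski scl) (Z i)"
    and "\<And>i. i < d \<Longrightarrow> Z i \<subseteq> Z (Suc i)"
    and "length fs = d" and "set fs \<subseteq> polynomial_functions scl"
    and "\<And>i x. i < d \<Longrightarrow> x \<in> Z (d - Suc i) \<Longrightarrow> (fs ! i) x = 0"
    and "\<And>i. i < d \<Longrightarrow> \<exists>x\<in>Z (d - i). (fs ! i) x \<noteq> 0"
    and "\<And>x. x \<in> Z d \<Longrightarrow> (\<Sum>es\<in>exponents d N. y es * monomial_value fs es x) = 0"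
    and "es \<in> exponents d N"
  shows "y es = 0"
  using assms
proof (induction d arbitrary: fs y es)
  case 0
  from "0.prems"(1)[of 0] obtain x where "x \<in> Z 0" unfolding irreducible_in_def by auto
  from "0.prems"(7)[OF this] "0.prems"(3,8) show ?case by simp
next
  case (Suc d)
  obtain f gs where fs: "fs = f # gs" "length gs = d" using Suc.prems(3) by (cases fs) auto
  have f: "f \<in> polynomial_functions scl" and gs: "set gs \<subseteq> polynomial_functions scl"
    using Suc.prems(4) fs by auto
  have ZS: "Z d \<subseteq> Z (Suc d)" and irr: "irreducible_in (zariski scl) (Z (Suc d))"
    using Suc.prems(1,2) by auto
  have f0: "f x = 0" if "x \<in> Z d" for x
    using Suc.prems(5)[of 0 x] that fs by simp
  obtain z where z: "z \<in> Z (Suc d)" "f z \<noteq> 0"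
    using Suc.prems(6)[of 0] fs by auto
  \<comment> \<open>The coefficient of \<open>f ^ b\<close> when the relation is ordered by powers
    of the first function.\<close>
  define G where "G b x = (\<Sum>es\<in>exponents d N. y (b # es) * monomial_value gs es x)" for b x
  have Gpoly: "G b \<in> polynomial_functions scl" for b
  proof -
    have "(\<lambda>x. \<Sum>es\<in>exponents d N. y (b # es) * monomial_value gs es x) \<in> polynomial_functions scl"
      using gs fs by (intro poly_alg.sum polynomial_functions.mult polynomial_functions.const
          poly_alg.monomial_value) (auto simp: exponents_def)
    then show ?thesis by (simp add: G_def[abs_def])
  qed
  have IH: "y (b # es) = 0" if "\<And>x. x \<in> Z d \<Longrightarrow> G b x = 0" "es \<in> exponents d N" for b es
  proof (rule Suc.IH[of gs "\<lambda>es. y (b # es)"])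
    show "(gs ! i) x = 0" if "i < d" "x \<in> Z (d - Suc i)" for i x
      using Suc.prems(5)[of "Suc i" x] that fs by simp
    show "\<exists>x\<in>Z (d - i). (gs ! i) x \<noteq> 0" if "i < d" for i
      using Suc.prems(6)[of "Suc i"] that fs by simp
    show "(\<Sum>es\<in>exponents d N. y (b # es) * monomial_value gs es x) = 0" if "x \<in> Z d" for x
      using \<open>\<And>x. x \<in> Z d \<Longrightarrow> G b x = 0\<close>[OF that] by (simp add: G_def)
  qed (use Suc.prems(1,2) fs gs that(2) in auto)
  \<comment> \<open>Once the coefficients below \<open>j\<close> vanish, \<open>f ^ j\<close> can be
    cancelled on \<open>Z (Suc d)\<close>. Restricting the rest to \<open>Z d\<close>, where
    \<open>f\<close> is zero, isolates \<open>G j\<close>, and the induction hypothesis for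
    \<open>d\<close> kills its coefficients.\<close>
  have tail: "(\<Sum>b=j..<N. G b x * f x ^ (b - j)) = 0" if "j \<le> N" "x \<in> Z (Suc d)" for j x
    using that
  proof (induction j arbitrary: x)
    case 0
    have "(\<Sum>b<N. G b x * f x ^ b) = (\<Sum>es\<in>exponents (Suc d) N. y es * monomial_value fs es x)"
      unfolding sum_exponents_Suc by (simp add: fs G_def sum_distrib_left sum_distrib_right algebra_simps)
    also have "\<dots> = 0" using Suc.prems(7) 0 by simp
    finally show ?case by (simp add: lessThan_atLeast0)
  next
    case (Suc j)
    have j: "j < N" using Suc.prems by simp
    have split: "(\<Sum>b=j..<N. G b x * f x ^ (b - j))
      = G j x + f x * (\<Sum>b=Suc j..<N. G b x * f x ^ (b - Suc j))" for x
    proof -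
      have "(\<Sum>b=Suc j..<N. G b x * f x ^ (b - j)) = (\<Sum>b=Suc j..<N. f x * (G b x * f x ^ (b - Suc j)))"
      proof (rule sum.cong)
        fix b assume "b \<in> {Suc j..<N}"
        then have "b - j = Suc (b - Suc j)" by (simp add: Suc_diff_Suc)
        then show "G b x * f x ^ (b - j) = f x * (G b x * f x ^ (b - Suc j))" by simp
      qed simp
      then show ?thesis using j by (simp add: sum.atLeast_Suc_lessThan sum_distrib_left)
    qed
    have "G j x = 0" if "x \<in> Z d" for x
      using Suc.IH[of x] j split[of x] f0[OF that] that ZS by auto
    then have "y (j # es) = 0" if "es \<in> exponents d N" for es using IH that by blast
    then have Gj: "G j x = 0" for x by (simp add: G_def)
    show ?case
    proof (rule irreducible_in_zariski_prod[OF irr f _ _ z Suc.prems(2)])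
      show "(\<lambda>x. \<Sum>b=Suc j..<N. G b x * f x ^ (b - Suc j)) \<in> polynomial_functions scl"
        by (intro poly_alg.sum polynomial_functions.mult poly_alg.power Gpoly f)
      show "f x * (\<Sum>b=Suc j..<N. G b x * f x ^ (b - Suc j)) = 0" if "x \<in> Z (Suc d)" for x
        using Suc.IH[OF _ that] j split[of x] Gj by simp
    qed
  qed
  obtain b es' where es: "es = b # es'" "b < N" "es' \<in> exponents d N"
    using Suc.prems(8) by (cases es) (auto simp: exponents_def)
  have "(\<Sum>c=b..<N. G c x * f x ^ (c - b)) = G b x" if "x \<in> Z d" for x
  proof -
    have "(\<Sum>c=Suc b..<N. G c x * f x ^ (c - b)) = 0"
      by (rule sum.neutral) (auto simp: f0[OF that])
    then show ?thesis using es(2) by (simp add: sum.atLeast_Suc_lessThan)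
  qed
  then have "G b x = 0" if "x \<in> Z d" for x
    using tail[of b x] es(2) that ZS by auto
  then show ?case using IH es by blast
qed

section \<open>Dimension of closures of polynomial images\<close>

lemma irreducible_in_subtopology:
  assumes "closedin X S"
  shows "irreducible_in (subtopology X S) T \<longleftrightarrow> T \<subseteq> S \<and> irreducible_in X T"
proof -
  have *: "S \<subseteq> topspace X" using assms closedin_subset by blast
  show ?thesis
  proof (intro iffI conjI)
    assume L: "irreducible_in (subtopology X S) T"
    then show TS: "T \<subseteq> S" unfolding irreducible_in_def by auto
    show "irreducible_in X T"
      unfolding irreducible_in_def
    proof (intro conjI allI impI)
      fix C D assume "closedin X C \<and> closedin X D \<and> T \<subseteq> C \<union> D"
      then have "closedin (subtopology X S) (C \<inter> S)" "closedin (subtopology X S) (D \<inter> S)"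
        "T \<subseteq> (C \<inter> S) \<union> (D \<inter> S)"
        using TS by (auto simp: closedin_subtopology)
      then show "T \<subseteq> C \<or> T \<subseteq> D" using L unfolding irreducible_in_def by blast
    qed (use L TS * in \<open>auto simp: irreducible_in_def\<close>)
  next
    assume R: "T \<subseteq> S \<and> irreducible_in X T"
    then show "irreducible_in (subtopology X S) T"
      unfolding irreducible_in_def closedin_closed_subtopology[OF assms] by auto
  qed
qed

lemma krull_dim_closed:
  assumes "closedin X S"
  shows "krull_dim (subtopology X S) = Sup {enat m | m. \<exists>Z.
    (\<forall>i\<le>m. closedin X (Z i) \<and> irreducible_in X (Z i) \<and> Z i \<subseteq> S) \<and> (\<forall>i<m. Z i \<subset> Z (Suc i))}"
  unfolding krull_dim_def irreducible_in_subtopology[OF assms] closedin_closed_subtopology[OF assms]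
  by (intro arg_cong[of _ _ Sup] Collect_cong ex_cong1 conj_cong refl) auto

text \<open>A chain of length \<open>m\<close> yields \<open>m\<close> separating functions that are
  independent on its top member. If \<open>m\<close> exceeds the number of parameters, their
  pullbacks satisfy a relation, which then holds on the image, on its closure and so on that
  member.\<close>

lemma krull_dim_polynomial_image_le:
  fixes \<phi> :: "('i \<Rightarrow> 'a::field) \<Rightarrow> 'v::ab_group_add"
  assumes I: "finite I" and pm: "polynomial_map scl I \<phi>"
  shows "krull_dim (subtopology (zariski scl) (zariski scl closure_of range \<phi>)) \<le> enat (card I)"
proof -
  let ?X = "zariski scl" and ?S = "zariski scl closure_of range \<phi>"
  have *: "m \<le> card I" if Z: "\<And>i. i \<le> m \<Longrightarrow> closedin ?X (Z i) \<and> irreducible_in ?X (Z i) \<and> Z i \<subseteq> ?S"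
    "\<And>i. i < m \<Longrightarrow> Z i \<subset> Z (Suc i)" for m Z
  proof (rule ccontr)
    assume gt: "\<not> m \<le> card I"
    have "\<exists>f. f \<in> polynomial_functions scl \<and> (\<forall>x\<in>Z (m - Suc i). f x = 0) \<and> (\<exists>x\<in>Z (m - i). f x \<noteq> 0)"
      if "i < m" for i
    proof -
      have "Z (m - Suc i) \<subset> Z (m - i)"
        using Z(2)[of "m - Suc i"] that by (simp add: Suc_diff_Suc)
      then obtain x where "x \<in> Z (m - i)" "x \<notin> Z (m - Suc i)" by blast
      moreover have "closedin ?X (Z (m - Suc i))" using Z(1) by simp
      ultimately show ?thesis using closedin_zariski_separate by metis
    qed
    then obtain f where f: "\<And>i. i < m \<Longrightarrow> f i \<in> polynomial_functions scl"
      "\<And>i x. i < m \<Longrightarrow> x \<in> Z (m - Suc i) \<Longrightarrow> f i x = 0" "\<And>i. i < m \<Longrightarrow> \<exists>x\<in>Z (m - i). f i x \<noteq> 0"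
      by metis
    let ?fs = "map f [0..<m]" and ?gs = "map (\<lambda>i x. f i (\<phi> x)) [0..<m]"
    have gs: "set ?gs \<subseteq> coord_polys I" using pm f(1) by (auto simp: polynomial_map_def)
    have len: "card I < length ?gs" using gt by simp
    from monomials_dependent[OF I gs len]
    obtain N y es where y: "es \<in> exponents (length ?gs) N" "y es \<noteq> 0"
      "\<forall>x. (\<Sum>es\<in>exponents (length ?gs) N. y es * monomial_value ?gs es x) = 0"
      by blast
    have mv: "monomial_value ?gs es x = monomial_value ?fs es (\<phi> x)" for es x
      by (simp add: monomial_value_def zip_map1 o_def case_prod_unfold)
    define F where "F v = (\<Sum>es\<in>exponents m N. y es * monomial_value ?fs es v)" for v
    have "F \<in> polynomial_functions scl"
    proof -
      have "(\<lambda>v. \<Sum>es\<in>exponents m N. y es * monomial_value ?fs es v) \<in> polynomial_functions scl"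
        using f(1) by (intro poly_alg.sum polynomial_functions.mult polynomial_functions.const
            poly_alg.monomial_value) (auto simp: exponents_def)
      then show ?thesis by (simp add: F_def[abs_def])
    qed
    moreover have "F v = 0" if "v \<in> range \<phi>" for v
      using that y(3) by (auto simp: F_def mv)
    ultimately have F0: "F v = 0" if "v \<in> ?S" for v
      using zariski_closure_vanish that by blast
    have "y es = 0"
    proof (rule chain_independent[of m scl Z ?fs y N es])
      show "(\<Sum>es\<in>exponents m N. y es * monomial_value ?fs es x) = 0" if "x \<in> Z m" for x
        using F0[of x] Z(1)[of m] that unfolding F_def by blast
    qed (use Z f y(1) in \<open>auto\<close>)
    with y(2) show False by simp
  qed
  then show ?thesis
    unfolding krull_dim_closed[OF closedin_closure_of]
  proof (intro Sup_least, clarify)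
    fix m Z assume "\<forall>i\<le>m. closedin ?X (Z i) \<and> irreducible_in ?X (Z i) \<and> Z i \<subseteq> ?S"
      "\<forall>i<m. Z i \<subset> Z (Suc i)"
    with *[of m Z] show "enat m \<le> enat (card I)" by simp
  qed
qed

text \<open>
  Hypotheses \<open>P\<close> and \<open>hP\<close> say that, off the zero set of \<open>\<delta>\<close>, each coordinate \<open>x i\<close> is determined by
  \<open>\<phi> x\<close> up to finitely many values, so the coordinate subspaces through \<open>b\<close> have distinct images.
\<close>

lemma krull_dim_polynomial_image_ge:
  fixes \<phi> :: "('i \<Rightarrow> 'a::field) \<Rightarrow> 'v::ab_group_add"
  assumes inf: "infinite (UNIV :: 'a set)" and I: "finite I" and pm: "polynomial_map scl I \<phi>"
    and \<delta>: "\<delta> \<in> coord_polys I" "\<delta> b \<noteq> 0"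
    and h: "\<And>i. i \<in> I \<Longrightarrow> h i \<in> polynomial_functions scl"
    and P: "\<And>i. i \<in> I \<Longrightarrow> P i \<noteq> 0 \<and> poly (P i) (b i) = 0"
    and hP: "\<And>i x. i \<in> I \<Longrightarrow> \<delta> x \<noteq> 0 \<Longrightarrow> h i (\<phi> x) = 0 \<longleftrightarrow> poly (P i) (x i) = 0"
  shows "krull_dim (subtopology (zariski scl) (zariski scl closure_of range \<phi>)) \<ge> enat (card I)"
proof -
  let ?X = "zariski scl"
  obtain \<iota> where \<iota>: "bij_betw \<iota> {..<card I} I"
    using I ex_bij_betw_nat_finite[of I] by (auto simp: lessThan_atLeast0)
  have \<iota>I: "\<iota> j \<in> I" if "j < card I" for j using \<iota> that by (auto simp: bij_betw_def)
  \<comment> \<open>Only the first \<open>j\<close> parameters vary; the others are frozen at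
    \<open>b\<close>.\<close>
  define \<phi>' where "\<phi>' j x = \<phi> (\<lambda>i. if i \<in> \<iota> ` {..<j} then x i else b i)" for j x
  define Z where "Z j = ?X closure_of range (\<phi>' j)" for j
  have pm': "polynomial_map scl I (\<phi>' j)" for j
    unfolding polynomial_map_def
  proof
    fix F assume "F \<in> polynomial_functions scl"
    then have F: "(\<lambda>x. F (\<phi> x)) \<in> coord_polys I" using pm by (simp add: polynomial_map_def)
    have "(\<lambda>x. if i \<in> \<iota> ` {..<j} then x i else b i) \<in> coord_polys I" if "i \<in> I" for i
      using that by (cases "i \<in> \<iota> ` {..<j}") (auto intro: coord_polys.intros)
    from coord_polys_compose[OF F this] show "(\<lambda>x. F (\<phi>' j x)) \<in> coord_polys I"
      by (simp add: \<phi>'_def)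
  qed
  have irr: "irreducible_in ?X (Z j)" for j
    unfolding Z_def by (rule irreducible_in_polynomial_image[OF inf pm'])
  have ZS: "Z j \<subseteq> ?X closure_of range \<phi>" for j
    unfolding Z_def by (rule closure_of_mono) (auto simp: \<phi>'_def)
  have mono: "Z j \<subseteq> Z (Suc j)" for j
    unfolding Z_def
  proof (rule closure_of_mono, safe)
    fix x
    have "\<phi>' j x = \<phi>' (Suc j) (\<lambda>i. if i \<in> \<iota> ` {..<j} then x i else b i)"
      unfolding \<phi>'_def by (rule arg_cong[of _ _ \<phi>]) (auto simp: lessThan_Suc)
    then show "\<phi>' j x \<in> range (\<phi>' (Suc j))" by blast
  qed
  have strict: "Z j \<noteq> Z (Suc j)" if j: "j < card I" for j
  proof
    assume eq: "Z j = Z (Suc j)"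
    define i where "i = \<iota> j"
    have i: "i \<in> I" using \<iota>I j by (simp add: i_def)
    have nin: "i \<notin> \<iota> ` {..<j}"
    proof
      assume "i \<in> \<iota> ` {..<j}"
      then obtain k where "k < j" "\<iota> k = \<iota> j" unfolding i_def by auto
      with inj_onD[OF bij_betw_imp_inj_on[OF \<iota>], of k j] j show False by simp
    qed
    \<comment> \<open>Parameter \<open>i\<close> is still frozen at \<open>b i\<close>, a root of
      \<open>P i\<close>. Density removes the condition on \<open>\<delta>\<close>.\<close>
    have "h i (\<phi>' j x) = 0" for x
    proof -
      have 2: "closedin ?X {v. h i v = 0}" by (rule closedin_zero_set[OF h[OF i]])
      have 3: "(\<lambda>x. \<delta> (\<lambda>i. if i \<in> \<iota> ` {..<j} then x i else b i)) \<in> coord_polys I"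
        by (rule coord_polys_compose[OF \<delta>(1)], rule coord_alg.if_const) (auto intro: coord_polys.intros)
      have "\<phi>' j x \<in> {v. h i v = 0}"
      proof (rule polynomial_map_dense[OF inf pm' 2 3, of b])
        show "\<delta> (\<lambda>i. if i \<in> \<iota> ` {..<j} then b i else b i) \<noteq> 0" using \<delta>(2) by simp
        fix x assume "\<delta> (\<lambda>i. if i \<in> \<iota> ` {..<j} then x i else b i) \<noteq> 0"
        from hP[OF i this] show "\<phi>' j x \<in> {v. h i v = 0}"
          using nin P[OF i] by (simp add: \<phi>'_def)
      qed
      then show ?thesis by simp
    qed
    then have van: "h i v = 0" if "v \<in> Z j" for v
      using zariski_closure_vanish[OF h[OF i], of "range (\<phi>' j)"] that unfolding Z_def by auto
    \<comment> \<open>Moving only parameter \<open>i\<close> away from \<open>b\<close> reaches a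
      point where \<open>\<delta>\<close> and \<open>P i\<close> are nonzero; its image lies in
      \<open>Z (Suc j)\<close>, but \<open>h i\<close> does not vanish there.\<close>
    have line: "(\<lambda>x. \<delta> (b(i := x ()))) \<in> coord_polys {()}"
      unfolding fun_upd_def
      by (rule coord_polys_compose[OF \<delta>(1)], rule coord_alg.if_const) (auto intro: coord_polys.intros)
    have "(\<lambda>x. poly (P i) (x ())) \<in> coord_polys {()}"
      unfolding poly_altdef
      by (intro coord_alg.sum coord_alg.mult coord_alg.power)
        (auto intro: coord_polys.intros)
    moreover obtain t where t: "poly (P i) t \<noteq> 0" using poly_eq_0_infinite[OF inf] P[OF i] by blast
    ultimately obtain x where x: "poly (P i) (x ()) \<noteq> 0" "\<delta> (b(i := x ())) \<noteq> 0"
      using coord_polys_common_nonzero[OF inf _ line, of "\<lambda>x. poly (P i) (x ())" "\<lambda>_. t" "\<lambda>_. b i"] \<delta>(2)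
      by auto
    have "\<phi>' (Suc j) (b(i := x ())) = \<phi> (b(i := x ()))"
      unfolding \<phi>'_def by (rule arg_cong[of _ _ \<phi>]) (auto simp: i_def)
    then have "\<phi> (b(i := x ())) \<in> Z (Suc j)"
      using subset_zariski_closure[of "range (\<phi>' (Suc j))" scl] unfolding Z_def by (metis rangeI subsetD)
    then have "h i (\<phi> (b(i := x ()))) = 0" using van eq by simp
    with hP[OF i x(2)] x(1) show False by simp
  qed
  show ?thesis
    unfolding krull_dim_closed[OF closedin_closure_of]
  proof (rule Sup_upper, intro CollectI exI conjI allI impI)
    show "enat (card I) = enat (card I)" ..
    fix i
    show "closedin ?X (Z i)" "irreducible_in ?X (Z i)" "Z i \<subseteq> ?X closure_of range \<phi>"
      using irr ZS by (auto simp: Z_def)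
  next
    fix i assume "i < card I"
    then show "Z i \<subset> Z (Suc i)" using mono strict by blast
  qed
qed

text \<open>An irreducible subset of a union of two closed sets lies in one of them, so only
  \<open>Z1\<close> and \<open>Z2\<close> can be maximal; since neither contains the other, both
  are.\<close>

lemma irreducible_components_Un:
  assumes "closedin X Z1" "closedin X Z2" "irreducible_in X Z1" "irreducible_in X Z2"
    "\<not> Z1 \<subseteq> Z2" "\<not> Z2 \<subseteq> Z1" "C = Z1 \<union> Z2"
  shows "irreducible_components (subtopology X C) = {Z1, Z2}"
proof -
  have C: "closedin X C" unfolding assms(7) by (rule closedin_Un[OF assms(1,2)])
  have *: "T \<subseteq> Z1 \<or> T \<subseteq> Z2" if "irreducible_in X T" "T \<subseteq> C" for T
  proof -
    have "closedin X Z1 \<and> closedin X Z2 \<and> T \<subseteq> Z1 \<union> Z2" using that(2) assms(1,2) unfolding assms(7) by (intro conjI)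
    moreover have "\<forall>C D. closedin X C \<and> closedin X D \<and> T \<subseteq> C \<union> D \<longrightarrow> T \<subseteq> C \<or> T \<subseteq> D"
      using that(1) unfolding irreducible_in_def by (elim conjE)
    ultimately show ?thesis by (elim allE impE)
  qed
  have sub: "Z1 \<subseteq> C" "Z2 \<subseteq> C" unfolding assms(7) by auto
  show ?thesis
    unfolding irreducible_components_def irreducible_in_subtopology[OF C]
  proof (rule equalityI; rule subsetI)
    fix S assume "S \<in> {S. (S \<subseteq> C \<and> irreducible_in X S) \<and>
      (\<forall>T. (T \<subseteq> C \<and> irreducible_in X T) \<and> S \<subseteq> T \<longrightarrow> T = S)}"
    then have S: "S \<subseteq> C" "irreducible_in X S"
      and max: "\<And>T. T \<subseteq> C \<Longrightarrow> irreducible_in X T \<Longrightarrow> S \<subseteq> T \<Longrightarrow> T = S"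
      by simp_all
    show "S \<in> {Z1, Z2}"
      using *[OF S(2,1)] max[OF sub(1) assms(3)] max[OF sub(2) assms(4)] by fast
  next
    fix S assume S: "S \<in> {Z1, Z2}"
    have "T = S" if T: "T \<subseteq> C" "irreducible_in X T" "S \<subseteq> T" for T
      using *[OF T(2,1)] T(3) S assms(5,6) by auto
    then show "S \<in> {S. (S \<subseteq> C \<and> irreducible_in X S) \<and>
      (\<forall>T. (T \<subseteq> C \<and> irreducible_in X T) \<and> S \<subseteq> T \<longrightarrow> T = S)}"
      using S sub assms(3,4) by auto
  qed
qed

section \<open>Polynomials in a matrix\<close>

lemma matrix_add_rdistrib:
  fixes A B C :: "'a::semiring_1 ^ 'n ^ 'n"
  shows "(A + B) ** C = A ** C + B ** C"
  by (simp add: vec_eq_iff matrix_matrix_mult_def algebra_simps sum.distrib)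

lemma matrix_diff_rdistrib:
  fixes A B C :: "'a::ring_1 ^ 'n ^ 'n"
  shows "(A - B) ** C = A ** C - B ** C"
  by (simp add: vec_eq_iff matrix_matrix_mult_def algebra_simps sum_subtractf)

lemma matrix_diff_ldistrib:
  fixes A B C :: "'a::ring_1 ^ 'n ^ 'n"
  shows "A ** (B - C) = A ** B - A ** C"
  by (simp add: vec_eq_iff matrix_matrix_mult_def algebra_simps sum_subtractf)

lemma mat_vector_mult: "mat c *v v = (c :: 'a::comm_ring_1) *s v"
  by (simp add: vec_eq_iff matrix_vector_mult_def mat_def if_distrib if_distribR cong: if_cong)

lemma mat_mult_mat: "mat c ** mat d = (mat (c * d) :: 'a::comm_ring_1 ^ 'n ^ 'n)"
  by (simp add: vec_eq_iff mat_mult_nth) (simp add: mat_def)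

primrec mpow :: "'a::semiring_1 ^ 'n ^ 'n \<Rightarrow> nat \<Rightarrow> 'a ^ 'n ^ 'n"
  where "mpow A 0 = mat 1" | "mpow A (Suc k) = A ** mpow A k"

lemma mpow_add: "mpow A (j + k) = mpow A j ** mpow A k"
  by (induction j) (simp_all add: matrix_mul_assoc)

definition mpoly :: "'a::comm_ring_1 poly \<Rightarrow> 'a ^ 'n ^ 'n \<Rightarrow> 'a ^ 'n ^ 'n"
  where "mpoly q A = fold_coeffs (\<lambda>a M. mat a + A ** M) q 0"

lemma mpoly_0 [simp]: "mpoly 0 A = 0"
  by (simp add: mpoly_def)

lemma mpoly_pCons [simp]: "mpoly (pCons a q) A = mat a + A ** mpoly q A"
  by (cases "pCons a q = 0") (auto simp: mpoly_def)

lemma mpoly_1 [simp]: "mpoly 1 A = mat 1"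
  by (simp add: one_pCons)

lemma mpoly_add: "mpoly (p + q) A = mpoly p A + mpoly q A"
proof (induction p arbitrary: q)
  case (pCons a p)
  then show ?case
    by (cases q) (simp add: mat_arith(1)[symmetric] matrix_add_ldistrib add_ac)
qed simp

lemma mpoly_smult: "mpoly (smult c p) A = mat c ** mpoly p A"
proof (induction p)
  case (pCons a p)
  have "mat c ** (A ** mpoly p A) = A ** (mat c ** mpoly p A)"
    by (simp only: matrix_mul_assoc mat_mult_commute[of c A])
  then show ?case using pCons by (simp add: matrix_add_ldistrib mat_mult_mat)
qed simp

lemma mpoly_mult: "mpoly (p * q) A = mpoly p A ** mpoly q A"
  by (induction p) (simp_all add: mpoly_add mpoly_smult matrix_add_rdistrib matrix_mul_assoc)

lemma mpoly_diff: "mpoly (p - q) A = mpoly p A - mpoly q (A :: 'a::comm_ring_1 ^ 'n ^ 'n)"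
  using mpoly_add[of "p - q" q A] by (simp add: algebra_simps)

lemma mpoly_power: "mpoly (p ^ k) A = mpow (mpoly p A) k"
  by (induction k) (simp_all add: mpoly_mult)

lemma mpoly_sum: "mpoly (\<Sum>i\<in>S. f i) A = (\<Sum>i\<in>S. mpoly (f i) A)"
  by (induction S rule: infinite_finite_induct) (simp_all add: mpoly_add)

lemma mpoly_monom: "mpoly (monom c k) A = mat c ** mpow A k"
proof (induction k)
  case 0
  show ?case by (simp add: monom_0)
next
  case (Suc k)
  have "A ** (mat c ** mpow A k) = mat c ** (A ** mpow A k)"
    by (simp only: matrix_mul_assoc mat_mult_commute[of c A])
  with Suc show ?case by (simp add: monom_Suc)
qed

lemma mpoly_pcompose: "mpoly (pcompose p q) A = mpoly p (mpoly q A)"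
  by (induction p) (simp_all add: pcompose_pCons mpoly_add mpoly_mult)

lemma mpoly_commute: "A ** B = B ** A \<Longrightarrow> mpoly q A ** B = B ** mpoly q A"
proof (induction q)
  case (pCons a q)
  then have IH: "mpoly q A ** B = B ** mpoly q A" by simp
  have "(A ** mpoly q A) ** B = A ** (B ** mpoly q A)"
    by (simp only: matrix_mul_assoc[symmetric] IH)
  also have "\<dots> = B ** (A ** mpoly q A)"
    by (simp only: matrix_mul_assoc pCons.prems)
  finally show ?case
    by (simp add: matrix_add_rdistrib matrix_add_ldistrib mat_mult_commute[of a B])
qed simp

lemma mpow_eq_mpoly: "mpow A k = mpoly (monom 1 k) A"
  by (simp add: mpoly_monom)

lemma mpoly_eigenvector:
  fixes A :: "'a::comm_ring_1 ^ 'n ^ 'n"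
  assumes "A *v w = c *s w"
  shows "mpoly q A *v w = poly q c *s w"
proof (induction q)
  case (pCons a q)
  have "A *v (poly q c *s w) = poly q c *s (A *v w)"
    by (simp add: vec_eq_iff matrix_vector_mult_def sum_distrib_left algebra_simps)
  also have "\<dots> = (c * poly q c) *s w"
    by (simp only: assms vector_smult_assoc mult.commute)
  finally have "A *v (mpoly q A *v w) = (c * poly q c) *s w"
    by (simp only: pCons.IH)
  then show ?case
    by (simp only: mpoly_pCons poly_pCons matrix_vector_mult_add_rdistrib mat_vector_mult
        matrix_vector_mul_assoc[symmetric] vector_sadd_rdistrib)
qed simp

text \<open>The n^2 + 1 powers of \<open>A\<close> up to exponent n^2 lie in a space of dimension
  n^2.\<close>

lemma mpoly_annihilator:
  fixes A :: "'a::field ^ 'n ^ 'n"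
  obtains p where "p \<noteq> 0" "mpoly p A = 0"
proof -
  let ?E = "UNIV :: ('n \<times> 'n) set" and ?U = "{..card (UNIV :: ('n \<times> 'n) set)}"
  have "card ?E < card ?U" by simp
  from homogeneous_system[OF _ _ this, of "\<lambda>(i, j) k. mpow A k $ i $ j"]
  obtain y where y: "\<exists>k\<in>?U. y k \<noteq> 0"
    "\<And>i j. (\<Sum>k\<in>?U. y k * mpow A k $ i $ j) = 0" by auto
  define p where "p = (\<Sum>k\<in>?U. monom (y k) k)"
  have "coeff p k = y k" if "k \<in> ?U" for k
    using that by (simp add: p_def coeff_sum)
  then have "p \<noteq> 0" using y(1) by auto
  moreover have "mpoly p A = 0"
    unfolding vec_eq_iff
    by (simp only: p_def mpoly_sum mpoly_monom sum_component mat_mult_nth y(2) zero_index simp_thms)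
  ultimately show thesis by (rule that)
qed

lemma vec_sum_mult: "(\<Sum>i\<in>S. M i) *v v = (\<Sum>i\<in>S. M i *v (v :: 'a::comm_ring_1 ^ 'n))"
  by (induction S rule: infinite_finite_induct) (simp_all add: matrix_vector_mult_add_rdistrib)

subsection \<open>A matrix with a cyclic vector in every centralizer\<close>

text \<open>Linear factors are split off a polynomial that annihilates \<open>w\<close>: if
  \<open>p = (x - c) q\<close>, then \<open>mpoly q B *v w\<close> is an eigenvector for
  \<open>c\<close> or zero, and in the latter case \<open>q\<close> is an annihilator of smaller
  degree.\<close>

lemma eigenvector_in_subspace:
  fixes B :: "'a::alg_closed_field ^ 'n ^ 'n"
  assumes S: "vec.subspace S" "\<And>w. w \<in> S \<Longrightarrow> B *v w \<in> S" and w: "w0 \<in> S" "w0 \<noteq> 0"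
  obtains c w where "w \<in> S" "w \<noteq> 0" "B *v w = c *s w"
proof -
  have stable: "mpoly q B *v w \<in> S" if "w \<in> S" for q w
    using that
    by (induction q) (simp_all add: vec.subspace_0 S vec.subspace_add vec.subspace_scale
        matrix_vector_mult_add_rdistrib mat_vector_mult matrix_vector_mul_assoc[symmetric])
  have "\<exists>c w. w \<in> S \<and> w \<noteq> 0 \<and> B *v w = c *s w"
    if "p \<noteq> 0" "w \<in> S" "w \<noteq> 0" "mpoly p B *v w = 0" for p w
    using that
  proof (induction "degree p" arbitrary: p rule: less_induct)
    case less
    show ?case
    proof (cases "degree p = 0")
      case True
      then obtain a where "p = [:a:]" by (rule degree_eq_zeroE)
      with less.prems show ?thesis by (simp add: mat_vector_mult)
    next
      case False
      then obtain c where "poly p c = 0" using alg_closed_imp_poly_has_root by blast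
      then obtain q where p: "p = [:-c, 1:] * q" by (auto simp: poly_eq_0_iff_dvd)
      have q: "q \<noteq> 0" using less.prems p by auto
      let ?w = "mpoly q B *v w"
      have "mpoly [:-c, 1:] B *v ?w = 0"
        using less.prems(4) by (simp only: p mpoly_mult matrix_vector_mul_assoc)
      then have "B *v ?w = c *s ?w"
        by (simp add: matrix_vector_mult_add_rdistrib mat_vector_mult)
      moreover have "degree q < degree p"
        unfolding p by (subst degree_mult_eq) (use q in auto)
      ultimately show ?thesis
        using less.hyps[of q] less.prems q stable[of w q] by (cases "?w = 0") auto
    qed
  qed
  moreover obtain p where "p \<noteq> 0" "mpoly p B = 0" by (rule mpoly_annihilator)
  ultimately show thesis using w that by fastforce
qed

text \<open>Since \<open>p - p(c)\<close> is divisible by \<open>x - c\<close>, the identity holds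
  for exponent 1; multiplying by it raises \<open>e\<close> by one. It serves to separate two blocks
  with coprime annihilators.\<close>

lemma bezout_linear_power:
  fixes p :: "'a::field poly"
  assumes "poly p c \<noteq> 0"
  shows "\<exists>a b. a * [:-c, 1:] ^ e + b * p = 1"
proof (induction e)
  case 0
  show ?case by (rule exI[of _ 1], rule exI[of _ 0]) simp
next
  case (Suc e)
  then obtain a b where ab: "a * [:-c, 1:] ^ e + b * p = 1" by blast
  have "[:-c, 1:] dvd p - [:poly p c:]" by (simp add: poly_eq_0_iff_dvd[symmetric])
  then obtain s where "p - [:poly p c:] = [:-c, 1:] * s" by (rule dvdE)
  then have s: "[:poly p c:] = p - [:-c, 1:] * s" by (simp add: algebra_simps)
  define k where "k = [:inverse (poly p c):]"
  have "1 = k * [:poly p c:]" using assms by (simp add: k_def one_pCons)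
  also have "\<dots> = (- k * s) * [:-c, 1:] + k * p" by (simp only: s) (simp add: algebra_simps)
  finally have "(- k * s) * [:-c, 1:] + k * p = 1" ..
  with ab have "(a * [:-c, 1:] ^ e + b * p) * ((- k * s) * [:-c, 1:] + k * p) = 1" by simp
  moreover have "(a * X ^ e + b * p) * ((- k * s) * X + k * p) = (a * (- k * s)) * X ^ Suc e
      + (a * X ^ e * k + b * ((- k * s) * X + k * p)) * p" for X
    by (simp add: algebra_simps)
  ultimately have "(a * (- k * s)) * [:-c, 1:] ^ Suc e
      + (a * [:-c, 1:] ^ e * k + b * ((- k * s) * [:-c, 1:] + k * p)) * p = 1"
    by (simp only:)
  then show ?case by blast
qed

section \<open>Cyclic subspaces\<close>

lemma mpoly_vector_pCons:
  "mpoly (pCons a q) A *v v = a *s v + A *v (mpoly q A *v (v :: 'a::comm_ring_1 ^ 'n))"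
  by (simp add: matrix_vector_mult_add_rdistrib mat_vector_mult matrix_vector_mul_assoc)

lemma mpoly_vector_add:
  "mpoly (p + q) A *v v = mpoly p A *v v + mpoly q A *v (v :: 'a::comm_ring_1 ^ 'n)"
  by (simp add: mpoly_add matrix_vector_mult_add_rdistrib)

lemma mpoly_vector_mult:
  "mpoly (p * q) A *v v = mpoly p A *v (mpoly q A *v (v :: 'a::comm_ring_1 ^ 'n))"
  by (simp add: mpoly_mult matrix_vector_mul_assoc)

lemma mpoly_vector_stable:
  fixes A :: "'a::field ^ 'n ^ 'n"
  assumes S: "vec.subspace S" "\<And>w. w \<in> S \<Longrightarrow> A *v w \<in> S" and "w \<in> S"
  shows "mpoly q A *v w \<in> S"
  by (induction q)
    (simp_all add: assms vec.subspace_0 vec.subspace_add vec.subspace_scale mpoly_vector_pCons del: mpoly_pCons)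

lemma mpoly_vector_cong_on:
  fixes A B :: "'a::field ^ 'n ^ 'n"
  assumes S: "vec.subspace S" "\<And>w. w \<in> S \<Longrightarrow> A *v w \<in> S" "\<And>w. w \<in> S \<Longrightarrow> B *v w = A *v w" and "w \<in> S"
  shows "mpoly q B *v w = mpoly q A *v w"
  using mpoly_vector_stable[OF S(1,2) \<open>w \<in> S\<close>]
  by (induction q) (simp_all add: assms mpoly_vector_pCons del: mpoly_pCons)

text \<open>The submodule \<open>k[A] v\<close>; that \<open>v\<close> is a cyclic vector is written
  \<open>cyclic_space A v = UNIV\<close>.\<close>

definition cyclic_space :: "'a::comm_ring_1 ^ 'n ^ 'n \<Rightarrow> 'a ^ 'n \<Rightarrow> ('a ^ 'n) set"
  where "cyclic_space A v = range (\<lambda>q. mpoly q A *v v)"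

lemma subspace_cyclic_space: "vec.subspace (cyclic_space A (v :: 'a::field ^ 'n))"
proof (rule vec.subspaceI)
  show "0 \<in> cyclic_space A v"
    unfolding cyclic_space_def by (rule range_eqI[of _ _ 0]) simp
next
  fix x y assume "x \<in> cyclic_space A v" "y \<in> cyclic_space A v"
  then obtain p q where "x = mpoly p A *v v" "y = mpoly q A *v v"
    unfolding cyclic_space_def by blast
  then show "x + y \<in> cyclic_space A v"
    unfolding cyclic_space_def by (intro range_eqI[of _ _ "p + q"]) (simp add: mpoly_vector_add)
next
  fix c x assume "x \<in> cyclic_space A v"
  then obtain p where "x = mpoly p A *v v"
    unfolding cyclic_space_def by blast
  then show "c *s x \<in> cyclic_space A v"
    unfolding cyclic_space_def
    by (intro range_eqI[of _ _ "smult c p"])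
      (simp add: mpoly_smult mat_vector_mult matrix_vector_mul_assoc[symmetric])
qed

lemma cyclic_space_stable:
  fixes A :: "'a::comm_ring_1 ^ 'n ^ 'n"
  assumes "w \<in> cyclic_space A v"
  shows "mpoly q A *v w \<in> cyclic_space A v"
  using assms unfolding cyclic_space_def by (auto simp: mpoly_vector_mult[symmetric])

lemma self_in_cyclic_space: "v \<in> cyclic_space A v"
  unfolding cyclic_space_def by (rule range_eqI[of _ _ 1]) simp

text \<open>
  Induction on the dimension: split off the cyclic subspace \<open>U\<close> of a primary vector \<open>u\<close> of maximal
  order \<open>e\<close> for the eigenvalue \<open>c\<close> of \<open>B\<close>. With \<open>N\<close> the part of an annihilating polynomial that is
  prime to \<open>x - c\<close>, the vectors \<open>w\<close> with \<open>l (T\<^sup>i N w) = 0\<close> for all \<open>i < e\<close>, where \<open>T = B - c\<close> and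
  \<open>l (T\<^sup>e\<^sup>-\<^sup>1 N u) = 1\<close>, form a stable complement.
\<close>

lemma cyclic_direct_summand:
  fixes B :: "'a::alg_closed_field ^ 'n ^ 'n"
  assumes S: "vec.subspace S" "\<And>w. w \<in> S \<Longrightarrow> B *v w \<in> S" and "S \<noteq> {0}"
  obtains u c e V P where "u \<in> S" "u \<noteq> 0" "mpow (B - mat c) e *v u = 0"
    "vec.subspace V" "V \<subseteq> S" "u \<notin> V" "\<forall>w\<in>V. B *v w \<in> V"
    "\<forall>w. P *v w \<in> cyclic_space (B - mat c) u"
    "\<forall>w\<in>S. w - P *v w \<in> V"
    "\<forall>w\<in>cyclic_space (B - mat c) u. P *v w = w"
    "\<forall>w\<in>V. P *v w = 0"
proof -
  obtain w0 where "w0 \<in> S" "w0 \<noteq> 0" using \<open>S \<noteq> {0}\<close> vec.subspace_0[OF S(1)] by blast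
  then obtain c w where w: "w \<in> S" "w \<noteq> 0" "B *v w = c *s w"
    using eigenvector_in_subspace[OF S] by blast
  obtain p where p: "p \<noteq> 0" "mpoly p B = 0" by (rule mpoly_annihilator)
  obtain \<nu> where \<nu>: "p = [:-c, 1:] ^ order c p * \<nu>" "\<not> [:-c, 1:] dvd \<nu>"
    using order_decomp[OF p(1), of c] by blast
  have \<nu>c: "poly \<nu> c \<noteq> 0" using \<nu>(2) by (simp add: poly_eq_0_iff_dvd)
  define T where "T = B - mat c"
  have T: "T = mpoly [:-c, 1:] B" by (simp add: T_def mat_arith(3)[symmetric])
  have powT: "mpow T i = mpoly ([:-c, 1:] ^ i) B" for i by (simp only: T mpoly_power)
  define N where "N = mpoly \<nu> B"
  have stab: "mpoly q B *v x \<in> S" if "x \<in> S" for q x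
    by (rule mpoly_vector_stable[OF S that])
  have comm: "mpoly q B *v (mpoly r B *v x) = mpoly r B *v (mpoly q B *v x)" for q r x
    by (simp add: mpoly_vector_mult[symmetric] mult.commute)
  \<comment> \<open>\<open>N\<close> discards the generalized eigenspaces for the other eigenvalues,
    so \<open>kills i\<close> says that \<open>T ^ i\<close> vanishes on the part of
    \<open>S\<close> that belongs to \<open>c\<close>.\<close>
  define kills where "kills i \<longleftrightarrow> (\<forall>x\<in>S. mpow T i *v (N *v x) = 0)" for i
  have "kills (order c p)"
    using p(2) \<nu>(1) by (simp add: kills_def powT N_def mpoly_vector_mult[symmetric])
  moreover have "\<not> kills 0"
    using w mpoly_eigenvector[OF w(3), of \<nu>] \<nu>c by (auto simp: kills_def N_def intro!: bexI[of _ w])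
  ultimately obtain e' where e': "\<not> kills e'" "kills (Suc e')"
    using ex_least_nat_less[of kills "order c p"] by (auto simp: less_eq_Suc_le)
  define e where "e = Suc e'"
  obtain v0 where v0: "v0 \<in> S" "mpow T e' *v (N *v v0) \<noteq> 0"
    using e'(1) by (auto simp: kills_def)
  define u where "u = N *v v0"
  have uS: "u \<in> S" unfolding u_def N_def by (rule stab[OF v0(1)])
  define z where "z = mpow T e' *v u"
  have z0: "z \<noteq> 0" using v0 by (simp add: z_def u_def)
  have Teu: "mpow T e *v u = 0" using e'(2) v0(1) by (simp add: kills_def u_def e_def)
  then have Tz: "T *v z = 0" by (simp add: z_def e_def matrix_vector_mul_assoc)
  then have "B *v z = c *s z"
    by (simp add: T_def matrix_vector_mult_diff_rdistrib mat_vector_mult)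
  then have Nz: "N *v z = poly \<nu> c *s z" unfolding N_def by (rule mpoly_eigenvector)
  then obtain i0 where i0: "(N *v z) $ i0 \<noteq> 0"
    using z0 \<nu>c by (metis vec_eq_iff vector_mul_eq_0 zero_index)
  \<comment> \<open>A coordinate functional scaled to the value 1 at \<open>N z\<close>. The vector
    \<open>z\<close> is an eigenvector of \<open>B\<close> for \<open>c\<close>, so
    \<open>N z\<close> is a nonzero multiple of it.\<close>
  define l where "l x = x $ i0 / (N *v z) $ i0" for x
  have l_lin: "l (x + y) = l x + l y" "l (x - y) = l x - l y" "l (a *s x) = a * l x" "l 0 = 0" for x y a
    by (simp_all add: l_def add_divide_distrib diff_divide_distrib)
  define M where "M i x = mpow T i *v (N *v x)" for i x
  have M_lin: "M i (x + y) = M i x + M i y" "M i (x - y) = M i x - M i y" "M i (a *s x) = a *s M i x" "M i 0 = 0"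
    for i x y a
    by (simp_all add: M_def matrix_vector_right_distrib matrix_vector_mult_diff_distrib vector_scalar_commute)
  have M0: "M i x = 0" if "i \<ge> e" "x \<in> S" for i x
  proof -
    have "i = (i - e) + e" using that by simp
    then have "M i x = mpow T (i - e) *v M e x"
      by (metis M_def matrix_vector_mul_assoc mpow_add)
    then show ?thesis using e'(2) that by (simp add: M_def e_def kills_def)
  qed
  have MT: "M i (mpow T j *v x) = M (i + j) x" for i j x
    unfolding M_def N_def powT by (simp add: mpoly_vector_mult[symmetric] power_add ac_simps)
  define V where "V = {x \<in> S. \<forall>i<e. l (M i x) = 0}"
  let ?U = "cyclic_space T u"
  have TS: "T *v x \<in> S" if "x \<in> S" for x using stab[OF that] by (simp only: T)
  have US: "?U \<subseteq> S"
    unfolding cyclic_space_def using mpoly_vector_stable[OF S(1) TS uS] by auto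
  \<comment> \<open>If \<open>x = T ^ j q'(T) u\<close> with \<open>q'(0)\<close> nonzero, then
    \<open>T ^ (e' - j) x\<close> is a nonzero multiple of \<open>z\<close>, which \<open>l\<close>
    detects after applying \<open>N\<close>.\<close>
  have UV: "x = 0" if x: "x \<in> ?U" "x \<in> V" for x
  proof (rule ccontr)
    assume "x \<noteq> 0"
    obtain q where q: "x = mpoly q T *v u" using x(1) by (auto simp: cyclic_space_def)
    with \<open>x \<noteq> 0\<close> have "q \<noteq> 0" by auto
    obtain q' where q': "q = [:0, 1:] ^ order 0 q * q'" "\<not> [:0, 1:] dvd q'"
      using order_decomp[OF \<open>q \<noteq> 0\<close>, of 0] by auto
    define j where "j = order 0 q"
    have q0: "poly q' 0 \<noteq> 0" using q'(2) poly_eq_0_iff_dvd[of q' 0] by simp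
    have pj: "mpow T i = mpoly ([:0, 1:] ^ i) T" for i by (simp add: mpoly_power)
    have commT: "mpow T i *v (mpoly q' T *v y) = mpoly q' T *v (mpow T i *v y)" for i y
      unfolding pj by (simp add: mpoly_vector_mult[symmetric] mult.commute)
    have xj: "x = mpow T j *v (mpoly q' T *v u)"
      unfolding q pj j_def by (subst q'(1)) (simp add: mpoly_vector_mult)
    have "j < e"
    proof (rule ccontr)
      assume "\<not> j < e"
      then have "j = (j - e) + e" by simp
      then have "mpow T j *v u = mpow T (j - e) *v (mpow T e *v u)"
        by (metis matrix_vector_mul_assoc mpow_add)
      then have "mpow T j *v u = 0" by (simp add: Teu)
      then show False using \<open>x \<noteq> 0\<close> by (simp add: xj commT)
    qed
    have "M (e' - j) x = M e' (mpoly q' T *v u)"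
      unfolding xj MT using \<open>j < e\<close> by (simp add: e_def)
    also have "\<dots> = N *v (mpow T e' *v (mpoly q' T *v u))"
      unfolding M_def N_def powT by (rule comm)
    also have "\<dots> = N *v (poly q' 0 *s z)"
      unfolding commT z_def[symmetric] using mpoly_eigenvector[of T z 0 q'] Tz by simp
    finally have "l (M (e' - j) x) = poly q' 0 * l (N *v z)"
      by (simp add: vector_scalar_commute l_lin)
    moreover have "l (N *v z) = 1" using i0 by (simp add: l_def)
    ultimately have "l (M (e' - j) x) \<noteq> 0" using q0 by simp
    with x(2) show False by (simp add: V_def e_def)
  qed
  \<comment> \<open>The pairing of the functionals \<open>l (M i _)\<close> with the vectors
    \<open>T ^ k u\<close> is antitriangular with ones on the antidiagonal.\<close>
  have lMu: "l (M i (mpow T k *v u)) = (if i + k = e' then 1 else 0)" if "i + k \<ge> e'" for i k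
  proof (cases "i + k = e'")
    case True
    have "M e' u = N *v z" unfolding M_def z_def N_def powT by (rule comm)
    with True show ?thesis using i0 by (simp add: MT l_def)
  next
    case False
    with that show ?thesis using M0[OF _ uS, of "i + k"] by (simp add: MT e_def l_lin)
  qed
  \<comment> \<open>The projection is built by correcting one functional at a time, from index
    \<open>e - 1\<close> down to 0. The correction for \<open>i\<close> is a multiple of
    \<open>T ^ k u\<close> with \<open>i + k = e'\<close>, which leaves the functionals of larger
    index unchanged.\<close>
  have "\<exists>P. (\<forall>x. P *v x \<in> ?U) \<and> (\<forall>x. \<forall>i<e. i \<ge> e - k \<longrightarrow> l (M i (x - P *v x)) = 0)" if "k \<le> e" for k
    using that
  proof (induction k)
    case 0
    show ?case
      by (rule exI[of _ 0]) (simp add: vec.subspace_0[OF subspace_cyclic_space])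
  next
    case (Suc k)
    then obtain P where P: "\<And>x. P *v x \<in> ?U"
      "\<And>x i. i < e \<Longrightarrow> i \<ge> e - k \<Longrightarrow> l (M i (x - P *v x)) = 0"
      by auto
    define i where "i = e - Suc k"
    define f where "f x = P *v x + l (M i (x - P *v x)) *s (mpow T k *v u)" for x
    have "Vector_Spaces.linear (*s) (*s) f"
      unfolding f_def
      by unfold_locales
        (simp_all add: matrix_vector_right_distrib vector_scalar_commute M_lin l_lin algebra_simps
          vector_sadd_rdistrib vector_ssub_ldistrib vector_smult_assoc vector_add_ldistrib)
    then have Pf: "matrix f *v x = f x" for x by (rule matrix_works)
    have Tku: "mpow T k *v u \<in> ?U"
      unfolding cyclic_space_def mpow_eq_mpoly by blast
    have "f x \<in> ?U" for x
      unfolding f_def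
      by (intro vec.subspace_add[OF subspace_cyclic_space] vec.subspace_scale[OF subspace_cyclic_space] P Tku)
    moreover have "l (M i' (x - f x)) = 0" if "i' < e" "i' \<ge> e - Suc k" for i' x
    proof -
      have "l (M i' (x - f x)) = l (M i' (x - P *v x))
          - l (M i (x - P *v x)) * l (M i' (mpow T k *v u))"
        by (simp add: f_def diff_diff_eq[symmetric] M_lin l_lin left_diff_distrib)
      also have "\<dots> = 0"
      proof (cases "i' = i")
        case True
        then have "i' + k = e'" using that Suc.prems by (simp add: i_def e_def)
        then show ?thesis using lMu[of i' k] True by simp
      next
        case False
        then have "i' \<ge> e - k" "i' + k \<ge> e'" "i' + k \<noteq> e'" using that Suc.prems by (auto simp: i_def e_def)
        then show ?thesis using lMu[of i' k] P(2)[of i' x] that by simp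
      qed
      finally show ?thesis .
    qed
    ultimately show ?case by (intro exI[of _ "matrix f"]) (simp add: Pf)
  qed
  from this[of e] obtain P where P: "\<And>x. P *v x \<in> ?U" "\<And>x i. i < e \<Longrightarrow> l (M i (x - P *v x)) = 0"
    by auto
  have V: "vec.subspace V"
    by (rule vec.subspaceI)
      (auto simp: V_def M_lin l_lin vec.subspace_0 vec.subspace_add vec.subspace_scale S(1))
  have VT: "B *v x \<in> V" if "x \<in> V" for x
  proof -
    have x: "x \<in> S" "\<And>i. i < e \<Longrightarrow> l (M i x) = 0" using that by (auto simp: V_def)
    have "l (M i (T *v x)) = 0" if "i < e" for i
      using MT[of i 1 x] x(2)[of "Suc i"] M0[OF _ x(1), of "Suc i"] by (cases "Suc i < e") (simp_all add: l_lin)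
    then have "T *v x \<in> V" using TS[OF x(1)] by (simp add: V_def)
    moreover have "B *v x = T *v x + c *s x"
      by (simp add: T_def matrix_vector_mult_diff_rdistrib mat_vector_mult)
    ultimately show ?thesis using that V by (simp add: vec.subspace_add vec.subspace_scale)
  qed
  have uU: "u \<in> ?U" by (rule self_in_cyclic_space)
  have u0: "u \<noteq> 0" using z0 by (auto simp: z_def)
  have PV: "x - P *v x \<in> V" if "x \<in> S" for x
    using that P(2)[of _ x] vec.subspace_diff[OF S(1) that] P(1)[of x] US by (auto simp: V_def)
  have PU0: "P *v x = x" if "x \<in> ?U" for x
  proof -
    have "x - P *v x = 0"
      by (rule UV) (use that US PV P(1)[of x] vec.subspace_diff[OF subspace_cyclic_space that] in auto)
    then show ?thesis by simp
  qed
  have PV0: "P *v x = 0" if "x \<in> V" for x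
  proof (rule UV)
    have "x \<in> S" using that by (simp add: V_def)
    then have "x - (x - P *v x) \<in> V" using vec.subspace_diff[OF V that] PV by blast
    then show "P *v x \<in> V" by simp
  qed (rule P(1))
  show thesis
  proof (rule that[OF uS u0 _ V, of c e P])
    show "mpow (B - mat c) e *v u = 0" using Teu by (simp add: T_def)
    show "V \<subseteq> S" by (auto simp: V_def)
    show "u \<notin> V" using UV[OF uU] u0 by blast
  qed (use VT P(1) PV PU0 PV0 in \<open>simp_all add: T_def\<close>)
qed

text \<open>\<open>R\<close> acts as \<open>T + a\<close> on the cyclic summand and as the
  inductively given \<open>R2\<close> on the complement. With \<open>a\<close> outside the roots of
  an annihilator of \<open>R2\<close>, the two parts have coprime annihilators, so the sum of their
  cyclic vectors generates both.\<close>

lemma cyclic_commuting_on: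
  fixes B :: "'a::alg_closed_field ^ 'n ^ 'n"
  assumes inf: "infinite (UNIV :: 'a set)" and "vec.subspace S" "\<And>w. w \<in> S \<Longrightarrow> B *v w \<in> S"
  shows "\<exists>R v. v \<in> S \<and> (\<forall>w\<in>S. R *v w \<in> S) \<and> (\<forall>w\<in>S. R *v (B *v w) = B *v (R *v w)) \<and>
    S \<subseteq> cyclic_space R v"
  using assms(2,3)
proof (induction "vec.dim S" arbitrary: S rule: less_induct)
  case less
  note S = less.prems
  show ?case
  proof (cases "S = {0}")
    case True
    then show ?thesis
      by (intro exI[of _ 0]) (simp add: vec.subspace_0[OF subspace_cyclic_space])
  next
    case False
    obtain u c e V P where u: "u \<in> S" "u \<noteq> 0" "mpow (B - mat c) e *v u = 0"
      and V': "vec.subspace V" "V \<subseteq> S" "u \<notin> V" "\<forall>w\<in>V. B *v w \<in> V"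
      and P': "\<forall>w. P *v w \<in> cyclic_space (B - mat c) u" "\<forall>w\<in>S. w - P *v w \<in> V"
        "\<forall>w\<in>cyclic_space (B - mat c) u. P *v w = w" "\<forall>w\<in>V. P *v w = 0"
      by (rule cyclic_direct_summand[OF S False])
    note V = V'[rule_format] and P = P'[rule_format]
    define T where "T = B - mat c"
    let ?U = "cyclic_space T u"
    have TS: "T *v x \<in> S" if "x \<in> S" for x
      using that S by (simp add: T_def matrix_vector_mult_diff_rdistrib mat_vector_mult
          vec.subspace_diff vec.subspace_scale)
    have US: "?U \<subseteq> S"
      unfolding cyclic_space_def using mpoly_vector_stable[OF S(1) TS u(1)] by auto
    have "V \<noteq> S" using u V by blast
    then have "vec.dim V < vec.dim S"
      using vec.subspace_dim_equal[OF V(1) S(1) V(2)] vec.dim_subset[OF V(2)] by linarith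
    from less.hyps[OF this V(1,4)]
    obtain R2 v2 where R2: "v2 \<in> V" "\<And>w. w \<in> V \<Longrightarrow> R2 *v w \<in> V"
      "\<And>w. w \<in> V \<Longrightarrow> R2 *v (B *v w) = B *v (R2 *v w)" "V \<subseteq> cyclic_space R2 v2"
      by blast
    obtain p where p: "p \<noteq> 0" "mpoly p R2 = 0" by (rule mpoly_annihilator)
    obtain a where a: "poly p a \<noteq> 0" using poly_eq_0_infinite[OF inf] p(1) by blast
    obtain r s where rs: "r * [:-a, 1:] ^ e + s * p = 1"
      using bezout_linear_power[OF a] by blast
    define T' where "T' = T + mat a"
    define R where "R = T' ** P + R2 ** (mat 1 - P)"
    have R: "R *v w = T' *v (P *v w) + R2 *v (w - P *v w)" for w
      by (simp add: R_def matrix_vector_mult_add_rdistrib matrix_vector_mul_assoc[symmetric]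
          matrix_vector_mult_diff_rdistrib)
    have U: "vec.subspace ?U" by (rule subspace_cyclic_space)
    have TU: "T *v w \<in> ?U" if "w \<in> ?U" for w
      using cyclic_space_stable[OF that, of "[:0, 1:]"] by simp
    have T'U: "T' *v w \<in> ?U" if "w \<in> ?U" for w
      using that TU U by (simp add: T'_def matrix_vector_mult_add_rdistrib mat_vector_mult
          vec.subspace_add vec.subspace_scale)
    have RU: "R *v w = T' *v w" if "w \<in> ?U" for w
      using P(3)[of w] that by (simp add: R T_def)
    have RV: "R *v w = R2 *v w" if "w \<in> V" for w
      using P(4)[OF that] by (simp add: R)
    have split: "w = P *v w + (w - P *v w)" for w by simp
    have PU: "P *v w \<in> ?U" for w using P(1) by (simp add: T_def)
    have RS: "R *v w \<in> S" if "w \<in> S" for w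
    proof -
      have "T' *v (P *v w) \<in> S" using T'U[OF PU] US by blast
      moreover have "R2 *v (w - P *v w) \<in> S" using R2(2)[OF P(2)[OF that]] V(2) by blast
      ultimately show ?thesis unfolding R by (rule vec.subspace_add[OF S(1)])
    qed
    have BT: "T' *v (B *v w) = B *v (T' *v w)" for w
      by (simp add: T'_def T_def matrix_vector_mult_add_rdistrib matrix_vector_mult_diff_rdistrib
          mat_vector_mult matrix_vector_right_distrib matrix_vector_mult_diff_distrib vector_scalar_commute)
    have BU: "B *v w \<in> ?U" if "w \<in> ?U" for w
    proof -
      have "B *v w = T *v w + c *s w"
        by (simp add: T_def matrix_vector_mult_diff_rdistrib mat_vector_mult)
      then show ?thesis using that TU U by (simp add: vec.subspace_add vec.subspace_scale)
    qed
    have RB: "R *v (B *v w) = B *v (R *v w)" if "w \<in> S" for w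
    proof -
      let ?x = "P *v w" and ?y = "w - P *v w"
      have "R *v (B *v w) = R *v (B *v ?x) + R *v (B *v ?y)"
        by (simp only: matrix_vector_right_distrib[symmetric] split[symmetric])
      also have "\<dots> = B *v (T' *v ?x) + B *v (R2 *v ?y)"
        using RU[OF BU[OF PU]] RV[OF V(4)[OF P(2)[OF that]]] R2(3)[OF P(2)[OF that]] BT by simp
      also have "\<dots> = B *v (R *v w)"
        by (simp add: R matrix_vector_right_distrib)
      finally show ?thesis .
    qed
    have mU: "mpoly q R *v w = mpoly q T' *v w" if "w \<in> ?U" for q w
      by (rule mpoly_vector_cong_on[OF U T'U RU that])
    have mV: "mpoly q R *v w = mpoly q R2 *v w" if "w \<in> V" for q w
      by (rule mpoly_vector_cong_on[OF V(1) R2(2) RV that])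
    have uU: "u \<in> ?U" by (rule self_in_cyclic_space)
    have "mpoly [:-a, 1:] T' = T"
      by (simp add: T'_def mat_arith(3)[symmetric])
    then have k1: "mpoly ([:-a, 1:] ^ e) R *v u = 0"
      using mU[OF uU, of "[:-a, 1:] ^ e"] u(3) by (simp add: mpoly_power T_def)
    have k2: "mpoly p R *v v2 = 0" using mV[OF R2(1)] p(2) by simp
    \<comment> \<open>The two terms of the Bezout identity extract \<open>u\<close> and
      \<open>v2\<close> from \<open>u + v2\<close>.\<close>
    define f g where "f = s * p" and "g = r * [:-a, 1:] ^ e"
    have fg: "g + f = 1" using rs by (simp add: f_def g_def)
    have "mpoly f R *v v2 = 0" "mpoly g R *v u = 0"
      by (simp_all only: f_def g_def mpoly_vector_mult k1 k2 matrix_vector_mult_0_right)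
    moreover from this have "mpoly f R *v u = u" "mpoly g R *v v2 = v2"
      using mpoly_vector_add[of g f R u] mpoly_vector_add[of g f R v2] by (simp_all add: fg)
    ultimately have f: "mpoly f R *v (u + v2) = u" and g: "mpoly g R *v (u + v2) = v2"
      by (simp_all add: matrix_vector_right_distrib)
    let ?X = "cyclic_space R (u + v2)"
    have X: "vec.subspace ?X" by (rule subspace_cyclic_space)
    have uX: "u \<in> ?X" and v2X: "v2 \<in> ?X"
      using cyclic_space_stable[OF self_in_cyclic_space, of f R "u + v2"]
        cyclic_space_stable[OF self_in_cyclic_space, of g R "u + v2"] f g by simp_all
    have UX: "?U \<subseteq> ?X"
    proof
      fix w assume "w \<in> ?U"
      then obtain q where q: "w = mpoly q T *v u" by (auto simp: cyclic_space_def)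
      have "w = mpoly (pcompose q [:-a, 1:]) T' *v u"
        using \<open>mpoly [:-a, 1:] T' = T\<close> by (simp only: q mpoly_pcompose)
      then have "w = mpoly (pcompose q [:-a, 1:]) R *v u" by (simp only: mU[OF uU])
      then show "w \<in> ?X" using cyclic_space_stable[OF uX] by simp
    qed
    have VX: "V \<subseteq> ?X"
    proof
      fix w assume "w \<in> V"
      then obtain q where "w = mpoly q R2 *v v2" using R2(4) by (auto simp: cyclic_space_def)
      then have "w = mpoly q R *v v2" by (simp only: mV[OF R2(1)])
      then show "w \<in> ?X" using cyclic_space_stable[OF v2X] by simp
    qed
    have "P *v w + (w - P *v w) \<in> ?X" if "w \<in> S" for w
      by (rule vec.subspace_add[OF X subsetD[OF UX PU] subsetD[OF VX P(2)[OF that]]])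
    then have "S \<subseteq> ?X" by auto
    moreover have "u + v2 \<in> S" using u(1) R2(1) V(2) vec.subspace_add[OF S(1)] by blast
    ultimately show ?thesis using RS RB by blast
  qed
qed

lemma cyclic_commuting:
  fixes B :: "'a::alg_closed_field ^ 'n ^ 'n"
  assumes inf: "infinite (UNIV :: 'a set)"
  obtains R v where "R ** B = B ** R" "cyclic_space R v = UNIV"
proof -
  have "\<exists>R v. v \<in> UNIV \<and> (\<forall>w\<in>UNIV. R *v w \<in> UNIV) \<and>
      (\<forall>w\<in>UNIV. R *v (B *v w) = B *v (R *v w)) \<and> UNIV \<subseteq> cyclic_space R v"
    by (rule cyclic_commuting_on[OF inf vec.subspace_UNIV]) simp
  then obtain R v where "\<And>w. R *v (B *v w) = B *v (R *v w)" "UNIV \<subseteq> cyclic_space R v" by blast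
  then show thesis
    by (intro that[of R v]) (simp_all add: matrix_eq matrix_vector_mul_assoc top.extremum_unique)
qed

section \<open>Krylov matrices\<close>

text \<open>An arbitrary numbering of the index type, so that basis vectors can be matched with
  powers of \<open>x\<close>.\<close>

definition idx :: "nat \<Rightarrow> 'n::finite"
  where "idx = (SOME h. bij_betw h {..<CARD('n)} UNIV)"

definition num :: "'n::finite \<Rightarrow> nat"
  where "num = inv_into {..<CARD('n)} idx"

lemma bij_idx: "bij_betw (idx :: nat \<Rightarrow> 'n::finite) {..<CARD('n)} UNIV"
  unfolding idx_def
  using someI_ex[OF ex_bij_betw_nat_finite[OF finite[of "UNIV :: 'n set"]]]
  by (simp add: lessThan_atLeast0)

lemma num_less: "num (i :: 'n::finite) < CARD('n)"
  using inv_into_into[of i idx "{..<CARD('n)}"] bij_idx[where 'n="'n::finite"]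
  by (auto simp: num_def bij_betw_def)

lemma idx_num [simp]: "idx (num i) = i"
  using f_inv_into_f[of i idx "{..<CARD('n)}"] bij_idx[where 'n="'n::finite"]
  by (auto simp: num_def bij_betw_def)

lemma num_idx: "k < CARD('n::finite) \<Longrightarrow> num (idx k :: 'n) = k"
  using inv_into_f_f[of idx "{..<CARD('n)}" k] bij_idx[where 'n="'n::finite"]
  by (auto simp: num_def bij_betw_def)

lemma eq_idx_iff: "k < CARD('n::finite) \<Longrightarrow> (i :: 'n) = idx k \<longleftrightarrow> num i = k"
  using num_idx by fastforce

lemma num_idx_0 [simp]: "num (idx 0 :: 'n::finite) = 0"
  by (rule num_idx) simp

lemma sum_idx: "(\<Sum>j\<in>UNIV. f j) = (\<Sum>k<CARD('n). f (idx k :: 'n::finite))"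
  using sum.reindex_bij_betw[OF bij_idx, of f] by simp

lemma matrix_vector_mult_smult:
  "A *v (c *s x) = c *s (A *v (x :: 'a::comm_ring_1 ^ 'n))"
  by (simp add: vec_eq_iff matrix_vector_mult_def sum_distrib_left algebra_simps)

lemma matrix_vector_mult_axis:
  "A *v axis j 1 = column j (A :: 'a::comm_ring_1 ^ 'n ^ 'n)"
  by (simp add: vec_eq_iff matrix_vector_mult_def axis_def column_def if_distrib cong: if_cong)

abbreviation unit_vec :: "nat \<Rightarrow> 'a::comm_ring_1 ^ 'n"
  where "unit_vec k \<equiv> axis (idx k) 1"

lemma matrix_eq_unit_vec:
  fixes A B :: "'a::comm_ring_1 ^ 'n ^ 'n"
  assumes "\<And>k. k < CARD('n) \<Longrightarrow> A *v unit_vec k = B *v unit_vec k"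
  shows "A = B"
proof -
  have "column j A = column j B" for j
    using assms[of "num j"] num_less[of j] by (simp add: matrix_vector_mult_axis)
  then show ?thesis by (simp add: vec_eq_iff column_def)
qed

lemma matrix_vector_expand:
  fixes A :: "'a::comm_ring_1 ^ 'n ^ 'n"
  shows "A *v y = (\<Sum>k<CARD('n). y $ idx k *s (A *v unit_vec k))"
  by (subst matrix_mult_sum) (simp only: sum_idx matrix_vector_mult_axis)

text \<open>The columns are \<open>v, A v, ..., A ^ (n-1) v\<close>. The determinant turns cyclicity
  of \<open>v\<close> into the nonvanishing of a polynomial in the entries of
  \<open>A\<close>.\<close>

definition krylov :: "'a::comm_ring_1 ^ 'n ^ 'n \<Rightarrow> 'a ^ 'n \<Rightarrow> 'a ^ 'n ^ 'n"
  where "krylov A v = (\<chi> i j. (mpow A (num j) *v v) $ i)"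

lemma krylov_unit_vec: "k < CARD('n) \<Longrightarrow> krylov A v *v unit_vec k = mpow A k *v (v :: 'a::comm_ring_1 ^ 'n)"
  by (simp add: matrix_vector_mult_axis column_def krylov_def num_idx)

lemma krylov_mult_vector:
  fixes A :: "'a::comm_ring_1 ^ 'n ^ 'n"
  shows "krylov A v *v y = (\<Sum>k<CARD('n). y $ idx k *s (mpow A k *v v))"
  by (subst matrix_vector_expand) (rule sum.cong, simp_all add: krylov_unit_vec)

lemma mpoly_altdef:
  assumes "degree q \<le> m"
  shows "mpoly q A = (\<Sum>k\<le>m. mat (coeff q k) ** mpow A k)"
  using poly_as_sum_of_monoms'[OF assms] by (metis (no_types, lifting) mpoly_monom mpoly_sum sum.cong)

lemma krylov_eq_mpoly:
  fixes A :: "'a::comm_ring_1 ^ 'n ^ 'n"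
  shows "krylov A v *v y = mpoly (\<Sum>k<CARD('n). monom (y $ idx k) k) A *v v"
  by (simp add: krylov_mult_vector mpoly_sum mpoly_monom vec_sum_mult mat_vector_mult
      matrix_vector_mul_assoc[symmetric])

lemma det_nonzero_iff_ker:
  fixes A :: "'a::field ^ 'n ^ 'n"
  shows "det A \<noteq> 0 \<longleftrightarrow> (\<forall>y. A *v y = 0 \<longrightarrow> y = 0)"
  using invertible_det_nz[of A] invertible_left_inverse[of A] matrix_left_invertible_ker[of A] by simp

lemma det_nonzero_inverse:
  fixes A :: "'a::field ^ 'n ^ 'n"
  assumes "det A \<noteq> 0"
  obtains A' where "A ** A' = mat 1" "A' ** A = mat 1"
  using assms invertible_det_nz[of A] unfolding invertible_def by blast

lemma det_krylov_cyclic: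
  fixes A :: "'a::field ^ 'n ^ 'n"
  assumes "det (krylov A v) \<noteq> 0"
  shows "cyclic_space A v = UNIV"
proof -
  obtain K' where K': "krylov A v ** K' = mat 1" by (rule det_nonzero_inverse[OF assms])
  have "w \<in> cyclic_space A v" for w
  proof -
    have "w = krylov A v *v (K' *v w)" by (simp add: matrix_vector_mul_assoc K')
    then show ?thesis unfolding cyclic_space_def krylov_eq_mpoly by blast
  qed
  then show ?thesis by blast
qed

text \<open>Division with remainder by \<open>q\<close> puts every vector into the span of the first
  \<open>degree q\<close> vectors \<open>A ^ k v\<close>.\<close>

lemma cyclic_independent:
  fixes A :: "'a::field ^ 'n ^ 'n"
  assumes cyc: "cyclic_space A v = UNIV" and q: "mpoly q A *v v = 0" "q \<noteq> 0"
  shows "CARD('n) \<le> degree q"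
proof -
  let ?W = "(\<lambda>k. mpow A k *v v) ` {..<degree q}"
  have "UNIV \<subseteq> vec.span ?W"
  proof
    fix w
    obtain f where f: "w = mpoly f A *v v" using cyc by (auto simp: cyclic_space_def)
    let ?r = "f mod q"
    have "mpoly f A *v v = mpoly (f div q * q + ?r) A *v v" by simp
    also have "\<dots> = mpoly ?r A *v v"
      by (simp only: mpoly_vector_add mpoly_vector_mult q(1) matrix_vector_mult_0_right add_0)
    finally have w: "w = mpoly ?r A *v v" using f by simp
    show "w \<in> vec.span ?W"
    proof (cases "?r = 0")
      case True
      then show ?thesis using w by (simp add: vec.span_zero)
    next
      case False
      then have deg: "degree ?r < degree q" using degree_mod_less[OF q(2), of f] by simp
      have "w = (\<Sum>k\<le>degree ?r. coeff ?r k *s (mpow A k *v v))"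
        unfolding w by (subst mpoly_altdef[OF order_refl])
          (simp add: vec_sum_mult mat_vector_mult matrix_vector_mul_assoc[symmetric])
      also have "\<dots> \<in> vec.span ?W"
        using deg by (intro vec.span_sum vec.span_scale vec.span_base) auto
      finally show ?thesis .
    qed
  qed
  then have "vec.dim (UNIV :: ('a ^ 'n) set) \<le> card ?W"
    by (rule vec.dim_le_card) simp
  also have "\<dots> \<le> degree q" using card_image_le[of "{..<degree q}"] by simp
  finally show ?thesis by (simp only: vec_dim_card)
qed

lemma degree_sum_monom_less: "(\<Sum>k<m. monom (y k) k) \<noteq> 0 \<Longrightarrow> degree (\<Sum>k<m. monom (y k) k) < m"
proof (rule ccontr)
  assume nz: "(\<Sum>k<m. monom (y k) k) \<noteq> 0" and "\<not> degree (\<Sum>k<m. monom (y k) k) < m"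
  then have "coeff (\<Sum>k<m. monom (y k) k) (degree (\<Sum>k<m. monom (y k) k)) = 0"
    by (simp add: coeff_sum)
  then show False using nz by simp
qed

text \<open>A kernel vector of the Krylov matrix lists the coefficients of a polynomial of degree
  below n that annihilates \<open>v\<close>; for cyclic \<open>v\<close> it must be zero.\<close>

lemma cyclic_iff_det_krylov:
  fixes A :: "'a::field ^ 'n ^ 'n"
  shows "cyclic_space A v = UNIV \<longleftrightarrow> det (krylov A v) \<noteq> 0"
proof
  assume cyc: "cyclic_space A v = UNIV"
  show "det (krylov A v) \<noteq> 0"
    unfolding det_nonzero_iff_ker
  proof (intro allI impI)
    fix y assume "krylov A v *v y = 0"
    then have 0: "mpoly (\<Sum>k<CARD('n). monom (y $ idx k) k) A *v v = 0" by (simp only: krylov_eq_mpoly)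
    have q0: "(\<Sum>k<CARD('n). monom (y $ idx k) k) = 0"
      using cyclic_independent[OF cyc 0] degree_sum_monom_less[of "\<lambda>k. y $ idx k" "CARD('n)"] by fastforce
    have "y $ j = 0" for j
    proof -
      have "coeff (\<Sum>k<CARD('n). monom (y $ idx k) k) (num j) = y $ j"
        using num_less[of j] by (simp add: coeff_sum)
      then show ?thesis using q0 by simp
    qed
    then show "y = 0" by (simp add: vec_eq_iff)
  qed
qed (rule det_krylov_cyclic)

section \<open>Cyclic vectors under shifts, scaling and conjugation; centralizers\<close>

lemma cyclic_space_shift:
  fixes A :: "'a::field ^ 'n ^ 'n"
  shows "cyclic_space (A + mat c) v = cyclic_space A v"
proof -
  have sub: "cyclic_space (A + mat c) v \<subseteq> cyclic_space A v" for A :: "'a ^ 'n ^ 'n" and c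
  proof -
    have "A + mat c = mpoly [:c, 1:] A" by (simp add: add.commute)
    then have "mpoly q (A + mat c) = mpoly (pcompose q [:c, 1:]) A" for q
      by (simp only: mpoly_pcompose)
    then show ?thesis by (auto simp: cyclic_space_def)
  qed
  have "A + mat c + mat (- c) = A" by (simp add: mat_arith(3)[symmetric])
  with sub[of A c] sub[of "A + mat c" "- c"] show ?thesis by auto
qed

lemma cyclic_space_scale:
  fixes A :: "'a::field ^ 'n ^ 'n"
  assumes "s \<noteq> 0"
  shows "cyclic_space A v \<subseteq> cyclic_space (mat s ** A) v"
proof -
  have "A = mpoly [:0, inverse s:] (mat s ** A)"
    using assms mat_mult_commute[of "inverse s" "mat s ** A"]
    by (simp add: matrix_mul_assoc mat_mult_mat)
  then have "mpoly q A = mpoly (pcompose q [:0, inverse s:]) (mat s ** A)" for q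
    by (simp only: mpoly_pcompose)
  then show ?thesis by (auto simp: cyclic_space_def)
qed

lemma mpoly_conj:
  fixes A M M' :: "'a::comm_ring_1 ^ 'n ^ 'n"
  assumes "A ** M = M ** A'"
  shows "mpoly q A ** M = M ** mpoly q A'"
proof (induction q)
  case (pCons a q)
  have "(A ** mpoly q A) ** M = M ** (A' ** mpoly q A')"
    by (simp only: matrix_mul_assoc[symmetric] pCons.IH) (simp only: matrix_mul_assoc assms)
  then show ?case
    by (simp add: matrix_add_rdistrib matrix_add_ldistrib mat_mult_commute[of a M])
qed simp

lemma cyclic_space_conj:
  fixes A M :: "'a::field ^ 'n ^ 'n"
  assumes "A ** M = M ** A'" "det M \<noteq> 0" "cyclic_space A' v = UNIV"
  shows "cyclic_space A (M *v v) = UNIV"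
proof -
  obtain M' where M': "M ** M' = mat 1" by (rule det_nonzero_inverse[OF assms(2)])
  have "w \<in> cyclic_space A (M *v v)" for w
  proof -
    obtain q where "M' *v w = mpoly q A' *v v" using assms(3) by (auto simp: cyclic_space_def)
    then have "M *v (M' *v w) = mpoly q A *v (M *v v)"
      by (simp add: matrix_vector_mul_assoc mpoly_conj[OF assms(1)])
    then have "w = mpoly q A *v (M *v v)" by (simp add: matrix_vector_mul_assoc M')
    then show ?thesis unfolding cyclic_space_def by blast
  qed
  then show ?thesis by blast
qed

text \<open>A matrix that commutes with \<open>A\<close> is \<open>k[A]\<close>-linear, hence
  determined by the image of a generator.\<close>

lemma eq_if_commute_cyclic:
  fixes A :: "'a::field ^ 'n ^ 'n"
  assumes cyc: "cyclic_space A v = UNIV" and "A ** X = X ** A" "A ** Y = Y ** A" "X *v v = Y *v v"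
  shows "X = Y"
  unfolding matrix_eq
proof
  fix w
  obtain q where w: "w = mpoly q A *v v" using cyc by (auto simp: cyclic_space_def)
  have "X *v w = mpoly q A *v (X *v v)"
    unfolding w matrix_vector_mul_assoc mpoly_commute[OF assms(2)] ..
  also have "\<dots> = Y *v w"
    unfolding w assms(4) matrix_vector_mul_assoc mpoly_commute[OF assms(3)] ..
  finally show "X *v w = Y *v w" .
qed

text \<open>Exponents stop at n - 1, which for a cyclic \<open>A\<close> still reaches everything
  that commutes with \<open>A\<close>.\<close>

definition mcomb :: "(nat \<Rightarrow> 'a::comm_ring_1) \<Rightarrow> 'a ^ 'n ^ 'n \<Rightarrow> 'a ^ 'n ^ 'n"
  where "mcomb x A = (\<Sum>k<CARD('n). mat (x k) ** mpow A k)"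

lemma mcomb_eq_mpoly: "mcomb x A = mpoly (\<Sum>k<CARD('n). monom (x k) k) (A :: 'a::comm_ring_1 ^ 'n ^ 'n)"
  by (simp add: mcomb_def mpoly_sum mpoly_monom)

lemma mcomb_vector:
  fixes A :: "'a::comm_ring_1 ^ 'n ^ 'n"
  shows "mcomb x A *v v = krylov A v *v (\<chi> i. x (num i))"
proof -
  have "(\<Sum>k<CARD('n). monom (x k) k) = (\<Sum>k<CARD('n). monom ((\<chi> i. x (num i)) $ (idx k :: 'n)) k)"
    by (rule sum.cong) (simp_all add: num_idx)
  then show ?thesis by (simp only: mcomb_eq_mpoly krylov_eq_mpoly)
qed

lemma mcomb_commute: "A ** mcomb x A = mcomb x A ** A"
  unfolding mcomb_eq_mpoly using mpoly_commute[of A A] by metis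

lemma commuting_cyclic:
  fixes A B :: "'a::field ^ 'n ^ 'n"
  assumes cyc: "cyclic_space A v = UNIV" and "A ** B = B ** A"
  obtains x where "B = mcomb x A"
proof -
  have "det (krylov A v) \<noteq> 0" using cyc cyclic_iff_det_krylov by blast
  then obtain K' where K': "krylov A v ** K' = mat 1" by (rule det_nonzero_inverse)
  define y where "y = K' *v (B *v v)"
  have "B *v v = krylov A v *v y" by (simp add: y_def matrix_vector_mul_assoc matrix_mul_assoc K')
  also have "\<dots> = mcomb (\<lambda>k. y $ idx k) A *v v" by (simp add: mcomb_vector)
  finally have "B = mcomb (\<lambda>k. y $ idx k) A"
    by (rule eq_if_commute_cyclic[OF cyc assms(2) mcomb_commute])
  then show thesis by (rule that)
qed

section \<open>Pairs whose commutator is a scalar\<close>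

text \<open>The commutator with \<open>B\<close> obeys the product rule and takes the value
  \<open>c\<close> at \<open>A\<close>.\<close>

lemma mpoly_derivation:
  fixes A B :: "'a::idom ^ 'n ^ 'n"
  assumes "A ** B - B ** A = mat c"
  shows "mpoly q A ** B - B ** mpoly q A = mat c ** mpoly (pderiv q) A"
proof (induction q)
  case (pCons a q)
  let ?M = "mpoly q A"
  have "(A ** ?M) ** B - B ** (A ** ?M) = A ** (?M ** B - B ** ?M) + (A ** B - B ** A) ** ?M"
    by (simp add: matrix_diff_ldistrib matrix_diff_rdistrib matrix_mul_assoc)
  also have "\<dots> = A ** (mat c ** mpoly (pderiv q) A) + mat c ** ?M"
    by (simp only: pCons.IH assms)
  also have "A ** (mat c ** mpoly (pderiv q) A) = mat c ** (A ** mpoly (pderiv q) A)"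
    by (simp only: matrix_mul_assoc mat_mult_commute[of c A])
  finally show ?case
    by (simp add: pderiv_pCons mpoly_add matrix_add_ldistrib matrix_add_rdistrib
        mat_mult_commute[of a B] add.commute)
qed simp

text \<open>Multiplication by \<open>x\<close> on \<open>k[x]/(m)\<close> in the basis of powers of
  \<open>x\<close>, where \<open>m\<close> is \<open>x^n\<close> minus the sum of the
  \<open>a k x^k\<close>; hence the last column carries \<open>a\<close> without a sign.\<close>

definition companion :: "(nat \<Rightarrow> 'a::comm_ring_1) \<Rightarrow> 'a ^ 'n ^ 'n"
  where "companion a = (\<chi> i j. if Suc (num j) = CARD('n) then a (num i)
    else if num i = Suc (num j) then 1 else 0)"

text \<open>The matrix of \<open>d/dx\<close> in the basis \<open>1, x, x\<^sup>2, \<dots>\<close>.\<close>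

definition deriv_matrix :: "'a::comm_ring_1 ^ 'n ^ 'n"
  where "deriv_matrix = (\<chi> i j. if Suc (num i) = num j then of_nat (num j) else 0)"

lemma companion_unit_vec:
  "Suc k < CARD('n) \<Longrightarrow> companion a *v unit_vec k = (unit_vec (Suc k) :: 'a::comm_ring_1 ^ 'n)"
  "Suc k = CARD('n) \<Longrightarrow> companion a *v unit_vec k = ((\<chi> i. a (num i)) :: 'a::comm_ring_1 ^ 'n)"
  unfolding matrix_vector_mult_axis
  by (auto simp: column_def companion_def num_idx vec_eq_iff axis_def eq_idx_iff)

lemma deriv_matrix_unit_vec:
  "k < CARD('n) \<Longrightarrow> deriv_matrix *v unit_vec k = (of_nat k *s unit_vec (k - 1) :: 'a::comm_ring_1 ^ 'n)"
  unfolding matrix_vector_mult_axis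
  by (cases k) (auto simp: column_def deriv_matrix_def num_idx vec_eq_iff axis_def eq_idx_iff)

lemma mpow_companion_unit_vec:
  "k < CARD('n) \<Longrightarrow> mpow (companion a) k *v unit_vec 0 = (unit_vec k :: 'a::comm_ring_1 ^ 'n)"
  by (induction k) (simp_all add: matrix_vector_mul_assoc[symmetric] companion_unit_vec)

lemma krylov_companion: "krylov (companion a) (unit_vec 0) = (mat 1 :: 'a::comm_ring_1 ^ 'n ^ 'n)"
  by (rule matrix_eq_unit_vec) (simp add: krylov_unit_vec mpow_companion_unit_vec)

text \<open>The hypotheses say that the polynomial behind the companion matrix has derivative zero,
  so \<open>d/dx\<close> preserves the ideal it generates, and the product rule holds on the
  quotient.\<close>

lemma companion_deriv_matrix:
  assumes "of_nat CARD('n) = (0 :: 'a::comm_ring_1)" "\<And>k. k < CARD('n) \<Longrightarrow> of_nat k * a k = 0"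
  shows "deriv_matrix ** companion a - companion a ** deriv_matrix = (mat 1 :: 'a ^ 'n ^ 'n)"
proof (rule matrix_eq_unit_vec)
  fix k assume k: "k < CARD('n)"
  let ?e = "unit_vec :: nat \<Rightarrow> 'a ^ 'n"
  let ?C = "companion a :: 'a ^ 'n ^ 'n" and ?D = "deriv_matrix :: 'a ^ 'n ^ 'n"
  have CD: "?C *v (?D *v ?e k) = of_nat k *s ?e k"
  proof (cases k)
    case (Suc j)
    then show ?thesis using k
      by (simp only: deriv_matrix_unit_vec matrix_vector_mult_smult diff_Suc_1 companion_unit_vec)
  qed (simp add: deriv_matrix_unit_vec)
  \<comment> \<open>For the last basis vector, \<open>x * x^(n-1)\<close> is reduced to lower terms
    whose derivative vanishes; the right side is zero too, because n is zero in the ring.\<close>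
  have DC: "?D *v (?C *v ?e k) = of_nat (Suc k) *s ?e k"
  proof (cases "Suc k = CARD('n)")
    case True
    have "?D *v (\<chi> i. a (num i)) = (\<Sum>j<CARD('n). (of_nat j * a j) *s ?e (j - 1))"
      by (subst matrix_vector_expand, rule sum.cong)
        (simp_all add: deriv_matrix_unit_vec num_idx vector_smult_assoc mult.commute)
    also have "\<dots> = 0" using assms(2) by simp
    finally show ?thesis using True assms(1) by (simp only: companion_unit_vec(2) vector_smult_lzero)
  next
    case False
    then show ?thesis using k
      by (simp only: companion_unit_vec deriv_matrix_unit_vec Suc_lessI diff_Suc_1)
  qed
  show "(?D ** ?C - ?C ** ?D) *v ?e k = mat 1 *v ?e k"
    using CD DC by (simp add: matrix_vector_mult_diff_rdistrib matrix_vector_mul_assoc[symmetric]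
        vector_sadd_rdistrib)
qed

lemma krylov_companion_conj:
  fixes A :: "'a::comm_ring_1 ^ 'n ^ 'n"
  assumes "mpow A CARD('n) *v v = krylov A v *v (\<chi> i. a (num i))"
  shows "A ** krylov A v = krylov A v ** companion a"
proof (rule matrix_eq_unit_vec)
  fix k assume k: "k < CARD('n)"
  have "(A ** krylov A v) *v unit_vec k = mpow A (Suc k) *v v"
    using k by (simp add: matrix_vector_mul_assoc[symmetric] krylov_unit_vec)
  also have "\<dots> = krylov A v *v (companion a *v unit_vec k)"
  proof (cases "Suc k = CARD('n)")
    case True
    then show ?thesis by (simp only: companion_unit_vec assms)
  next
    case False
    then show ?thesis using k by (simp only: companion_unit_vec krylov_unit_vec Suc_lessI)
  qed
  finally show "(A ** krylov A v) *v unit_vec k = (krylov A v ** companion a) *v unit_vec k"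
    by (simp add: matrix_vector_mul_assoc)
qed

text \<open>
  The minimal polynomial \<open>m\<close> of a cyclic \<open>A\<close> with \<open>[A, B] = c \<noteq> 0\<close> has \<open>m' = 0\<close>, so
  \<open>A\<close> is multiplication by \<open>x\<close> on \<open>k[x]/(m)\<close> and \<open>d/dx\<close> is defined there.
\<close>

lemma scalar_commutator_normal_form:
  fixes A B :: "'a::field ^ 'n ^ 'n"
  assumes comm: "A ** B - B ** A = mat c" and "c \<noteq> 0" and char: "of_nat CARD('n) = (0 :: 'a)"
    and cyc: "cyclic_space A v = UNIV"
  obtains a x where "\<And>k. k < CARD('n) \<Longrightarrow> of_nat k * a k = 0"
    "A ** krylov A v = krylov A v ** companion a"
    "B ** krylov A v = krylov A v ** (mat (- c) ** deriv_matrix + mcomb x (companion a))"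
proof -
  let ?K = "krylov A v" and ?n = "CARD('n)"
  have "det ?K \<noteq> 0" using cyc cyclic_iff_det_krylov by blast
  then obtain K' where K': "?K ** K' = mat 1" "K' ** ?K = mat 1" by (rule det_nonzero_inverse)
  define y where "y = K' *v (mpow A ?n *v v)"
  define a where "a k = y $ idx k" for k
  have y: "mpow A ?n *v v = ?K *v y" by (simp add: y_def matrix_vector_mul_assoc matrix_mul_assoc K')
  then have AK: "A ** ?K = ?K ** companion a" by (intro krylov_companion_conj) (simp add: a_def)
  \<comment> \<open>The minimal polynomial of \<open>A\<close>, read off from \<open>A ^ n v\<close>
    in the Krylov basis.\<close>
  define m where "m = monom 1 ?n - (\<Sum>k<?n. monom (a k) k)"
  have coeff_m: "coeff m k = - a k" if "k < ?n" for k
    using that by (simp add: m_def coeff_sum)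
  have "mpoly m A *v v = 0"
    using y by (simp add: m_def mpoly_diff matrix_vector_mult_diff_rdistrib krylov_eq_mpoly mpoly_monom a_def)
  then have "mpoly m A = 0"
    using mpoly_commute[of A A m] eq_if_commute_cyclic[OF cyc, of "mpoly m A" 0] by simp
  then have "mat c ** mpoly (pderiv m) A = 0" using mpoly_derivation[OF comm, of m] by simp
  then have "mat (inverse c) ** (mat c ** mpoly (pderiv m) A) = 0" by simp
  then have 0: "mpoly (pderiv m) A *v v = 0"
    using \<open>c \<noteq> 0\<close> by (simp add: matrix_mul_assoc mat_mult_mat)
  \<comment> \<open>The derivation identity has turned \<open>m(A) = 0\<close> into
    \<open>m'(A) v = 0\<close>, and a nonzero polynomial of degree below n cannot annihilate a
    cyclic vector.\<close>
  have "pderiv m = 0"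
  proof (rule ccontr)
    assume nz: "pderiv m \<noteq> 0"
    have "coeff (pderiv m) i = 0" if "i \<ge> ?n" for i
      using that by (simp add: coeff_pderiv m_def coeff_sum)
    moreover have "lead_coeff (pderiv m) \<noteq> 0" using nz by simp
    ultimately have "degree (pderiv m) < ?n" by (metis not_le)
    with cyclic_independent[OF cyc 0 nz] show False by simp
  qed
  have a0: "of_nat k * a k = 0" if "k < ?n" for k
  proof (cases k)
    case (Suc j)
    have "coeff (pderiv m) j = 0" using \<open>pderiv m = 0\<close> by simp
    then show ?thesis using Suc coeff_m[OF that] by (simp add: coeff_pderiv)
  qed simp
  let ?C = "companion a :: 'a ^ 'n ^ 'n" and ?D = "deriv_matrix :: 'a ^ 'n ^ 'n"
  define B' where "B' = K' ** B ** ?K"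
  have KB: "B ** ?K = ?K ** B'" by (simp add: B'_def matrix_mul_assoc K')
  have C: "?C = K' ** A ** ?K" by (simp add: matrix_mul_assoc[symmetric] AK) (simp add: matrix_mul_assoc K')
  have "?C ** B' = K' ** (A ** (?K ** K') ** B) ** ?K" "B' ** ?C = K' ** (B ** (?K ** K') ** A) ** ?K"
    unfolding C B'_def by (simp_all only: matrix_mul_assoc)
  then have "?C ** B' - B' ** ?C = K' ** (A ** B - B ** A) ** ?K"
    by (simp add: K' matrix_diff_ldistrib matrix_diff_rdistrib)
  also have "\<dots> = mat c"
    unfolding comm by (simp add: mat_mult_commute[of c K', symmetric] matrix_mul_assoc[symmetric] K')
  finally have CB: "?C ** B' - B' ** ?C = mat c" .
  \<comment> \<open>\<open>B'\<close> and \<open>- c d/dx\<close> have the same commutator with the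
    companion matrix, so their difference commutes with it.\<close>
  define E where "E = B' + mat c ** ?D"
  have "?C ** E - E ** ?C = (?C ** B' - B' ** ?C) - mat c ** (?D ** ?C - ?C ** ?D)"
  proof -
    have "?C ** (mat c ** ?D) = mat c ** (?C ** ?D)"
      by (simp only: matrix_mul_assoc mat_mult_commute[of c ?C])
    then show ?thesis
      by (simp add: E_def matrix_add_ldistrib matrix_add_rdistrib matrix_diff_ldistrib matrix_mul_assoc)
  qed
  then have "?C ** E = E ** ?C"
    using companion_deriv_matrix[of a, OF char a0] by (simp add: CB)
  moreover have "cyclic_space ?C (unit_vec 0) = UNIV"
    by (rule det_krylov_cyclic) (simp add: krylov_companion)
  ultimately obtain x where x: "E = mcomb x ?C" by (metis commuting_cyclic)
  have "B' = mat (- c) ** ?D + mcomb x ?C"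
    by (simp add: x[symmetric] E_def vec_eq_iff mat_mult_nth)
  with KB have "B ** ?K = ?K ** (mat (- c) ** ?D + mcomb x ?C)" by simp
  with a0 AK show thesis by (rule that)
qed

text \<open>Cramer's formula for the inverse without the division: the entries are polynomial in
  those of \<open>A\<close>, and singular matrices are allowed.\<close>

definition adjugate :: "'a::comm_ring_1 ^ 'n ^ 'n \<Rightarrow> 'a ^ 'n ^ 'n"
  where "adjugate A = (\<chi> i j. det (\<chi> k l. if l = i then axis j 1 $ k else A $ k $ l))"

lemma adjugate_eq:
  fixes A :: "'a::field ^ 'n ^ 'n"
  assumes "A ** A' = mat 1"
  shows "adjugate A = mat (det A) ** A'"
proof -
  have "adjugate A $ i $ j = A' $ i $ j * det A" for i j
  proof -
    have "A *v (A' *v axis j 1) = axis j 1" by (simp add: matrix_vector_mul_assoc assms)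
    moreover have "(A' *v axis j 1) $ i = A' $ i $ j"
      by (simp add: matrix_vector_mult_axis column_def)
    ultimately show ?thesis
      using cramer_lemma[of i A "A' *v axis j 1"] by (simp only: adjugate_def vec_lambda_beta)
  qed
  then show ?thesis by (simp add: vec_eq_iff mat_mult_nth mult.commute)
qed

context function_algebra
begin

lemma mpow:
  fixes A :: "'x \<Rightarrow> 'a ^ 'n ^ 'n"
  assumes "\<And>i j. (\<lambda>x. A x $ i $ j) \<in> \<A>"
  shows "(\<lambda>x. mpow (A x) k $ i $ j) \<in> \<A>"
proof (induction k arbitrary: i j)
  case 0
  show ?case by (simp add: const)
next
  case (Suc k)
  show ?case using matrix_mult[OF assms Suc] by simp
qed

lemma krylov:
  fixes A :: "'x \<Rightarrow> 'a ^ 'n ^ 'n"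
  assumes "\<And>i j. (\<lambda>x. A x $ i $ j) \<in> \<A>"
  shows "(\<lambda>x. krylov (A x) v $ i $ j) \<in> \<A>"
  unfolding krylov_def by (simp, intro matrix_vector_mult mpow assms const)

lemma mcomb:
  fixes A :: "'x \<Rightarrow> 'a ^ 'n ^ 'n"
  assumes "\<And>i j. (\<lambda>x. A x $ i $ j) \<in> \<A>" "\<And>k. k < CARD('n) \<Longrightarrow> (\<lambda>x. y x k) \<in> \<A>"
  shows "(\<lambda>x. mcomb (y x) (A x) $ i $ j) \<in> \<A>"
  unfolding mcomb_def by (simp add: mat_mult_nth, intro sum mult mpow assms) simp

lemma replace_column:
  fixes A :: "'x \<Rightarrow> 'a ^ 'n ^ 'n"
  assumes "\<And>i j. (\<lambda>x. A x $ i $ j) \<in> \<A>" "\<And>i. (\<lambda>x. v x $ i) \<in> \<A>"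
  shows "(\<lambda>x. det (\<chi> i j. if j = l then v x $ i else A x $ i $ j)) \<in> \<A>"
  by (rule det) (simp, intro if_const assms)

lemma adjugate:
  fixes A :: "'x \<Rightarrow> 'a ^ 'n ^ 'n"
  assumes "\<And>i j. (\<lambda>x. A x $ i $ j) \<in> \<A>"
  shows "(\<lambda>x. adjugate (A x) $ i $ j) \<in> \<A>"
  unfolding adjugate_def by (simp, intro replace_column assms const)

end

section \<open>Coordinates on pgl\<close>

lemma mat_left_commute:
  fixes A B :: "'a::comm_ring_1 ^ 'n ^ 'n"
  shows "A ** (mat c ** B) = mat c ** (A ** B)"
  by (simp only: matrix_mul_assoc mat_mult_commute[of c A])

text \<open>Over a finite field, 1 plus the product of all \<open>x - a\<close> is a nonconstant
  polynomial without roots.\<close>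

lemma infinite_alg_closed: "infinite (UNIV :: 'a::alg_closed_field set)"
proof
  assume fin: "finite (UNIV :: 'a set)"
  define f :: "'a poly" where "f = (\<Prod>a\<in>UNIV. [:-a, 1:])"
  have f0: "poly f a = 0" for a
    unfolding f_def poly_prod using fin by (intro prod_zero bexI[of _ a]) auto
  have "f \<noteq> 0" unfolding f_def using fin by (subst prod_zero_iff) auto
  moreover have "degree (f + 1) = 0"
  proof (rule ccontr)
    assume "degree (f + 1) \<noteq> 0"
    then obtain a where "poly (f + 1) a = 0" using alg_closed_imp_poly_has_root by blast
    then show False by (simp add: f0)
  qed
  then obtain c where c: "f + 1 = [:c:]" by (rule degree_eq_zeroE)
  then have "poly (f + 1) 0 = c" by simp
  then have "c = 1" by (simp add: f0)
  with c have "f = 0" by (simp add: one_pCons)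
  ultimately show False by simp
qed

text \<open>The representative with corner entry zero. It is linear in the class, so its entries
  serve as coordinates on pgl.\<close>

lift_definition sec :: "('a::comm_ring_1, 'n::finite) pgl \<Rightarrow> 'a ^ 'n ^ 'n"
  is "\<lambda>A. A - mat (A $ idx 0 $ idx 0)"
proof -
  fix A B :: "'a ^ 'n ^ 'n"
  assume "scalar_rel A B"
  then obtain c where "A - B = mat c" by (auto simp: scalar_rel_def)
  then have "A = B + mat c" by (simp add: algebra_simps)
  then show "A - mat (A $ idx 0 $ idx 0) = B - mat (B $ idx 0 $ idx 0)"
    by (simp add: vec_eq_iff mat_def)
qed

lemma abs_pgl_eq_iff: "abs_pgl A = abs_pgl B \<longleftrightarrow> (\<exists>c. A - B = mat c)"
  by (simp add: pgl.abs_eq_iff scalar_rel_def)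

lemma abs_pgl_add_mat [simp]: "abs_pgl (A + mat c) = abs_pgl A"
  unfolding abs_pgl_eq_iff by (rule exI[of _ c]) simp

lemma sec_abs: "sec (abs_pgl A) = A - mat (A $ idx 0 $ idx 0)"
  by (rule sec.abs_eq)

lemma abs_sec [simp]: "abs_pgl (sec a) = a"
proof (induction a rule: pgl.abs_induct)
  case (1 A)
  show ?case
    unfolding sec_abs abs_pgl_eq_iff by (rule exI[of _ "- (A $ idx 0 $ idx 0)"]) (simp add: mat_arith)
qed

lemma sec_add: "sec (a + b) = sec a + sec b"
  by transfer (simp add: mat_arith(1)[symmetric])

lemma sec_scale: "sec (pgl_scale c a) $ i $ j = c * sec a $ i $ j"
  by transfer (simp add: matrix_scale_def mat_def algebra_simps)

lemma linear_sec:
  "Vector_Spaces.linear pgl2_scale (*) (\<lambda>v. sec (fst v :: ('a::field, 'n::finite) pgl) $ i $ j)"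
  "Vector_Spaces.linear pgl2_scale (*) (\<lambda>v. sec (snd v :: ('a::field, 'n::finite) pgl) $ i $ j)"
  unfolding Vector_Spaces.linear_iff
  by (simp_all add: vector_space_pgl2 vector_space_over_itself.vector_space_axioms sec_add sec_scale
      pgl2_scale_def)

lemma sec_polynomial:
  "(\<lambda>v. sec (fst v) $ i $ j) \<in> polynomial_functions pgl2_scale"
  "(\<lambda>v. sec (snd v) $ i $ j) \<in> polynomial_functions pgl2_scale"
  by (rule polynomial_functions.linear[OF linear_sec(1)], rule polynomial_functions.linear[OF linear_sec(2)])

lemma matrix_functional_expand:
  fixes g :: "'a::comm_ring_1 ^ 'n ^ 'n \<Rightarrow> 'a"
  assumes "\<And>A B. g (A + B) = g A + g B" "\<And>c A. g (matrix_scale c A) = c * g A"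
  shows "g A = (\<Sum>i\<in>UNIV. \<Sum>j\<in>UNIV. A $ i $ j * g (\<chi> k l. if k = i \<and> l = j then 1 else 0))"
proof -
  let ?E = "\<lambda>i j. (\<chi> k l. if k = i \<and> l = j then 1 else 0) :: 'a ^ 'n ^ 'n"
  have "g 0 = 0" using assms(1)[of 0 0] by simp
  then have g_sum: "g (\<Sum>s\<in>S. M s) = (\<Sum>s\<in>S. g (M s))" for M :: "'n \<Rightarrow> 'a ^ 'n ^ 'n" and S
    by (induction S rule: infinite_finite_induct) (simp_all add: assms(1))
  have "(\<Sum>i\<in>UNIV. \<Sum>j\<in>UNIV. matrix_scale (A $ i $ j) (?E i j)) $ k $ l = A $ k $ l" for k l
  proof -
    have "(\<Sum>i\<in>UNIV. \<Sum>j\<in>UNIV. matrix_scale (A $ i $ j) (?E i j)) $ k $ l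
        = (\<Sum>i\<in>UNIV. \<Sum>j\<in>UNIV. if i = k then if j = l then A $ i $ j else 0 else 0)"
      by (simp add: matrix_scale_def) (intro sum.cong refl, auto)
    also have "\<dots> = (\<Sum>i\<in>UNIV. if i = k then A $ i $ l else 0)"
      by (intro sum.cong refl) simp
    finally show ?thesis by simp
  qed
  then have "A = (\<Sum>i\<in>UNIV. \<Sum>j\<in>UNIV. matrix_scale (A $ i $ j) (?E i j))"
    by (simp add: vec_eq_iff)
  then have "g A = g (\<Sum>i\<in>UNIV. \<Sum>j\<in>UNIV. matrix_scale (A $ i $ j) (?E i j))" by simp
  then show ?thesis by (simp only: g_sum assms(2))
qed

text \<open>A linear functional on pairs of classes, pulled back to pairs of matrices, is a linear
  combination of matrix entries.\<close>

lemma polynomial_map_pgl2: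
  fixes A B :: "('i \<Rightarrow> 'a::field) \<Rightarrow> 'a ^ 'n ^ 'n"
  assumes "\<And>i j. (\<lambda>x. A x $ i $ j) \<in> coord_polys I" "\<And>i j. (\<lambda>x. B x $ i $ j) \<in> coord_polys I"
  shows "polynomial_map pgl2_scale I (\<lambda>x. (abs_pgl (A x), abs_pgl (B x)))"
proof (rule polynomial_mapI)
  fix f :: "('a, 'n) pgl \<times> ('a, 'n) pgl \<Rightarrow> 'a"
  assume "Vector_Spaces.linear pgl2_scale (*) f"
  then have f_add: "f (u + v) = f u + f v" and f_scale: "f (pgl2_scale c v) = c * f v" for u v c
    unfolding Vector_Spaces.linear_iff by (blast, blast)
  define g1 g2 where "g1 M = f (abs_pgl M, 0)" and "g2 M = f (0, abs_pgl M)" for M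
  have g1: "g1 (M + N) = g1 M + g1 N" "g1 (matrix_scale c M) = c * g1 M" for M N c
    using f_add[of "(abs_pgl M, 0)" "(abs_pgl N, 0)"] f_scale[of c "(abs_pgl M, 0)"]
    by (simp_all add: g1_def plus_pgl.abs_eq pgl_scale.abs_eq pgl2_scale_def)
  have g2: "g2 (M + N) = g2 M + g2 N" "g2 (matrix_scale c M) = c * g2 M" for M N c
    using f_add[of "(0, abs_pgl M)" "(0, abs_pgl N)"] f_scale[of c "(0, abs_pgl M)"]
    by (simp_all add: g2_def plus_pgl.abs_eq pgl_scale.abs_eq pgl2_scale_def)
  have fg: "f (abs_pgl M, abs_pgl N) = g1 M + g2 N" for M N
    using f_add[of "(abs_pgl M, 0)" "(0, abs_pgl N)"] by (simp add: g1_def g2_def)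
  define c1 where "c1 i j = g1 (\<chi> k l. if k = i \<and> l = j then 1 else 0)" for i j
  have g1e: "g1 M = (\<Sum>i\<in>UNIV. \<Sum>j\<in>UNIV. M $ i $ j * c1 i j)" for M
    unfolding c1_def by (rule matrix_functional_expand[OF g1])
  define c2 where "c2 i j = g2 (\<chi> k l. if k = i \<and> l = j then 1 else 0)" for i j
  have g2e: "g2 M = (\<Sum>i\<in>UNIV. \<Sum>j\<in>UNIV. M $ i $ j * c2 i j)" for M
    unfolding c2_def by (rule matrix_functional_expand[OF g2])
  show "(\<lambda>x. f (abs_pgl (A x), abs_pgl (B x))) \<in> coord_polys I"
    unfolding fg g1e g2e
    by (intro coord_polys.add coord_alg.sum coord_polys.mult coord_polys.const assms)
qed

text \<open>Scalars are central, so the commutator as a matrix depends only on the two classes. This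
  makes the value \<open>c\<close> a polynomial function on the commuting variety.\<close>

lemma commutator_abs_sec:
  fixes A B :: "'a::comm_ring_1 ^ 'n ^ 'n"
  shows "sec (abs_pgl A) ** sec (abs_pgl B) - sec (abs_pgl B) ** sec (abs_pgl A) = A ** B - B ** A"
proof -
  have "(A - mat a) ** (B - mat b) - (B - mat b) ** (A - mat a) = A ** B - B ** A" for a b
    by (simp add: matrix_diff_ldistrib matrix_diff_rdistrib mat_mult_mat mult.commute
        mat_mult_commute[of a B] mat_mult_commute[of b A])
  then show ?thesis by (simp only: sec_abs)
qed

lemma commuting_variety_iff:
  "(abs_pgl A, abs_pgl B) \<in> commuting_variety_pgl \<longleftrightarrow> (\<exists>c. A ** B - B ** A = mat c)"
  by (simp add: commuting_variety_pgl_def pgl_bracket.abs_eq zero_pgl_def abs_pgl_eq_iff)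

lemma commutator_polynomial:
  "(\<lambda>v. (sec (fst v) ** sec (snd v) - sec (snd v) ** sec (fst v)) $ i $ j) \<in> polynomial_functions pgl2_scale"
  by (simp, intro poly_alg.diff poly_alg.matrix_mult sec_polynomial)

lemma closedin_vanishing:
  assumes "\<And>i j. f i j \<in> polynomial_functions scl"
  shows "closedin (zariski scl) {v. \<forall>i j. f i j v = 0}"
  unfolding closedin_zariski zariski_closed_def
  by (rule exI[of _ "range (\<lambda>(i, j). f i j)"]) (use assms in \<open>auto simp: zero_locus_def\<close>)

lemma closedin_commuting_variety:
  "closedin (zariski pgl2_scale) (commuting_variety_pgl :: (('a::field, 'n::finite) pgl \<times> ('a, 'n) pgl) set)"
proof -
  let ?c = "\<lambda>v :: ('a, 'n) pgl \<times> ('a, 'n) pgl. sec (fst v) ** sec (snd v) - sec (snd v) ** sec (fst v)"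
  \<comment> \<open>The equations for a matrix to agree with the scalar matrix of its corner
    entry.\<close>
  let ?f = "\<lambda>i j v. ?c v $ i $ j - (if i = j then ?c v $ idx 0 $ idx 0 else 0)"
  have "v \<in> commuting_variety_pgl \<longleftrightarrow> (\<forall>i j. ?f i j v = 0)" for v
  proof -
    have "v \<in> commuting_variety_pgl \<longleftrightarrow> (\<exists>c. ?c v = mat c)"
      using commuting_variety_iff[of "sec (fst v)" "sec (snd v)"] by simp
    also have "\<dots> \<longleftrightarrow> ?c v = mat (?c v $ idx 0 $ idx 0)"
    proof (intro iffI exI)
      assume "\<exists>c. ?c v = mat c"
      then obtain c where c: "?c v = mat c" by blast
      have "(mat c :: 'a ^ 'n ^ 'n) $ idx 0 $ idx 0 = c" by (simp add: mat_def)
      then show "?c v = mat (?c v $ idx 0 $ idx 0)" unfolding c by simp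
    qed
    also have "\<dots> \<longleftrightarrow> (\<forall>i j. ?f i j v = 0)"
      by (subst vec_eq_iff, subst vec_eq_iff) (simp add: mat_def)
    finally show ?thesis .
  qed
  then have "commuting_variety_pgl = {v. \<forall>i j. ?f i j v = 0}" by blast
  moreover have "closedin (zariski pgl2_scale) {v. \<forall>i j. ?f i j v = 0}"
    by (intro closedin_vanishing poly_alg.diff poly_alg.if_const commutator_polynomial poly_alg.const)
  ultimately show ?thesis by simp
qed

lemma closedin_commuting_sec:
  "closedin (zariski pgl2_scale) {v :: ('a::field, 'n::finite) pgl \<times> ('a, 'n) pgl.
    sec (fst v) ** sec (snd v) - sec (snd v) ** sec (fst v) = 0}"
  using closedin_vanishing[OF commutator_polynomial] by (simp add: vec_eq_iff)

text \<open>
  Adding multiples of a matrix \<open>R\<close> with a cyclic vector that commutes with \<open>B\<close> changes neither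
  \<open>B\<close> nor \<open>[A, B]\<close>, and makes the first matrix cyclic for all but finitely many multiples.
\<close>

lemma deform_to_cyclic:
  fixes A B :: "'a::alg_closed_field ^ 'n ^ 'n"
  assumes Z: "closedin (zariski pgl2_scale) Z"
    and cyc: "\<And>A v. A ** B - B ** A = mat c \<Longrightarrow> cyclic_space A v = UNIV \<Longrightarrow> (abs_pgl A, abs_pgl B) \<in> Z"
    and AB: "A ** B - B ** A = mat c"
  shows "(abs_pgl A, abs_pgl B) \<in> Z"
proof -
  obtain R v where R: "R ** B = B ** R" "cyclic_space R v = UNIV"
    by (rule cyclic_commuting[OF infinite_alg_closed])
  have param: "(\<lambda>x. x ()) \<in> coord_polys {()}" by (rule coord_polys.coord) simp
  \<comment> \<open>Scaling \<open>A\<close> instead of \<open>R\<close> shows that a good multiple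
    exists: \<open>0 A + R\<close> is cyclic, so \<open>y A + R\<close> is cyclic for some nonzero
    \<open>y\<close>, and division by \<open>y\<close> gives the multiple \<open>inverse y\<close>
    of \<open>R\<close>.\<close>
  have \<eta>: "(\<lambda>x. det (krylov (mat (x ()) ** A + R) v)) \<in> coord_polys {()}"
    by (intro coord_alg.det coord_alg.krylov)
      (simp add: mat_mult_nth, intro coord_polys.add coord_polys.mult param coord_polys.const)
  have \<eta>0: "det (krylov (mat ((\<lambda>_. 0) ()) ** A + R) v) \<noteq> 0"
    using R(2) cyclic_iff_det_krylov by auto
  obtain y :: "unit \<Rightarrow> 'a" where y: "det (krylov (mat (y ()) ** A + R) v) \<noteq> 0" "y () \<noteq> 0"
    by (rule coord_polys_common_nonzero[OF infinite_alg_closed \<eta> param \<eta>0, of "\<lambda>_. 1"]) simp_all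
  let ?A = "\<lambda>x :: unit \<Rightarrow> 'a. A + mat (x ()) ** R"
  have entries: "(\<lambda>x. ?A x $ i $ j) \<in> coord_polys {()}" for i j
    by (simp add: mat_mult_nth, intro coord_polys.add coord_polys.mult param coord_polys.const)
  have pm: "polynomial_map pgl2_scale {()} (\<lambda>x. (abs_pgl (?A x), abs_pgl B))"
    by (intro polynomial_map_pgl2 entries coord_polys.const)
  have \<delta>: "(\<lambda>x. det (krylov (?A x) v)) \<in> coord_polys {()}"
    by (intro coord_alg.det coord_alg.krylov entries)
  have "mat (inverse (y ())) ** (mat (y ()) ** A + R) = ?A (\<lambda>_. inverse (y ()))"
    using y(2) by (simp add: matrix_add_ldistrib matrix_mul_assoc mat_mult_mat)
  moreover have "cyclic_space (mat (y ()) ** A + R) v = UNIV"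
    using y(1) cyclic_iff_det_krylov by blast
  ultimately have "cyclic_space (?A (\<lambda>_. inverse (y ()))) v = UNIV"
    using cyclic_space_scale[of "inverse (y ())" "mat (y ()) ** A + R" v] y(2) by auto
  then have \<delta>0: "det (krylov (?A (\<lambda>_. inverse (y ()))) v) \<noteq> 0"
    by (simp only: cyclic_iff_det_krylov not_False_eq_True)
  have "(abs_pgl (?A (\<lambda>_. 0)), abs_pgl B) \<in> Z"
  proof (rule polynomial_map_dense[OF infinite_alg_closed pm Z \<delta>, where x="\<lambda>_. 0"])
    show "det (krylov (?A (\<lambda>_. inverse (y ()))) v) \<noteq> 0" by (rule \<delta>0)
    fix x assume "det (krylov (?A x) v) \<noteq> 0"
    then have "cyclic_space (?A x) v = UNIV" by (rule det_krylov_cyclic)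
    moreover have "?A x ** B - B ** ?A x = mat c"
    proof -
      have "mat (x ()) ** R ** B = B ** (mat (x ()) ** R)"
        by (simp only: mat_left_commute matrix_mul_assoc[symmetric] R(1))
      then show ?thesis using AB by (simp add: matrix_add_ldistrib matrix_add_rdistrib)
    qed
    ultimately show "(abs_pgl (?A x), abs_pgl B) \<in> Z" using cyc by blast
  qed
  then show ?thesis by simp
qed

lemma conj_adjugate:
  fixes M :: "'a::field ^ 'n ^ 'n"
  assumes "M ** M' = mat 1"
  shows "M ** A ** adjugate M = mat (det M) ** (M ** A ** M')"
  unfolding adjugate_eq[OF assms] by (rule mat_left_commute)

text \<open>The adjugate in place of the inverse multiplies each conjugate by \<open>det M\<close>,
  hence the commutator by its square.\<close>

lemma commutator_conj_adjugate:
  fixes M :: "'a::field ^ 'n ^ 'n"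
  assumes "det M \<noteq> 0" "A ** B - B ** A = mat c"
  shows "(M ** A ** adjugate M) ** (M ** B ** adjugate M) - (M ** B ** adjugate M) ** (M ** A ** adjugate M)
    = mat (det M * det M * c)"
proof -
  obtain M' where M': "M ** M' = mat 1" "M' ** M = mat 1" by (rule det_nonzero_inverse[OF assms(1)])
  let ?d = "det M"
  have mult: "(mat ?d ** (M ** X ** M')) ** (mat ?d ** (M ** Y ** M')) = mat (?d * ?d) ** (M ** (X ** Y) ** M')"
    for X Y
  proof -
    have "(M ** X ** M') ** (M ** Y ** M') = M ** X ** (M' ** M) ** Y ** M'"
      by (simp only: matrix_mul_assoc)
    also have "\<dots> = M ** (X ** Y) ** M'" by (simp add: M' matrix_mul_assoc)
    finally have eq: "(M ** X ** M') ** (M ** Y ** M') = M ** (X ** Y) ** M'" .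
    have "(mat ?d ** P) ** (mat ?d ** Q) = mat (?d * ?d) ** (P ** Q)" for P Q :: "'a ^ 'n ^ 'n"
    proof -
      have "(mat ?d ** P) ** (mat ?d ** Q) = mat ?d ** (mat ?d ** (P ** Q))"
        by (simp only: matrix_mul_assoc[symmetric] mat_left_commute[of P ?d Q])
      then show ?thesis by (simp only: matrix_mul_assoc mat_mult_mat)
    qed
    then show ?thesis by (simp only: eq)
  qed
  have "(M ** A ** adjugate M) ** (M ** B ** adjugate M) - (M ** B ** adjugate M) ** (M ** A ** adjugate M)
    = mat (?d * ?d) ** (M ** (A ** B - B ** A) ** M')"
    by (simp only: conj_adjugate[OF M'(1)] mult matrix_diff_ldistrib matrix_diff_rdistrib)
  also have "M ** (A ** B - B ** A) ** M' = mat c ** (M ** M')"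
    unfolding assms(2) matrix_mul_assoc[symmetric] by (rule mat_left_commute)
  finally show ?thesis by (simp add: M' mat_mult_mat)
qed

text \<open>Conjugation along the line from \<open>1\<close> to a matrix that takes \<open>v\<close> to the first unit vector.\<close>

lemma deform_cyclic_vector:
  fixes A B :: "'a::alg_closed_field ^ 'n ^ 'n"
  assumes Z: "closedin (zariski pgl2_scale) Z"
    and cyc: "\<And>A B c. A ** B - B ** A = mat c \<Longrightarrow> c \<noteq> 0 \<Longrightarrow> cyclic_space A (unit_vec 0) = UNIV \<Longrightarrow>
      (abs_pgl A, abs_pgl B) \<in> Z"
    and AB: "A ** B - B ** A = mat c" "c \<noteq> 0" and v: "cyclic_space A v = UNIV"
  shows "(abs_pgl A, abs_pgl B) \<in> Z"
proof -
  have "det (krylov A v) \<noteq> 0" using v cyclic_iff_det_krylov by blast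
  \<comment> \<open>The first column of the Krylov matrix is \<open>v\<close>, so the inverse takes
    \<open>v\<close> to the first unit vector.\<close>
  then obtain M where M: "krylov A v ** M = mat 1" "M ** krylov A v = mat 1"
    by (rule det_nonzero_inverse)
  have "krylov A v *v unit_vec 0 = v" by (simp add: krylov_unit_vec)
  then have Mv: "M *v v = unit_vec 0" using M(2) by (metis matrix_vector_mul_assoc matrix_vector_mul_lid)
  have detM: "det M \<noteq> 0" using M(1) by (metis det_I det_mul mult_zero_right zero_neq_one)
  have param: "(\<lambda>x. x ()) \<in> coord_polys {()}" by (rule coord_polys.coord) simp
  define N where "N x = mat 1 + mat (x ()) ** (M - mat 1)" for x :: "unit \<Rightarrow> 'a"
  have N: "(\<lambda>x. N x $ i $ j) \<in> coord_polys {()}" for i j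
    unfolding N_def
    by (simp add: mat_mult_nth, intro coord_polys.add coord_polys.mult param coord_polys.const)
  define conj where "conj X x = N x ** X ** adjugate (N x)" for X x
  have conj: "(\<lambda>x. conj X x $ i $ j) \<in> coord_polys {()}" for X i j
    unfolding conj_def by (intro coord_alg.matrix_mult coord_alg.adjugate N coord_polys.const)
  have pm: "polynomial_map pgl2_scale {()} (\<lambda>x. (abs_pgl (conj A x), abs_pgl (conj B x)))"
    by (intro polynomial_map_pgl2 conj)
  have \<delta>: "(\<lambda>x. det (N x) * det (krylov (conj A x) (unit_vec 0))) \<in> coord_polys {()}"
    by (intro coord_polys.mult coord_alg.det coord_alg.krylov N conj)
  have N1: "N (\<lambda>_. 1) = M" by (simp add: N_def)
  obtain M' where M': "M ** M' = mat 1" "M' ** M = mat 1" by (rule det_nonzero_inverse[OF detM])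
  have "cyclic_space (M ** A ** M') (M *v v) = UNIV"
    by (rule cyclic_space_conj[OF _ detM v]) (simp add: matrix_mul_assoc[symmetric] M')
  then have "cyclic_space (conj A (\<lambda>_. 1)) (unit_vec 0) = UNIV"
    using cyclic_space_scale[OF detM, of "M ** A ** M'" "M *v v"]
    by (auto simp: conj_def N1 conj_adjugate[OF M'(1)] Mv)
  then have \<delta>0: "det (N (\<lambda>_. 1)) * det (krylov (conj A (\<lambda>_. 1)) (unit_vec 0)) \<noteq> 0"
    using detM by (simp add: N1 cyclic_iff_det_krylov)
  have "(abs_pgl (conj A (\<lambda>_. 0)), abs_pgl (conj B (\<lambda>_. 0))) \<in> Z"
  proof (rule polynomial_map_dense[OF infinite_alg_closed pm Z \<delta>, where x="\<lambda>_. 0"])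
    show "det (N (\<lambda>_. 1)) * det (krylov (conj A (\<lambda>_. 1)) (unit_vec 0)) \<noteq> 0" by (rule \<delta>0)
    fix x assume "det (N x) * det (krylov (conj A x) (unit_vec 0)) \<noteq> 0"
    then have d: "det (N x) \<noteq> 0" and "cyclic_space (conj A x) (unit_vec 0) = UNIV"
      by (auto simp: cyclic_iff_det_krylov)
    then show "(abs_pgl (conj A x), abs_pgl (conj B x)) \<in> Z"
      using cyc[OF commutator_conj_adjugate[OF d AB(1)]] AB(2) by (simp add: conj_def)
  qed
  moreover have "conj X (\<lambda>_. 0) = X" for X
    using adjugate_eq[of "mat 1 :: 'a ^ 'n ^ 'n" "mat 1"] by (simp add: conj_def N_def)
  ultimately show ?thesis by simp
qed

section \<open>Parametrization of the two components\<close>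

text \<open>\<open>Root k\<close> stands for the coefficient \<open>a (p * k)\<close> of the
  companion matrix, not for a root; \<open>Scal\<close> is the factor of \<open>d/dx\<close>, and
  \<open>Coef k\<close> the coefficient of degree \<open>k\<close> of \<open>q\<close>.\<close>

datatype 'n coord = Entry 'n 'n | Root nat | Scal | Coef nat

text \<open>A constant term would only add a scalar matrix, which is zero in pgl.\<close>

definition combination :: "('n coord \<Rightarrow> 'a) \<Rightarrow> nat \<Rightarrow> 'a::comm_ring_1"
  where "combination x k = (if k = 0 then 0 else x (Coef k))"

definition cyclic_matrix :: "('n coord \<Rightarrow> 'a) \<Rightarrow> 'a::comm_ring_1 ^ 'n ^ 'n"
  where "cyclic_matrix x = (\<chi> i j. if num i = 0 \<and> num j = 0 then 0 else x (Entry i j))"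

definition commuting_pair :: "('n coord \<Rightarrow> 'a::comm_ring_1) \<Rightarrow> ('a, 'n::finite) pgl \<times> ('a, 'n) pgl"
  where "commuting_pair x =
    (abs_pgl (cyclic_matrix x), abs_pgl (mcomb (combination x) (cyclic_matrix x)))"

definition commuting_coords :: "'n::finite coord set"
  where "commuting_coords = (\<lambda>(i, j). Entry i j) ` (UNIV - {(idx 0, idx 0)}) \<union> Coef ` {1..<CARD('n)}"

definition base_change :: "('n coord \<Rightarrow> 'a) \<Rightarrow> 'a::comm_ring_1 ^ 'n ^ 'n"
  where "base_change x = (\<chi> i j. if num j = 0 then if num i = 0 then 1 else 0
    else if num i = 0 \<and> num j = 1 then 0 else x (Entry i j))"

definition sparse_coeffs :: "nat \<Rightarrow> ('n coord \<Rightarrow> 'a) \<Rightarrow> nat \<Rightarrow> 'a::comm_ring_1"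
  where "sparse_coeffs p x k = (if p dvd k then x (Root (k div p)) else 0)"

definition weyl_matrix :: "nat \<Rightarrow> ('n coord \<Rightarrow> 'a) \<Rightarrow> 'a::comm_ring_1 ^ 'n ^ 'n"
  where "weyl_matrix p x =
    mat (x Scal) ** deriv_matrix + mcomb (combination x) (companion (sparse_coeffs p x))"

text \<open>
  The cyclic vector is the first unit vector and the first matrix has corner entry 0, which fixes the
  first column and one more entry of \<open>base_change x\<close>; \<open>sparse_coeffs p x\<close> describes a polynomial in \<open>x\<^sup>p\<close>.
  The adjugate replaces the inverse to make the map polynomial. The family of pairs is stable under
  a common rescaling, so the factor \<open>det (base_change x)\<close> does not change the closure of the image.
\<close>

definition weyl_pair :: "nat \<Rightarrow> ('n coord \<Rightarrow> 'a::comm_ring_1) \<Rightarrow> ('a, 'n::finite) pgl \<times> ('a, 'n) pgl"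
  where "weyl_pair p x =
    (abs_pgl (base_change x ** companion (sparse_coeffs p x) ** adjugate (base_change x)),
     abs_pgl (base_change x ** weyl_matrix p x ** adjugate (base_change x)))"

definition weyl_coords :: "nat \<Rightarrow> 'n::finite coord set"
  where "weyl_coords r = (\<lambda>(i, j). Entry i j) ` (UNIV \<times> (UNIV - {idx 0}) - {(idx 0, idx 1)})
    \<union> Root ` {..<r} \<union> {Scal} \<union> Coef ` {1..<CARD('n)}"

lemma num_eq_0_iff: "num (i :: 'n::finite) = 0 \<longleftrightarrow> i = idx 0"
  using eq_idx_iff[of 0 i] by simp

lemma num_eq_1_iff: "1 < CARD('n) \<Longrightarrow> num (i :: 'n::finite) = 1 \<longleftrightarrow> i = idx 1"
  using eq_idx_iff[of 1 i] by simp

section \<open>Number of parameters and polynomiality of the two maps\<close>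

lemma finite_commuting_coords: "finite commuting_coords"
  by (simp add: commuting_coords_def)

lemma finite_weyl_coords: "finite (weyl_coords r)"
  by (simp add: weyl_coords_def)

lemma card_commuting_coords: "card (commuting_coords :: 'n::finite coord set) = CARD('n)\<^sup>2 + CARD('n) - 2"
proof -
  have "card ((\<lambda>(i, j). Entry i j) ` (UNIV - {(idx 0, idx 0)}) :: 'n coord set) = CARD('n)\<^sup>2 - 1"
    by (subst card_image) (auto simp: inj_on_def card_Diff_singleton power2_eq_square)
  moreover have "card (Coef ` {1..<CARD('n)} :: 'n coord set) = CARD('n) - 1"
    by (subst card_image) (auto simp: inj_on_def)
  moreover have "card (commuting_coords :: 'n coord set)
    = card ((\<lambda>(i, j). Entry i j) ` (UNIV - {(idx 0, idx 0)}) :: 'n coord set) + card (Coef ` {1..<CARD('n)} :: 'n coord set)"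
    unfolding commuting_coords_def by (rule card_Un_disjoint) auto
  moreover have "CARD('n) \<ge> 1" "CARD('n)\<^sup>2 \<ge> 1" by (simp_all add: Suc_le_eq)
  ultimately show ?thesis by simp
qed

lemma card_weyl_coords:
  assumes "1 < CARD('n::finite)"
  shows "card (weyl_coords r :: 'n coord set) = CARD('n)\<^sup>2 + r - 1"
proof -
  let ?E = "(\<lambda>(i, j). Entry i j) ` (UNIV \<times> (UNIV - {idx 0}) - {(idx 0, idx 1)}) :: 'n coord set"
  have ne: "(idx 1 :: 'n) \<noteq> idx 0" using assms num_idx[of 1, where 'n='n] by (metis num_idx_0 zero_neq_one)
  have E: "card ?E = CARD('n) * (CARD('n) - 1) - 1"
    by (subst card_image)
      (use ne in \<open>auto simp: inj_on_def card_Diff_singleton card_cartesian_product\<close>)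
  have R: "card (Root ` {..<r} :: 'n coord set) = r"
    by (subst card_image) (auto simp: inj_on_def)
  have C: "card (Coef ` {1..<CARD('n)} :: 'n coord set) = CARD('n) - 1"
    by (subst card_image) (auto simp: inj_on_def)
  have "card (weyl_coords r :: 'n coord set)
    = card (?E \<union> Root ` {..<r} \<union> {Scal}) + card (Coef ` {1..<CARD('n)} :: 'n coord set)"
    unfolding weyl_coords_def by (rule card_Un_disjoint) auto
  also have "card (?E \<union> Root ` {..<r} \<union> {Scal}) = card (?E \<union> Root ` {..<r}) + card {Scal :: 'n coord}"
    by (rule card_Un_disjoint) auto
  also have "card (?E \<union> Root ` {..<r}) = card ?E + card (Root ` {..<r} :: 'n coord set)"
    by (rule card_Un_disjoint) auto
  finally have *: "card (weyl_coords r :: 'n coord set) = CARD('n) * (CARD('n) - 1) - 1 + r + 1 + (CARD('n) - 1)"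
    by (simp only: E R C) simp
  obtain m where m: "CARD('n) = Suc (Suc m)" using that[of "CARD('n) - 2"] assms by simp
  show ?thesis unfolding * m by (simp add: power2_eq_square)
qed

lemma combination_coord: "k < CARD('n) \<Longrightarrow> Coef ` {1..<CARD('n)} \<subseteq> I \<Longrightarrow>
    (\<lambda>x. combination x k) \<in> coord_polys (I :: 'n::finite coord set)"
  unfolding combination_def
  by (intro coord_alg.if_const coord_polys.const coord_polys.coord) auto

lemma polynomial_map_commuting_pair: "polynomial_map pgl2_scale commuting_coords commuting_pair"
proof -
  have A: "(\<lambda>x. cyclic_matrix x $ i $ j) \<in> coord_polys commuting_coords" for i j
    unfolding cyclic_matrix_def
    by (simp, intro coord_alg.if_const coord_polys.const coord_polys.coord)
      (auto simp: commuting_coords_def num_eq_0_iff)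
  show ?thesis
    unfolding commuting_pair_def
    by (intro polynomial_map_pgl2 coord_alg.mcomb A combination_coord) (auto simp: commuting_coords_def)
qed

lemma base_change_coord:
  assumes "1 < CARD('n)"
  shows "(\<lambda>x. base_change x $ i $ j) \<in> coord_polys (weyl_coords r :: 'n::finite coord set)"
  unfolding base_change_def vec_lambda_beta
  by (intro coord_alg.if_const coord_polys.const coord_polys.coord)
    (use num_eq_1_iff[OF assms] in \<open>auto simp: weyl_coords_def num_eq_0_iff\<close>)

lemma companion_coord:
  assumes "CARD('n) = p * r"
  shows "(\<lambda>x. (companion (sparse_coeffs p x) :: 'a::comm_ring_1 ^ 'n ^ 'n) $ i $ j)
    \<in> coord_polys (weyl_coords r :: 'n::finite coord set)"
proof -
  have "k div p < r" if "k < CARD('n)" for k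
    using that assms by (simp add: less_mult_imp_div_less mult.commute)
  then have "(\<lambda>x. sparse_coeffs p x (num i) :: 'a) \<in> coord_polys (weyl_coords r :: 'n coord set)" for i :: 'n
    unfolding sparse_coeffs_def using num_less[of i]
    by (intro coord_alg.if_const coord_polys.const coord_polys.coord) (auto simp: weyl_coords_def)
  then show ?thesis
    unfolding companion_def vec_lambda_beta by (intro coord_alg.if_const coord_polys.const)
qed

lemma polynomial_map_weyl_pair:
  assumes "1 < CARD('n::finite)" "CARD('n) = p * r"
  shows "polynomial_map pgl2_scale (weyl_coords r) (weyl_pair p :: ('n coord \<Rightarrow> 'a::field) \<Rightarrow> _)"
proof -
  have "(\<lambda>x. weyl_matrix p x $ i $ j :: 'a) \<in> coord_polys (weyl_coords r :: 'n coord set)" for i j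
    unfolding weyl_matrix_def vector_add_component mat_mult_nth
    by (intro coord_polys.add coord_polys.mult coord_polys.const coord_alg.mcomb companion_coord[OF assms(2)]
        combination_coord coord_polys.coord) (auto simp: weyl_coords_def)
  then show ?thesis
    unfolding weyl_pair_def
    by (intro polynomial_map_pgl2 coord_alg.matrix_mult coord_alg.adjugate base_change_coord[OF assms(1)]
        companion_coord[OF assms(2)])
qed

text \<open>A coordinate with respect to the columns of an invertible \<open>K\<close> can be tested
  for zero by a determinant, without inverting \<open>K\<close>. Such determinants recover the
  coefficient parameters in both dimension proofs.\<close>

lemma cramer_column:
  fixes K :: "'a::field ^ 'n ^ 'n"
  assumes "w = K *v y"
  shows "det (\<chi> i j. if j = l then w $ i else K $ i $ j) = y $ l * det K"
  unfolding assms by (rule cramer_lemma)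

lemma mcomb_drop_constant:
  fixes A :: "'a::comm_ring_1 ^ 'n ^ 'n"
  shows "mcomb x A = mcomb (\<lambda>k. if k = 0 then 0 else x k) A + mat (x 0)"
proof -
  have "{..<CARD('n)} = insert 0 {1..<CARD('n)}" by auto
  then show ?thesis by (simp add: mcomb_def add.commute)
qed

subsection \<open>Commuting pairs\<close>

lemma cyclic_commuting_in_range:
  fixes A B :: "'a::field ^ 'n ^ 'n"
  assumes "A ** B = B ** A" "cyclic_space A v = UNIV"
  shows "(abs_pgl A, abs_pgl B) \<in> range commuting_pair"
proof -
  let ?a = "A $ idx 0 $ idx 0"
  define A0 where "A0 = A + mat (- ?a)"
  have "cyclic_space A0 v = UNIV" unfolding A0_def cyclic_space_shift by (rule assms(2))
  moreover have "A0 ** B = B ** A0"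
    by (simp add: A0_def matrix_add_ldistrib matrix_add_rdistrib assms(1) mat_mult_commute)
  ultimately obtain q where q: "B = mcomb q A0" by (rule commuting_cyclic)
  define x where "x c = (case c of Entry i j \<Rightarrow> A0 $ i $ j | Coef k \<Rightarrow> q k | _ \<Rightarrow> 0)" for c
  have "cyclic_matrix x = A0"
    by (auto simp: cyclic_matrix_def x_def A0_def vec_eq_iff num_eq_0_iff mat_def)
  moreover have "combination x = (\<lambda>k. if k = 0 then 0 else q k)"
    by (auto simp: combination_def x_def)
  ultimately have "commuting_pair x = (abs_pgl A0, abs_pgl (mcomb (\<lambda>k. if k = 0 then 0 else q k) A0))"
    by (simp add: commuting_pair_def)
  moreover have "abs_pgl A0 = abs_pgl A" unfolding A0_def by (rule abs_pgl_add_mat)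
  moreover have "abs_pgl (mcomb (\<lambda>k. if k = 0 then 0 else q k) A0) = abs_pgl B"
    unfolding q mcomb_drop_constant[of q A0] by simp
  ultimately show ?thesis by (metis rangeI)
qed

lemma commuting_in_closure:
  fixes A B :: "'a::alg_closed_field ^ 'n ^ 'n"
  assumes "A ** B = B ** A"
  shows "(abs_pgl A, abs_pgl B) \<in> zariski pgl2_scale closure_of range commuting_pair"
proof (rule deform_to_cyclic[where c = 0])
  fix A :: "'a ^ 'n ^ 'n" and v assume "A ** B - B ** A = mat 0" "cyclic_space A v = UNIV"
  then show "(abs_pgl A, abs_pgl B) \<in> zariski pgl2_scale closure_of range commuting_pair"
    by (intro subsetD[OF subset_zariski_closure] cyclic_commuting_in_range) simp_all
qed (use assms in simp_all)

lemma commuting_pair_commutes: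
  fixes x :: "'n::finite coord \<Rightarrow> 'a::field"
  shows "sec (fst (commuting_pair x)) ** sec (snd (commuting_pair x))
    - sec (snd (commuting_pair x)) ** sec (fst (commuting_pair x)) = 0"
  by (simp add: commuting_pair_def commutator_abs_sec mcomb_commute)

lemma krull_dim_commuting:
  "krull_dim (subtopology (zariski pgl2_scale)
    (zariski pgl2_scale closure_of range (commuting_pair :: ('n::finite coord \<Rightarrow> 'a::alg_closed_field) \<Rightarrow> _)))
    = enat (CARD('n)\<^sup>2 + CARD('n) - 2)"
proof (rule antisym)
  let ?\<phi> = "commuting_pair :: ('n coord \<Rightarrow> 'a) \<Rightarrow> _"
  show "krull_dim (subtopology (zariski pgl2_scale) (zariski pgl2_scale closure_of range ?\<phi>))
      \<le> enat (CARD('n)\<^sup>2 + CARD('n) - 2)"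
    using krull_dim_polynomial_image_le[OF finite_commuting_coords polynomial_map_commuting_pair]
    by (simp only: card_commuting_coords)
  define \<delta> where "\<delta> x = det (krylov (cyclic_matrix x) (unit_vec 0))" for x :: "'n coord \<Rightarrow> 'a"
  \<comment> \<open>At \<open>b\<close> the matrix is the nilpotent shift, for which the first unit
    vector is cyclic.\<close>
  define b :: "'n coord \<Rightarrow> 'a" where
    "b c = (case c of Entry i j \<Rightarrow> if num i = Suc (num j) then 1 else 0 | _ \<Rightarrow> 0)" for c
  let ?A = "\<lambda>v :: ('a, 'n) pgl \<times> ('a, 'n) pgl. sec (fst v)"
  let ?B = "\<lambda>v :: ('a, 'n) pgl \<times> ('a, 'n) pgl. sec (snd v)"
  let ?K = "\<lambda>v. krylov (?A v) (unit_vec 0)"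
  \<comment> \<open>Entries are read off directly. For \<open>Coef k\<close> the determinant is
    \<open>\<delta>\<close> times coordinate \<open>k\<close> of the first column of
    \<open>?B v\<close> in the Krylov basis.\<close>
  define h where "h c v = (case c of Entry i j \<Rightarrow> ?A v $ i $ j - b c
    | Coef k \<Rightarrow> det (\<chi> i j. if j = idx k then (?B v *v unit_vec 0) $ i else ?K v $ i $ j) | _ \<Rightarrow> 0)" for c v
  have "\<delta> \<in> coord_polys commuting_coords"
  proof -
    have "(\<lambda>x. det (krylov (cyclic_matrix x) (unit_vec 0))) \<in> coord_polys commuting_coords"
      unfolding cyclic_matrix_def
      by (intro coord_alg.det coord_alg.krylov, simp, intro coord_alg.if_const coord_polys.const coord_polys.coord)
        (auto simp: commuting_coords_def num_eq_0_iff)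
    then show ?thesis by (simp add: \<delta>_def[abs_def])
  qed
  moreover have "\<delta> b \<noteq> 0"
  proof -
    have nl: "num i \<noteq> CARD('n)" for i :: 'n using num_less[of i] by simp
    have "cyclic_matrix b = companion (\<lambda>_. 0)"
      using nl by (auto simp: cyclic_matrix_def b_def companion_def vec_eq_iff)
    then show ?thesis by (simp add: \<delta>_def krylov_companion)
  qed
  moreover have "h c \<in> polynomial_functions pgl2_scale" if "c \<in> commuting_coords" for c
  proof (cases c)
    case (Entry i j)
    have "(\<lambda>v. ?A v $ i $ j - b c) \<in> polynomial_functions pgl2_scale"
      by (intro poly_alg.diff sec_polynomial poly_alg.const)
    then show ?thesis by (simp add: h_def[abs_def] Entry)
  next
    case (Coef k)
    have "(\<lambda>v. det (\<chi> i j. if j = idx k then (?B v *v unit_vec 0) $ i else ?K v $ i $ j))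
        \<in> polynomial_functions pgl2_scale"
      by (intro poly_alg.replace_column poly_alg.krylov poly_alg.matrix_vector_mult sec_polynomial poly_alg.const)
    then show ?thesis by (simp add: h_def[abs_def] Coef)
  qed (use that in \<open>auto simp: commuting_coords_def\<close>)
  moreover have "[:- b c, 1:] \<noteq> 0 \<and> poly [:- b c, 1:] (b c) = 0" for c by simp
  moreover have "h c (?\<phi> x) = 0 \<longleftrightarrow> poly [:- b c, 1:] (x c) = 0"
    if c: "c \<in> commuting_coords" and \<delta>x: "\<delta> x \<noteq> 0" for c x
  proof -
    have secA: "sec (fst (?\<phi> x)) = cyclic_matrix x"
      by (simp add: commuting_pair_def sec_abs cyclic_matrix_def)
    show ?thesis
    proof (cases c)
      case (Entry i j)
      then have "\<not> (num i = 0 \<and> num j = 0)"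
        using c by (auto simp: commuting_coords_def num_eq_0_iff)
      then show ?thesis by (auto simp: h_def Entry secA cyclic_matrix_def)
    next
      case (Coef k)
      then have k: "0 < k" "k < CARD('n)" using c by (auto simp: commuting_coords_def)
      let ?M = "cyclic_matrix x" and ?q = "combination x"
      \<comment> \<open>Passing to the chosen representative subtracts \<open>s\<close> times the
        identity, which affects only coordinate 0 of the first column, while
        \<open>k > 0\<close>.\<close>
      define s where "s = mcomb ?q ?M $ idx 0 $ idx 0"
      have "sec (snd (?\<phi> x)) *v unit_vec 0 = krylov ?M (unit_vec 0) *v ((\<chi> i. ?q (num i)) - s *s unit_vec 0)"
        by (simp add: commuting_pair_def sec_abs s_def[symmetric] matrix_vector_mult_diff_rdistrib
            mat_vector_mult mcomb_vector matrix_vector_mult_diff_distrib matrix_vector_mult_smult krylov_unit_vec)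
      from cramer_column[OF this, of "idx k"]
      have "h c (?\<phi> x) = ((\<chi> i. ?q (num i)) - s *s unit_vec 0) $ (idx k :: 'n) * \<delta> x"
        unfolding h_def Coef secA \<delta>_def by simp
      moreover have "((\<chi> i. ?q (num i)) - s *s unit_vec 0) $ (idx k :: 'n) = x c"
      proof -
        have "(idx k :: 'n) \<noteq> idx 0" using k by (metis less_numeral_extra(3) num_idx num_idx_0)
        then show ?thesis using k by (simp add: combination_def num_idx axis_def Coef)
      qed
      ultimately show ?thesis using \<delta>x by (simp add: b_def Coef)
    qed (use c in \<open>auto simp: commuting_coords_def\<close>)
  qed
  ultimately have "enat (card (commuting_coords :: 'n coord set))
    \<le> krull_dim (subtopology (zariski pgl2_scale) (zariski pgl2_scale closure_of range ?\<phi>))"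
    by (rule krull_dim_polynomial_image_ge[OF infinite_alg_closed finite_commuting_coords
          polynomial_map_commuting_pair])
  then show "enat (CARD('n)\<^sup>2 + CARD('n) - 2)
      \<le> krull_dim (subtopology (zariski pgl2_scale) (zariski pgl2_scale closure_of range ?\<phi>))"
    by (simp only: card_commuting_coords)
qed

subsection \<open>Pairs with nonzero scalar commutator\<close>

lemma conj_adjugate_mult:
  fixes M :: "'a::field ^ 'n ^ 'n"
  assumes "det M \<noteq> 0"
  shows "(M ** X ** adjugate M) ** M = mat (det M) ** (M ** X)"
proof -
  obtain M' where M': "M ** M' = mat 1" "M' ** M = mat 1" by (rule det_nonzero_inverse[OF assms])
  show ?thesis
    unfolding conj_adjugate[OF M'(1)] by (simp only: matrix_mul_assoc[symmetric] M' matrix_mul_rid)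
qed

lemma base_change_0: "base_change x *v unit_vec 0 = (unit_vec 0 :: 'a::comm_ring_1 ^ 'n)"
  unfolding matrix_vector_mult_axis
  by (auto simp: column_def base_change_def vec_eq_iff axis_def num_eq_0_iff)

lemma det_columns_scale:
  fixes M :: "'a::comm_ring_1 ^ 'n ^ 'n"
  shows "det (\<chi> i j. M $ i $ j * d ^ num j) = det M * d ^ (\<Sum>j\<in>(UNIV :: 'n set). num j)"
proof -
  let ?D = "\<chi> i j. if i = j then d ^ num j else 0 :: 'a ^ 'n ^ 'n"
  have "(\<chi> i j. M $ i $ j * d ^ num j) = M ** ?D"
    by (simp add: vec_eq_iff matrix_matrix_mult_def if_distrib cong: if_cong)
  moreover have "det ?D = d ^ (\<Sum>j\<in>(UNIV :: 'n set). num j)"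
    by (subst det_diagonal) (simp_all add: power_sum)
  ultimately show ?thesis by (simp add: det_mul)
qed

text \<open>For invertible \<open>M\<close> the hypothesis says that \<open>A\<close> is
  \<open>d\<close> times a conjugate of the companion matrix. The Krylov columns are then those of
  \<open>M\<close> scaled by powers of \<open>d\<close>, which for \<open>d = det M\<close> leaves
  finitely many candidates for each diagonal entry of \<open>M\<close>.\<close>

lemma krylov_scaled_companion:
  fixes A M :: "'a::field ^ 'n ^ 'n"
  assumes AM: "A ** M = mat d ** (M ** companion a)" and M0: "M *v unit_vec 0 = unit_vec 0"
  shows "k < CARD('n) \<Longrightarrow> mpow A k *v unit_vec 0 = d ^ k *s (M *v unit_vec k)"
    and "mpow A CARD('n) *v unit_vec 0 = d ^ CARD('n) *s (M *v (\<chi> i. a (num i)))"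
    and "krylov A (unit_vec 0) $ i $ j = M $ i $ j * d ^ num j"
    and "det (krylov A (unit_vec 0)) = det M * d ^ (\<Sum>j\<in>(UNIV :: 'n set). num j)"
proof -
  have *: "mpow A k *v (M *v w) = d ^ k *s (M *v (mpow (companion a) k *v w))" for k w
  proof (induction k)
    case (Suc k)
    have "mpow A (Suc k) *v (M *v w) = d ^ k *s (A *v (M *v (mpow (companion a) k *v w)))"
      by (simp add: matrix_vector_mul_assoc[symmetric] Suc matrix_vector_mult_smult)
    also have "A *v (M *v (mpow (companion a) k *v w)) = d *s (M *v (mpow (companion a) (Suc k) *v w))"
      unfolding matrix_vector_mul_assoc[of A M] AM
      by (simp only: mpow.simps matrix_vector_mul_assoc[symmetric] mat_vector_mult)
    finally show ?case by (simp add: vector_smult_assoc mult.commute)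
  qed simp
  show k: "mpow A k *v unit_vec 0 = d ^ k *s (M *v unit_vec k)" if "k < CARD('n)" for k
    using *[of k "unit_vec 0"] by (simp add: M0 mpow_companion_unit_vec that)
  have "mpow (companion a) CARD('n) *v unit_vec 0 = ((\<chi> i. a (num i)) :: 'a ^ 'n)"
  proof -
    obtain m where m: "CARD('n) = Suc m" by (metis not0_implies_Suc zero_less_card_finite less_numeral_extra(3))
    then have "mpow (companion a) CARD('n) *v unit_vec 0 = companion a *v (unit_vec m :: 'a ^ 'n)"
      using mpow_companion_unit_vec[of m a, where 'n="'n"] by (simp add: matrix_vector_mul_assoc[symmetric])
    then show ?thesis using companion_unit_vec(2)[of m a, where 'n="'n"] m by simp
  qed
  then show "mpow A CARD('n) *v unit_vec 0 = d ^ CARD('n) *s (M *v (\<chi> i. a (num i)))"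
    using *[of "CARD('n)" "unit_vec 0"] by (simp add: M0)
  have K: "krylov A (unit_vec 0) $ i $ j = M $ i $ j * d ^ num j" for i j
    unfolding krylov_def vec_lambda_beta k[OF num_less[of j]]
    by (simp add: matrix_vector_mult_axis column_def mult.commute)
  then show "krylov A (unit_vec 0) $ i $ j = M $ i $ j * d ^ num j" .
  have "krylov A (unit_vec 0) = (\<chi> i j. M $ i $ j * d ^ num j)" by (simp add: vec_eq_iff K)
  then show "det (krylov A (unit_vec 0)) = det M * d ^ (\<Sum>j\<in>(UNIV :: 'n set). num j)"
    by (simp only: det_columns_scale)
qed

text \<open>Both hypotheses of \<open>companion_deriv_matrix\<close> come from p: it divides n, and
  it divides every exponent where \<open>sparse_coeffs\<close> can be nonzero.\<close>

lemma companion_weyl_commutator: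
  fixes x :: "'n::finite coord \<Rightarrow> 'a::field"
  assumes "CARD('n) = p * r" "CHAR('a) = p"
  shows "companion (sparse_coeffs p x) ** weyl_matrix p x - weyl_matrix p x ** companion (sparse_coeffs p x)
    = mat (- x Scal)"
proof -
  let ?C = "companion (sparse_coeffs p x) :: 'a ^ 'n ^ 'n" and ?D = "deriv_matrix :: 'a ^ 'n ^ 'n"
  have "of_nat CARD('n) = (0 :: 'a)" "of_nat k * sparse_coeffs p x k = 0" for k
    using assms by (auto simp: of_nat_eq_0_iff_char_dvd sparse_coeffs_def)
  then have "?D ** ?C - ?C ** ?D = mat 1" by (intro companion_deriv_matrix)
  then have D: "?C ** ?D = ?D ** ?C - mat 1" by (simp add: algebra_simps)
  have "mat (x Scal) ** ?D ** ?C = mat (x Scal) ** (?D ** ?C)" by (simp only: matrix_mul_assoc)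
  then show ?thesis
    by (simp add: weyl_matrix_def matrix_add_ldistrib matrix_add_rdistrib mcomb_commute mat_left_commute D
        matrix_diff_ldistrib mat_arith(3)[symmetric])
qed

lemma weyl_pair_commutator:
  fixes x :: "'n::finite coord \<Rightarrow> 'a::field"
  assumes "CARD('n) = p * r" "CHAR('a) = p" "det (base_change x) \<noteq> 0"
  shows "sec (fst (weyl_pair p x)) ** sec (snd (weyl_pair p x))
    - sec (snd (weyl_pair p x)) ** sec (fst (weyl_pair p x))
    = mat (- (det (base_change x))\<^sup>2 * x Scal)"
  unfolding weyl_pair_def fst_conv snd_conv commutator_abs_sec
    commutator_conj_adjugate[OF assms(3) companion_weyl_commutator[OF assms(1,2)]]
  by (simp add: power2_eq_square)

text \<open>The corner entry of the product is the determinant times the entry of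
  \<open>base_change x\<close> in row 0 and column 1, which is normalised to zero; so the product
  already is the chosen representative.\<close>

lemma weyl_pair_fst:
  fixes x :: "'n::finite coord \<Rightarrow> 'a::field"
  assumes n: "1 < CARD('n)" and d: "det (base_change x) \<noteq> 0"
  shows "sec (fst (weyl_pair p x)) = base_change x ** companion (sparse_coeffs p x) ** adjugate (base_change x)"
proof -
  let ?M = "base_change x" and ?C = "companion (sparse_coeffs p x)"
  let ?A = "?M ** ?C ** adjugate ?M"
  have "?A *v unit_vec 0 = (?A ** ?M) *v unit_vec 0"
    by (simp only: matrix_vector_mul_assoc[symmetric] base_change_0)
  also have "\<dots> = det ?M *s (?M *v unit_vec 1)"
    unfolding conj_adjugate_mult[OF d]
    using companion_unit_vec(1)[of 0 "sparse_coeffs p x", where 'n="'n"] n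
    by (simp add: matrix_vector_mul_assoc[symmetric] mat_vector_mult)
  finally have "(?A *v unit_vec 0) $ idx 0 = 0"
    using n by (simp add: matrix_vector_mult_axis column_def base_change_def num_idx)
  then have "?A $ idx 0 $ idx 0 = 0" by (simp add: matrix_vector_mult_axis column_def)
  then show ?thesis by (simp add: weyl_pair_def sec_abs)
qed

lemma base_change_surj:
  fixes G :: "'a::comm_ring_1 ^ 'n ^ 'n"
  assumes "1 < CARD('n)" "G *v unit_vec 0 = unit_vec 0" "G $ idx 0 $ idx 1 = 0"
    and "\<And>i j. x (Entry i j) = G $ i $ j"
  shows "base_change x = G"
proof -
  have "column (idx 0) G = unit_vec 0" using assms(2) by (simp only: matrix_vector_mult_axis)
  then have "G $ i $ idx 0 = (if i = idx 0 then 1 else 0)" for i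
    by (simp add: column_def vec_eq_iff axis_def)
  then show ?thesis
    using assms(1,3,4) num_eq_1_iff[OF assms(1)]
    by (auto simp: base_change_def vec_eq_iff num_eq_0_iff)
qed

text \<open>The factor \<open>det G\<close> contributed by the adjugate is compensated in advance:
  the normal form is applied to \<open>s A0\<close> and \<open>s B\<close>, where \<open>G\<close>
  is the Krylov matrix of \<open>s A0\<close> and \<open>s * det G = 1\<close>.\<close>

lemma scalar_commutator_in_range:
  fixes A B :: "'a::alg_closed_field ^ 'n ^ 'n"
  assumes p: "CHAR('a) = p" "p > 0" and n: "CARD('n) = p * r" "1 < CARD('n)"
    and AB: "A ** B - B ** A = mat c" "c \<noteq> 0" and cyc: "cyclic_space A (unit_vec 0) = UNIV"
  shows "(abs_pgl A, abs_pgl B) \<in> range (weyl_pair p)"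
proof -
  let ?e = "unit_vec 0 :: 'a ^ 'n"
  define A0 where "A0 = A + mat (- (A $ idx 0 $ idx 0))"
  have A0: "A0 ** B - B ** A0 = mat c"
    using AB(1) by (simp add: A0_def matrix_add_ldistrib matrix_add_rdistrib mat_mult_commute)
  have cyc0: "cyclic_space A0 ?e = UNIV" unfolding A0_def cyclic_space_shift by (rule cyc)
  have A00: "A0 $ idx 0 $ idx 0 = 0" by (simp add: A0_def mat_def)
  let ?\<kappa> = "det (krylov A0 ?e)" and ?N = "\<Sum>j\<in>(UNIV :: 'n set). num j"
  have \<kappa>: "?\<kappa> \<noteq> 0" using cyc0 cyclic_iff_det_krylov by blast
  \<comment> \<open>Scaling \<open>A0\<close> by \<open>s\<close> multiplies column \<open>j\<close>
    of the Krylov matrix by \<open>s ^ num j\<close>, so \<open>s * det G\<close> is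
    \<open>?\<kappa> * s ^ Suc ?N\<close>, which has to be 1.\<close>
  obtain s where s: "s ^ Suc ?N = inverse ?\<kappa>" using nth_root_exists[of "Suc ?N" "inverse ?\<kappa>"] by auto
  have s0: "s \<noteq> 0" using s \<kappa> by auto
  let ?A = "mat s ** A0" and ?B = "mat s ** B"
  define G where "G = krylov ?A ?e"
  have mpow: "mpow ?A k = mat (s ^ k) ** mpow A0 k" for k
    by (induction k) (simp_all add: matrix_mul_assoc[symmetric] mat_left_commute[of A0],
        simp_all add: matrix_mul_assoc mat_mult_mat)
  have "G = (\<chi> i j. krylov A0 ?e $ i $ j * s ^ num j)"
    by (simp add: G_def krylov_def vec_eq_iff mpow matrix_vector_mul_assoc[symmetric] mat_vector_mult mult.commute)
  then have detG: "det G = ?\<kappa> * s ^ ?N" by (simp only: det_columns_scale)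
  have sd: "s * det G = 1" using s \<kappa> by (simp add: detG field_simps)
  then have dG: "det G \<noteq> 0" by auto
  have "?A ** ?B - ?B ** ?A = mat (s * s * c)"
  proof -
    have "?A ** ?B - ?B ** ?A = mat s ** (mat s ** (A0 ** B - B ** A0))"
      by (simp only: matrix_mul_assoc[symmetric] mat_left_commute[of A0] mat_left_commute[of B] matrix_diff_ldistrib)
    then show ?thesis by (simp add: A0 mat_mult_mat mult.assoc)
  qed
  moreover have "s * s * c \<noteq> 0" using s0 AB(2) by simp
  moreover have char: "of_nat CARD('n) = (0 :: 'a)" using n p by (simp add: of_nat_eq_0_iff_char_dvd)
  moreover have "cyclic_space ?A ?e = UNIV" using dG by (simp add: G_def cyclic_iff_det_krylov)
  ultimately obtain a q where a: "\<And>k. k < CARD('n) \<Longrightarrow> of_nat k * a k = 0"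
    and AG: "?A ** G = G ** companion a"
    and BG: "?B ** G = G ** (mat (- (s * s * c)) ** deriv_matrix + mcomb q (companion a))"
    using scalar_commutator_normal_form[of ?A ?B "s * s * c" ?e] unfolding G_def by metis
  obtain G' where G': "G ** G' = mat 1" by (rule det_nonzero_inverse[OF dG])
  have conj: "G ** X ** adjugate G = Y" if "(mat s ** Y) ** G = G ** X" for X Y
  proof -
    have "G ** X ** adjugate G = mat (det G) ** (((mat s ** Y) ** G) ** G')"
      unfolding conj_adjugate[OF G'] that ..
    also have "\<dots> = mat (det G) ** (mat s ** Y)"
      by (simp only: matrix_mul_assoc[symmetric] G' matrix_mul_rid)
    also have "\<dots> = Y" using sd by (simp add: matrix_mul_assoc mat_mult_mat mult.commute)
    finally show ?thesis .
  qed
  define x where "x t = (case t of Entry i j \<Rightarrow> G $ i $ j | Root k \<Rightarrow> a (p * k)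
    | Scal \<Rightarrow> - (s * s * c) | Coef k \<Rightarrow> q k)" for t
  have G0: "G *v unit_vec 0 = unit_vec 0" unfolding G_def by (subst krylov_unit_vec) simp_all
  have "G $ idx 0 $ idx 1 = (?A *v ?e) $ idx 0"
    using n(2) by (simp add: G_def krylov_def num_idx)
  also have "\<dots> = 0" by (simp add: matrix_vector_mult_axis column_def mat_mult_nth A00)
  finally have "base_change x = G" by (intro base_change_surj n(2) G0) (simp_all add: x_def)
  moreover have "companion (sparse_coeffs p x) = (companion a :: 'a ^ 'n ^ 'n)"
  proof -
    \<comment> \<open>The condition \<open>of_nat k * a k = 0\<close> forces \<open>a k = 0\<close>
      unless p divides \<open>k\<close>.\<close>
    have "sparse_coeffs p x k = a k" if "k < CARD('n)" for k
      using a[OF that] p by (auto simp: sparse_coeffs_def x_def of_nat_eq_0_iff_char_dvd)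
    then show ?thesis using num_less[where 'n="'n"] by (simp add: companion_def vec_eq_iff)
  qed
  moreover have "combination x = (\<lambda>k. if k = 0 then 0 else q k)"
    by (auto simp: combination_def x_def)
  ultimately have W: "weyl_matrix p x + mat (q 0)
      = mat (- (s * s * c)) ** deriv_matrix + mcomb q (companion a)"
    and wp: "weyl_pair p x = (abs_pgl (G ** companion a ** adjugate G), abs_pgl (G ** weyl_matrix p x ** adjugate G))"
    by (simp_all add: weyl_matrix_def weyl_pair_def mcomb_drop_constant[of q] x_def)
  have "G ** (weyl_matrix p x + mat (q 0)) ** adjugate G = B"
    by (rule conj) (simp only: W BG)
  moreover have "G ** mat (q 0) ** adjugate G = mat (det G * q 0)"
  proof -
    have "G ** mat (q 0) ** G' = mat (q 0) ** (G ** G')"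
      by (simp only: mat_mult_commute[symmetric] matrix_mul_assoc)
    then show ?thesis by (simp add: conj_adjugate[OF G'] G' mat_mult_mat)
  qed
  ultimately have "G ** weyl_matrix p x ** adjugate G + mat (det G * q 0) = B"
    by (simp add: matrix_add_ldistrib matrix_add_rdistrib)
  then have "abs_pgl (G ** weyl_matrix p x ** adjugate G) = abs_pgl B"
    by (metis abs_pgl_add_mat)
  moreover have "abs_pgl (G ** companion a ** adjugate G) = abs_pgl A"
    unfolding conj[OF AG] A0_def by (rule abs_pgl_add_mat)
  ultimately show ?thesis using wp by (metis rangeI)
qed

lemma scalar_commutator_in_closure:
  fixes A B :: "'a::alg_closed_field ^ 'n ^ 'n"
  assumes p: "CHAR('a) = p" "p > 0" and n: "CARD('n) = p * r" "1 < CARD('n)"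
    and AB: "A ** B - B ** A = mat c" "c \<noteq> 0"
  shows "(abs_pgl A, abs_pgl B) \<in> zariski pgl2_scale closure_of range (weyl_pair p)"
proof (rule deform_to_cyclic[OF closedin_closure_of _ AB(1)])
  fix A :: "'a ^ 'n ^ 'n" and v assume A: "A ** B - B ** A = mat c" "cyclic_space A v = UNIV"
  show "(abs_pgl A, abs_pgl B) \<in> zariski pgl2_scale closure_of range (weyl_pair p)"
  proof (rule deform_cyclic_vector[OF closedin_closure_of _ A(1) AB(2) A(2)])
    fix A B :: "'a ^ 'n ^ 'n" and c
    assume "A ** B - B ** A = mat c" "c \<noteq> 0" "cyclic_space A (unit_vec 0) = UNIV"
    then show "(abs_pgl A, abs_pgl B) \<in> zariski pgl2_scale closure_of range (weyl_pair p)"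
      by (intro subsetD[OF subset_zariski_closure] scalar_commutator_in_range[OF p n])
  qed
qed

lemma det_base_change_coord:
  assumes "1 < CARD('n)"
  shows "(\<lambda>x. det (base_change x :: 'a::comm_ring_1 ^ 'n ^ 'n)) \<in> coord_polys (weyl_coords r)"
  by (intro coord_alg.det base_change_coord assms)

text \<open>A base point where the base change is the identity, which shows that its determinant is
  not identically zero.\<close>

definition weyl_base :: "'n coord \<Rightarrow> 'a::comm_ring_1"
  where "weyl_base c = (case c of Entry i j \<Rightarrow> if i = j then 1 else 0 | _ \<Rightarrow> 0)"

lemma base_change_weyl_base:
  assumes "1 < CARD('n)"
  shows "base_change (weyl_base(Scal := t)) = (mat 1 :: 'a::comm_ring_1 ^ 'n ^ 'n)"
proof (rule base_change_surj[OF assms])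
  have "(idx 0 :: 'n) \<noteq> idx 1" using assms num_idx[of 1, where 'n="'n"] by (metis num_idx_0 zero_neq_one)
  then show "(mat 1 :: 'a ^ 'n ^ 'n) $ idx 0 $ idx 1 = 0" by (simp add: mat_def)
  show "(mat 1 :: 'a ^ 'n ^ 'n) *v unit_vec 0 = unit_vec 0" by (rule matrix_vector_mul_lid)
qed (simp add: weyl_base_def mat_def)

lemma base_change_weyl_base': "1 < CARD('n) \<Longrightarrow> base_change weyl_base = (mat 1 :: 'a::comm_ring_1 ^ 'n ^ 'n)"
proof -
  assume "1 < CARD('n)"
  then have "base_change (weyl_base(Scal := 0)) = (mat 1 :: 'a ^ 'n ^ 'n)"
    by (rule base_change_weyl_base)
  then show ?thesis by (simp add: weyl_base_def fun_upd_idem)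
qed

lemma krull_dim_weyl:
  assumes p: "CHAR('a::alg_closed_field) = p" "p > 0" and n: "CARD('n::finite) = p * r" "1 < CARD('n)"
  shows "krull_dim (subtopology (zariski pgl2_scale)
    (zariski pgl2_scale closure_of range (weyl_pair p :: ('n coord \<Rightarrow> 'a) \<Rightarrow> _)))
    = enat (CARD('n)\<^sup>2 + r - 1)"
proof (rule antisym)
  let ?\<phi> = "weyl_pair p :: ('n coord \<Rightarrow> 'a) \<Rightarrow> _" and ?I = "weyl_coords r :: 'n coord set"
  show "krull_dim (subtopology (zariski pgl2_scale) (zariski pgl2_scale closure_of range ?\<phi>))
      \<le> enat (CARD('n)\<^sup>2 + r - 1)"
    using krull_dim_polynomial_image_le[OF finite_weyl_coords polynomial_map_weyl_pair[OF n(2,1)]]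
    by (simp only: card_weyl_coords[OF n(2)])
  let ?N = "\<Sum>j\<in>(UNIV :: 'n set). num j" and ?e = "unit_vec 0 :: 'a ^ 'n"
  let ?b = "weyl_base :: 'n coord \<Rightarrow> 'a"
  let ?A = "\<lambda>v :: ('a, 'n) pgl \<times> ('a, 'n) pgl. sec (fst v)"
  let ?B = "\<lambda>v :: ('a, 'n) pgl \<times> ('a, 'n) pgl. sec (snd v)"
  let ?K = "\<lambda>v. krylov (?A v) ?e"
  let ?col = "\<lambda>w k v. det (\<chi> i j. if j = idx k then w v $ i else ?K v $ i $ j)"
  \<comment> \<open>On the image, column \<open>j\<close> of the Krylov matrix is that of the base
    change times \<open>d ^ num j\<close>, and its determinant is \<open>d ^ Suc ?N\<close>. A
    diagonal entry, whose base value is 1, is therefore raised to the power \<open>Suc ?N\<close> to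
    eliminate \<open>d\<close>. All other parameters vanish at the base point, and a power of
    \<open>d\<close> does not affect vanishing.\<close>
  define h where "h c v = (case c of
      Entry i j \<Rightarrow> if i = j then (?K v $ i $ i) ^ Suc ?N - det (?K v) ^ num i else ?K v $ i $ j
    | Root k \<Rightarrow> ?col (\<lambda>v. mpow (?A v) CARD('n) *v ?e) (p * k) v
    | Scal \<Rightarrow> (?A v ** ?B v - ?B v ** ?A v) $ idx 0 $ idx 0
    | Coef k \<Rightarrow> ?col (\<lambda>v. ?B v *v ?e) k v)" for c v
  define P :: "'n coord \<Rightarrow> 'a poly" where
    "P c = (case c of Entry i j \<Rightarrow> if i = j then monom 1 (Suc ?N) - 1 else [:0, 1:] | _ \<Rightarrow> [:0, 1:])" for c
  have "det (base_change ?b) \<noteq> 0" by (simp add: base_change_weyl_base'[OF n(2)])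
  moreover have "h c \<in> polynomial_functions pgl2_scale" for c
  proof -
    have K: "(\<lambda>v. ?K v $ i $ j) \<in> polynomial_functions pgl2_scale" for i j
      by (intro poly_alg.krylov sec_polynomial)
    show ?thesis
    proof (cases c)
      case (Entry i j)
      have "(\<lambda>v. if i = j then (?K v $ i $ i) ^ Suc ?N - det (?K v) ^ num i else ?K v $ i $ j)
          \<in> polynomial_functions pgl2_scale"
        by (intro poly_alg.if_const poly_alg.diff poly_alg.power poly_alg.det K)
      then show ?thesis by (simp only: h_def[abs_def] Entry coord.case)
    next
      case (Root k)
      have "?col (\<lambda>v. mpow (?A v) CARD('n) *v ?e) (p * k) \<in> polynomial_functions pgl2_scale"
        by (intro poly_alg.replace_column K poly_alg.matrix_vector_mult poly_alg.mpow sec_polynomial poly_alg.const)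
      then show ?thesis by (simp only: h_def[abs_def] Root coord.case)
    next
      case Scal
      show ?thesis by (simp only: h_def[abs_def] Scal coord.case commutator_polynomial)
    next
      case (Coef k)
      have "?col (\<lambda>v. ?B v *v ?e) k \<in> polynomial_functions pgl2_scale"
        by (intro poly_alg.replace_column K poly_alg.matrix_vector_mult sec_polynomial poly_alg.const)
      then show ?thesis by (simp only: h_def[abs_def] Coef coord.case)
    qed
  qed
  moreover have "P c \<noteq> 0 \<and> poly (P c) (?b c) = 0" for c
  proof -
    have "poly (monom 1 (Suc ?N) - 1) 0 \<noteq> (0 :: 'a)" by (simp add: poly_monom)
    then have "monom 1 (Suc ?N) - 1 \<noteq> (0 :: 'a poly)" by (metis poly_0)
    then show ?thesis by (cases c) (auto simp: P_def weyl_base_def poly_monom)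
  qed
  moreover have "h c (?\<phi> x) = 0 \<longleftrightarrow> poly (P c) (x c) = 0"
    if c: "c \<in> ?I" and \<delta>: "det (base_change x :: 'a ^ 'n ^ 'n) \<noteq> 0" for c x
  proof -
    let ?G = "base_change x :: 'a ^ 'n ^ 'n" and ?a = "sparse_coeffs p x"
    define d where "d = det ?G"
    have d0: "d \<noteq> 0" using \<delta> by (simp add: d_def)
    define A where "A = ?G ** companion ?a ** adjugate ?G"
    have secA: "?A (?\<phi> x) = A" unfolding A_def by (rule weyl_pair_fst[OF n(2) \<delta>])
    have AG: "A ** ?G = mat d ** (?G ** companion ?a)"
      unfolding A_def d_def by (rule conj_adjugate_mult[OF \<delta>])
    note kr = krylov_scaled_companion[OF AG base_change_0]
    define K where "K = krylov A ?e"
    have detK: "det K = d ^ Suc ?N" unfolding K_def kr(4) by (simp add: d_def)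
    have Kaxis: "K *v unit_vec k = d ^ k *s (?G *v unit_vec k)" if "k < CARD('n)" for k
      unfolding K_def using that by (simp only: krylov_unit_vec kr(1))
    \<comment> \<open>Passing from the columns of the base change to those of \<open>K\<close>
      divides the coordinates by powers of \<open>d\<close>.\<close>
    have Kmult: "K *v (\<chi> i. y (num i) / d ^ num i) = ?G *v (\<chi> i. y (num i))" for y
      by (subst (1 2) matrix_vector_expand, rule sum.cong)
        (use d0 in \<open>simp_all add: num_idx Kaxis vector_smult_assoc\<close>)
    show ?thesis
    proof (cases c)
      case (Entry i j)
      have x: "?G $ i $ j = x c"
        using c n(2) num_eq_1_iff[OF n(2)] by (auto simp: weyl_coords_def Entry base_change_def num_eq_0_iff)
      have Kij: "K $ i $ j = x c * d ^ num j" unfolding K_def kr(3) x ..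
      show ?thesis
      proof (cases "i = j")
        case True
        have "(K $ i $ i) ^ Suc ?N - det K ^ num i = (d ^ num i) ^ Suc ?N * (x c ^ Suc ?N - 1)"
          using Kij True unfolding detK
          by (simp add: power_mult_distrib power_mult[symmetric] mult.commute algebra_simps
              power_add[symmetric])
        then show ?thesis
          using d0 True unfolding h_def P_def Entry coord.case secA K_def[symmetric]
          by (simp add: poly_monom Entry del: power_Suc)
      next
        case False
        then show ?thesis
          using d0 Kij unfolding h_def P_def Entry coord.case secA K_def[symmetric] by simp
      qed
    next
      case (Root k)
      have k: "k < r" using c by (auto simp: weyl_coords_def Root)
      then have pk: "p * k < CARD('n)" using n p(2) by simp
      have "mpow A CARD('n) *v ?e = K *v (d ^ CARD('n) *s (\<chi> i. ?a (num i) / d ^ num i))"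
        unfolding kr(2) matrix_vector_mult_smult Kmult ..
      from cramer_column[OF this, of "idx (p * k)"]
      have "h c (?\<phi> x) = d ^ CARD('n) * (?a (p * k) / d ^ (p * k)) * det K"
        unfolding h_def Root coord.case secA K_def[symmetric] by (simp add: num_idx[OF pk])
      moreover have "?a (p * k) = x c" using p(2) by (simp add: sparse_coeffs_def Root)
      ultimately show ?thesis using d0 by (simp add: detK P_def Root)
    next
      case Scal
      have "h c (?\<phi> x) = - d\<^sup>2 * x Scal"
        unfolding h_def Scal coord.case weyl_pair_commutator[OF n(1) p(1) \<delta>] by (simp add: mat_def d_def)
      then show ?thesis using d0 by (simp add: P_def Scal)
    next
      case (Coef k)
      have k: "0 < k" "k < CARD('n)" using c by (auto simp: weyl_coords_def Coef)
      let ?q = "combination x"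
      define B where "B = ?G ** weyl_matrix p x ** adjugate ?G"
      define s where "s = B $ idx 0 $ idx 0"
      have "B *v ?e = (B ** ?G) *v ?e" by (simp only: matrix_vector_mul_assoc[symmetric] base_change_0)
      also have "\<dots> = d *s (?G *v (weyl_matrix p x *v ?e))"
        unfolding B_def conj_adjugate_mult[OF \<delta>]
        by (simp only: d_def matrix_vector_mul_assoc[symmetric] mat_vector_mult)
      \<comment> \<open>The derivative of the constant 1 is zero, so only \<open>q\<close>
        contributes to the first column.\<close>
      also have "weyl_matrix p x *v ?e = (\<chi> i. ?q (num i))"
        by (simp add: weyl_matrix_def matrix_vector_mult_add_rdistrib matrix_vector_mul_assoc[symmetric]
            deriv_matrix_unit_vec mcomb_vector krylov_companion)
      finally have "B *v ?e = K *v (d *s (\<chi> i. ?q (num i) / d ^ num i))"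
        by (simp only: matrix_vector_mult_smult Kmult)
      moreover have "K *v ?e = ?e" using Kaxis[of 0] by (simp add: base_change_0)
      moreover have "?B (?\<phi> x) = B - mat s" by (simp add: weyl_pair_def sec_abs B_def s_def)
      ultimately have "?B (?\<phi> x) *v ?e = K *v (d *s (\<chi> i. ?q (num i) / d ^ num i) - s *s ?e)"
        by (simp add: matrix_vector_mult_diff_rdistrib mat_vector_mult matrix_vector_mult_diff_distrib
            matrix_vector_mult_smult)
      from cramer_column[OF this, of "idx k"]
      have "h c (?\<phi> x) = (d *s (\<chi> i. ?q (num i) / d ^ num i) - s *s ?e) $ (idx k :: 'n) * det K"
        unfolding h_def Coef coord.case secA K_def[symmetric] .
      moreover have "(d *s (\<chi> i. ?q (num i) / d ^ num i) - s *s ?e) $ (idx k :: 'n) = d * (x c / d ^ k)"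
      proof -
        have "(idx k :: 'n) \<noteq> idx 0" using k by (metis less_numeral_extra(3) num_idx num_idx_0)
        then show ?thesis using k by (simp add: combination_def num_idx axis_def Coef)
      qed
      ultimately show ?thesis using d0 by (simp add: detK P_def Coef)
    qed
  qed
  ultimately have "enat (card ?I)
    \<le> krull_dim (subtopology (zariski pgl2_scale) (zariski pgl2_scale closure_of range ?\<phi>))"
    by (intro krull_dim_polynomial_image_ge[OF infinite_alg_closed finite_weyl_coords
          polynomial_map_weyl_pair[OF n(2,1)] det_base_change_coord[OF n(2)], where b = ?b and h = h and P = P])
  then show "enat (CARD('n)\<^sup>2 + r - 1)
      \<le> krull_dim (subtopology (zariski pgl2_scale) (zariski pgl2_scale closure_of range ?\<phi>))"
    by (simp only: card_weyl_coords[OF n(2)])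
qed

subsection \<open>The two components\<close>

text \<open>The only diagonal entry of the companion matrix that might be nonzero is the last one,
  \<open>a (n-1)\<close>, and p does not divide n - 1. Conjugation with the adjugate only scales the
  trace, and its vanishing is a closed condition.\<close>

lemma weyl_closure_trace:
  assumes p: "CHAR('a::alg_closed_field) = p" "p > 0" and n: "CARD('n::finite) = p * r" "1 < CARD('n)"
    and v: "v \<in> zariski pgl2_scale closure_of range (weyl_pair p :: ('n coord \<Rightarrow> 'a) \<Rightarrow> _)"
  shows "trace (sec (fst v)) = 0"
proof -
  have tr: "(\<lambda>v. trace (sec (fst v :: ('a, 'n) pgl))) \<in> polynomial_functions pgl2_scale"
    unfolding trace_def by (intro poly_alg.sum sec_polynomial)
  have "weyl_pair p x \<in> {v. trace (sec (fst v)) = 0}" for x :: "'n coord \<Rightarrow> 'a"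
  proof (rule polynomial_map_dense[OF infinite_alg_closed polynomial_map_weyl_pair[OF n(2,1)]
        closedin_zero_set[OF tr] det_base_change_coord[OF n(2)], where b = weyl_base])
    show "det (base_change weyl_base :: 'a ^ 'n ^ 'n) \<noteq> 0" by (simp add: base_change_weyl_base'[OF n(2)])
    fix x assume d: "det (base_change x :: 'a ^ 'n ^ 'n) \<noteq> 0"
    let ?G = "base_change x :: 'a ^ 'n ^ 'n" and ?C = "companion (sparse_coeffs p x) :: 'a ^ 'n ^ 'n"
    obtain G' where G': "?G ** G' = mat 1" "G' ** ?G = mat 1" by (rule det_nonzero_inverse[OF d])
    have ndvd: "\<not> p dvd CARD('n) - 1"
    proof
      assume "p dvd CARD('n) - 1"
      moreover have "p dvd CARD('n)" using n by simp
      ultimately have "p dvd 1" using n(2) by (metis One_nat_def dvd_diffD1 less_imp_le)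
      then show False using p(1) CHAR_not_1' by simp
    qed
    have "?C $ j $ j = 0" for j
    proof (cases "Suc (num j) = CARD('n)")
      case True
      then have "num j = CARD('n) - 1" by simp
      then have "\<not> p dvd num j" using ndvd by simp
      then show ?thesis by (simp add: companion_def sparse_coeffs_def)
    qed (simp add: companion_def)
    then have "trace ?C = 0" by (simp add: trace_def)
    have "trace (?G ** ?C ** adjugate ?G) = trace (adjugate ?G ** (?G ** ?C))"
      by (rule trace_mul_sym)
    also have "adjugate ?G ** (?G ** ?C) = mat (det ?G) ** ?C"
      unfolding adjugate_eq[OF G'(1)] by (simp add: matrix_mul_assoc[symmetric]) (simp add: matrix_mul_assoc G')
    also have "trace \<dots> = det ?G * trace ?C" by (simp add: trace_def mat_mult_nth sum_distrib_left)
    finally show "weyl_pair p x \<in> {v. trace (sec (fst v)) = 0}"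
      using \<open>trace ?C = 0\<close> by (simp add: weyl_pair_fst[OF n(2) d])
  qed
  then have "trace (sec (fst u)) = 0" if "u \<in> range (weyl_pair p :: ('n coord \<Rightarrow> 'a) \<Rightarrow> _)" for u
    using that by blast
  then show ?thesis by (rule zariski_closure_vanish[OF tr _ v])
qed

theorem corollaryB:
  fixes C :: "(('k::alg_closed_field, 'n::finite) pgl \<times> ('k, 'n) pgl) set"
    and n p r :: nat
  assumes "CHAR('k) = p" and "p > 0"
    and "CARD('n) = n" and "n = p * r"
    and "C = commuting_variety_pgl"
  shows "\<exists>Z1 Z2. Z1 \<noteq> Z2 \<and>
    irreducible_components (subtopology (zariski pgl2_scale) C) = {Z1, Z2} \<and>
    krull_dim (subtopology (zariski pgl2_scale) Z1) = enat (n\<^sup>2 + n - 2) \<and>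
    krull_dim (subtopology (zariski pgl2_scale) Z2) = enat (n\<^sup>2 + r - 1)"
proof -
  have card: "CARD('n) = p * r" using assms by simp
  \<comment> \<open>A characteristic is never 1, so n is at least 2 and the index
    \<open>idx 1\<close> of the normalisation differs from \<open>idx 0\<close>.\<close>
  have "p \<noteq> 1" using assms(1) CHAR_not_1' by auto
  moreover have "r \<noteq> 0" using card by (metis mult_0_right zero_less_card_finite less_numeral_extra(3))
  ultimately have n1: "1 < CARD('n)"
    using assms(2) card by (metis One_nat_def Suc_lessI nat_1_eq_mult_iff nat_0_less_mult_iff neq0_conv)
  define \<phi>1 :: "('n coord \<Rightarrow> 'k) \<Rightarrow> _" where "\<phi>1 = commuting_pair"
  define \<phi>2 :: "('n coord \<Rightarrow> 'k) \<Rightarrow> _" where "\<phi>2 = weyl_pair p"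
  let ?X = "zariski pgl2_scale :: (('k, 'n) pgl \<times> ('k, 'n) pgl) topology"
  define Z1 where "Z1 = ?X closure_of range \<phi>1"
  define Z2 where "Z2 = ?X closure_of range \<phi>2"
  have pm1: "polynomial_map pgl2_scale commuting_coords \<phi>1"
    unfolding \<phi>1_def by (rule polynomial_map_commuting_pair)
  have pm2: "polynomial_map pgl2_scale (weyl_coords r) \<phi>2"
    unfolding \<phi>2_def by (rule polynomial_map_weyl_pair[OF n1 card])
  have Cl: "closedin ?X C" unfolding assms(5) by (rule closedin_commuting_variety)
  have comm1: "sec (fst v) ** sec (snd v) - sec (snd v) ** sec (fst v) = 0" if "v \<in> Z1" for v
  proof -
    have "Z1 \<subseteq> {v. sec (fst v) ** sec (snd v) - sec (snd v) ** sec (fst v) = 0}"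
      unfolding Z1_def \<phi>1_def
      by (rule closure_of_minimal[OF _ closedin_commuting_sec], rule image_subsetI, rule CollectI,
          rule commuting_pair_commutes)
    with that show ?thesis by blast
  qed
  have C_iff: "v \<in> C \<longleftrightarrow> (\<exists>c. sec (fst v) ** sec (snd v) - sec (snd v) ** sec (fst v) = mat c)" for v
    using commuting_variety_iff[of "sec (fst v)" "sec (snd v)"] by (simp add: assms(5))
  have "Z1 \<subseteq> C" using comm1 C_iff by (metis mat_0 subsetI)
  moreover have "Z2 \<subseteq> C"
    unfolding Z2_def
  proof (rule closure_of_minimal[OF _ Cl], rule image_subsetI)
    fix x
    \<comment> \<open>The commutator is computed where the base change is invertible; density covers
      the singular ones.\<close>
    show "\<phi>2 x \<in> C"
    proof (rule polynomial_map_dense[OF infinite_alg_closed pm2 Cl det_base_change_coord[OF n1], where b = weyl_base])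
      show "det (base_change weyl_base :: 'k ^ 'n ^ 'n) \<noteq> 0" by (simp add: base_change_weyl_base'[OF n1])
      fix x assume "det (base_change x :: 'k ^ 'n ^ 'n) \<noteq> 0"
      from weyl_pair_commutator[OF card assms(1) this] show "\<phi>2 x \<in> C"
        unfolding C_iff \<phi>2_def by blast
    qed
  qed
  moreover have "C \<subseteq> Z1 \<union> Z2"
  proof
    fix v assume "v \<in> C"
    then obtain c where c: "sec (fst v) ** sec (snd v) - sec (snd v) ** sec (fst v) = mat c"
      unfolding C_iff by blast
    show "v \<in> Z1 \<union> Z2"
    proof (cases "c = 0")
      case True
      then have "v \<in> Z1"
        using commuting_in_closure[of "sec (fst v)" "sec (snd v)"] c by (simp add: Z1_def \<phi>1_def)
      then show ?thesis ..
    next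
      case False
      then have "v \<in> Z2"
        using scalar_commutator_in_closure[OF assms(1,2) card n1 c] by (simp add: Z2_def \<phi>2_def)
      then show ?thesis ..
    qed
  qed
  ultimately have "C = Z1 \<union> Z2" by blast
  moreover have "\<not> Z1 \<subseteq> Z2"
  proof
    assume sub: "Z1 \<subseteq> Z2"
    have ne: "(idx 0 :: 'n) \<noteq> idx 1" using n1 num_idx[of 1, where 'n="'n"] by (metis num_idx_0 zero_neq_one)
    \<comment> \<open>A diagonal matrix unit away from the corner, so that \<open>sec\<close> leaves
      its trace 1 intact.\<close>
    define x :: "'n coord \<Rightarrow> 'k"
      where "x c = (case c of Entry i j \<Rightarrow> if i = idx 1 \<and> j = idx 1 then 1 else 0 | _ \<Rightarrow> 0)" for c
    have "\<phi>1 x \<in> Z2" using sub subset_zariski_closure[of "range \<phi>1"] unfolding Z1_def by blast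
    then have "trace (sec (fst (\<phi>1 x))) = 0"
      unfolding Z2_def \<phi>2_def by (rule weyl_closure_trace[OF assms(1,2) card n1])
    moreover have "sec (fst (\<phi>1 x)) = (\<chi> i j. if i = idx 1 \<and> j = idx 1 then 1 else 0)"
      using ne by (auto simp: \<phi>1_def commuting_pair_def sec_abs cyclic_matrix_def x_def vec_eq_iff num_eq_0_iff)
    ultimately show False by (simp add: trace_def)
  qed
  moreover have "\<not> Z2 \<subseteq> Z1"
  proof
    assume sub: "Z2 \<subseteq> Z1"
    \<comment> \<open>The pair at this parameter has commutator -1, while commutators vanish on
      \<open>Z1\<close>.\<close>
    define x :: "'n coord \<Rightarrow> 'k" where "x = weyl_base(Scal := 1)"
    have "\<phi>2 x \<in> Z1" using sub subset_zariski_closure[of "range \<phi>2"] unfolding Z2_def by blast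
    then have "mat (- (det (base_change x :: 'k ^ 'n ^ 'n))\<^sup>2 * x Scal) = (0 :: 'k ^ 'n ^ 'n)"
      using comm1 weyl_pair_commutator[OF card assms(1), of x]
      by (simp add: \<phi>2_def x_def base_change_weyl_base[OF n1])
    then have "(mat (- 1) :: 'k ^ 'n ^ 'n) $ idx 0 $ idx 0 = (0 :: 'k ^ 'n ^ 'n) $ idx 0 $ idx 0"
      by (simp add: x_def base_change_weyl_base[OF n1])
    then show False by (simp add: mat_def)
  qed
  moreover have "closedin ?X Z1" "closedin ?X Z2" by (simp_all add: Z1_def Z2_def)
  moreover have "irreducible_in ?X Z1" "irreducible_in ?X Z2"
    unfolding Z1_def Z2_def
    by (rule irreducible_in_polynomial_image[OF infinite_alg_closed pm1],
        rule irreducible_in_polynomial_image[OF infinite_alg_closed pm2])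
  ultimately have "irreducible_components (subtopology ?X C) = {Z1, Z2}"
    by (intro irreducible_components_Un)
  moreover have "Z1 \<noteq> Z2" using \<open>\<not> Z1 \<subseteq> Z2\<close> by blast
  moreover have "krull_dim (subtopology ?X Z1) = enat (n\<^sup>2 + n - 2)"
    unfolding Z1_def \<phi>1_def krull_dim_commuting assms(3) ..
  moreover have "krull_dim (subtopology ?X Z2) = enat (n\<^sup>2 + r - 1)"
    unfolding Z2_def \<phi>2_def krull_dim_weyl[OF assms(1,2) card n1] assms(3) ..
  ultimately show ?thesis by blast
qed

end
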